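(* Let $N\in\mathbb{N}$, $k_2\ge0$, $x,w\in C_N^B$, $t>0$, and write $k=(k_1,k_2)$. Then $$X^{B,k_1w}_{t/k_1,k,x}\ \longrightarrow\ y_{x,w,t}:=(y_{x_1,w_1,t},\ldots,y_{x_N,w_N,t})\quad\text{in probability for } k_1\to\infty,$$ where $y_{x_i,w_i,t}:=\sqrt{x_i^2+w_i^2t^2+2t\sqrt{x_i^2w_i^2+1}}$. This convergence is locally uniform in $x,w\in C_N^B$ and $t>0$ in the sense that for all $\epsilon>0$ and all compact sets $U\subset C_N^B\times C_N^B\times\,]0,\infty[$, $$\sup_{(x,w,t)\in U}P\big(\|X^{B,k_1w}_{t/k_1,k,x}-y_{x,w,t}\|\ge\epsilon\big)\ \longrightarrow\ 0\qquad\text{for } k_1\to\infty.$$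
   Context: $C_N^B:=\{x\in\mathbb{R}^N: x_1\ge x_2\ge\ldots\ge x_N\ge 0\}$. The root system of type $B_N$ is $\{\pm e_i\}\cup\{\pm e_i\pm e_j: i<j\}$, with multiplicity $k=(k_1,k_2)$, $k_1,k_2\ge0$, where $k_1$ belongs to $\pm e_i$ and $k_2$ to $\pm e_i\pm e_j$. Let $R_+=\{e_i\}\cup\{e_i\pm e_j: i<j\}$, $\sigma_\alpha$ the reflection in the hyperplane orthogonal to $\alpha$, and $W$ the generated reflection group (of order $2^NN!$). The Dunkl operators are $T_\xi f(x)=\partial_\xi f(x)+\sum_{\alpha\in R_+}k(\alpha)\langle\alpha,\xi\rangle\frac{f(x)-f(\sigma_\alpha x)}{\langle\alpha,x\rangle}$; the Dunkl kernel $E_k(\cdot,y)$ is the unique analytic solution of $T_\xi f=\langle\xi,y\rangle f$ for all $\xi\in\mathbb{R}^N$, $f(0)=1$; and $J^B_k(x,y)=\frac{1}{|W|}\sum_{g\in W}E_k(x,gy)$ is the Bessel function of type $B_N$ (for $N=1$ it does not depend on $k_2$). For $w\in C_N^B$ (the drift) and $x\in C_N^B$, the Bessel process $(X^{B,w}_{t,k,x})_{t\ge0}$ of type $B_N$ with multiplicity $k=(k_1,k_2)$, drift $w$ and starting point $x$ is the continuous Feller diffusion on $C_N^B$ started in $x$ with transition probabilities, for $t>0$ and Borel sets $A\subset C_N^B$, $$K^{B,w}_{t,k}(x,A)=\frac{2^NN!\,c_k\,e^{-\|w\|_2^2t/2}}{t^{\gamma_k+N/2}}\int_A e^{-(\|x\|_2^2+\|y\|_2^2)/(2t)}\,\frac{J^B_k(\frac{x}{\sqrt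 t},\frac{y}{\sqrt t})\,J^B_k(y,w)}{J^B_k(x,w)}\,w_k(y)\,dy,$$ where $w_k(y)=\prod_{i<j}|y_i^2-y_j^2|^{2k_2}\prod_{i=1}^N|y_i|^{2k_1}$, $\gamma_k=k_2N(N-1)+k_1N$, and $c_k=\big(\int_{\mathbb{R}^N}e^{-\|y\|_2^2/2}w_k(y)\,dy\big)^{-1}$. *)

theory Defs
  imports "HOL-Probability.Probability"
begin

text \<open>
  The space $\mathbb{R}^N$ is \<^typ>\<open>real ^ 'n\<close> over a finite linearly ordered index type
  \<open>'n\<close>; the order of \<open>'n\<close> is the order of the coordinates $1 < \dots < N$.
\<close>

type_synonym 'n rvec = "real ^ 'n"

section \<open>The root system of type B\<close>

definition chamber_B :: "('n::{finite,linorder} rvec) set" where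
  "chamber_B = {x. (\<forall>i j. i \<le> j \<longrightarrow> x $ j \<le> x $ i) \<and> (\<forall>i. 0 \<le> x $ i)}"

definition short_roots_B :: "('n::{finite,linorder} rvec) set" where
  "short_roots_B = {axis i 1 | i. True}"

definition long_roots_B :: "('n::{finite,linorder} rvec) set" where
  "long_roots_B = {axis i 1 + axis j 1 | i j. i < j} \<union> {axis i 1 - axis j 1 | i j. i < j}"

definition pos_roots_B :: "('n::{finite,linorder} rvec) set" where
  "pos_roots_B = short_roots_B \<union> long_roots_B"

text \<open>Only evaluated on positive roots.\<close>

definition mult_B :: "real \<times> real \<Rightarrow> 'n::{finite,linorder} rvec \<Rightarrow> real" where
  "mult_B k \<alpha> = (if \<alpha> \<in> short_roots_B then fst k else snd k)"

definition reflection :: "'v::real_inner \<Rightarrow> 'v \<Rightarrow> 'v" where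
  "reflection \<alpha> x = x - (2 * (\<alpha> \<bullet> x) / (\<alpha> \<bullet> \<alpha>)) *\<^sub>R \<alpha>"

text \<open>Reflections are involutions, so closing under composition already gives a group.\<close>

inductive_set reflection_group :: "'v::real_inner set \<Rightarrow> ('v \<Rightarrow> 'v) set" for R where
  "id \<in> reflection_group R"
| "\<alpha> \<in> R \<Longrightarrow> g \<in> reflection_group R \<Longrightarrow> reflection \<alpha> \<circ> g \<in> reflection_group R"

definition weyl_group_B :: "('n::{finite,linorder} rvec \<Rightarrow> 'n rvec) set" where
  "weyl_group_B = reflection_group pos_roots_B"

section \<open>Dunkl operators, Dunkl kernel and Bessel function\<close>

text \<open>
  On the hyperplane orthogonal to \<open>\<alpha>\<close> the difference quotient of the Dunkl operator is
  understood as its continuous extension, which exists for continuously differentiable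
  \<open>f\<close>. (The plain quotient would be \<open>0\<close> there, as \<open>a / 0 = 0\<close>.)
\<close>

definition dunkl_quotient :: "'v::real_inner \<Rightarrow> ('v \<Rightarrow> real) \<Rightarrow> 'v \<Rightarrow> real" where
  "dunkl_quotient \<alpha> f x =
    (if \<alpha> \<bullet> x \<noteq> 0 then (f x - f (reflection \<alpha> x)) / (\<alpha> \<bullet> x)
     else Lim (at x within {z. \<alpha> \<bullet> z \<noteq> 0}) (\<lambda>z. (f z - f (reflection \<alpha> z)) / (\<alpha> \<bullet> z)))"

definition dunkl_op ::
    "real \<times> real \<Rightarrow> 'n::{finite,linorder} rvec \<Rightarrow> ('n rvec \<Rightarrow> real) \<Rightarrow> 'n rvec \<Rightarrow> real" where
  "dunkl_op k \<xi> f x = frechet_derivative f (at x) \<xi> +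
    (\<Sum>\<alpha>\<in>pos_roots_B. mult_B k \<alpha> * (\<alpha> \<bullet> \<xi>) * dunkl_quotient \<alpha> f x)"

text \<open>
  Real analyticity on all of $\mathbb{R}^N$: around each point the function is the sum of an
  (unconditionally convergent) power series, indexed by multi-indices \<open>m\<close>.
\<close>

definition real_analytic :: "('n::finite rvec \<Rightarrow> real) \<Rightarrow> bool" where
  "real_analytic f \<longleftrightarrow> (\<forall>a. \<exists>r>0. \<exists>c :: ('n \<Rightarrow> nat) \<Rightarrow> real. \<forall>x\<in>ball a r.
    ((\<lambda>m. c m * (\<Prod>i\<in>UNIV. (x $ i - a $ i) ^ m i)) has_sum f x) UNIV)"

text \<open>The kernel is only needed for real arguments, where it is real-valued.\<close>

definition dunkl_kernel ::
    "real \<times> real \<Rightarrow> 'n::{finite,linorder} rvec \<Rightarrow> 'n rvec \<Rightarrow> real" where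
  "dunkl_kernel k x y =
    (THE f. real_analytic f \<and> f 0 = 1 \<and> (\<forall>\<xi> z. dunkl_op k \<xi> f z = (\<xi> \<bullet> y) * f z)) x"

definition bessel_B ::
    "real \<times> real \<Rightarrow> 'n::{finite,linorder} rvec \<Rightarrow> 'n rvec \<Rightarrow> real" where
  "bessel_B k x y =
    (\<Sum>g\<in>weyl_group_B. dunkl_kernel k x (g y)) /
      real (card (weyl_group_B :: ('n rvec \<Rightarrow> 'n rvec) set))"

section \<open>Bessel processes of type B with drift\<close>

text \<open>
  Since \<open>0 powr 0 = 0\<close>, for vanishing multiplicities this differs from the usual
  weight on the reflection hyperplanes, a Lebesgue null set; the weight is only used
  inside Lebesgue integrals.
\<close>

definition weight_B :: "real \<times> real \<Rightarrow> 'n::{finite,linorder} rvec \<Rightarrow> real" where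
  "weight_B k y =
    (\<Prod>(i, j)\<in>{(i, j). i < j}. \<bar>(y $ i)\<^sup>2 - (y $ j)\<^sup>2\<bar> powr (2 * snd k)) *
    (\<Prod>i\<in>UNIV. \<bar>y $ i\<bar> powr (2 * fst k))"

definition gamma_B :: "'n::finite itself \<Rightarrow> real \<times> real \<Rightarrow> real" where
  "gamma_B _ k = snd k * real CARD('n) * (real CARD('n) - 1) + fst k * real CARD('n)"

definition norm_const_B :: "'n::{finite,linorder} itself \<Rightarrow> real \<times> real \<Rightarrow> real" where
  "norm_const_B _ k =
    inverse (LINT y|lborel. exp (- (norm (y :: 'n rvec))\<^sup>2 / 2) * weight_B k y)"

text \<open>The transition probability \<open>K t x A\<close>, for \<open>A \<subseteq> chamber_B\<close>.\<close>

definition bessel_transition_B :: "real \<times> real \<Rightarrow> 'n::{finite,linorder} rvec \<Rightarrow> real \<Rightarrow>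
    'n rvec \<Rightarrow> ('n rvec) set \<Rightarrow> real" where
  "bessel_transition_B k w t x A =
    2 ^ CARD('n) * fact CARD('n) * norm_const_B TYPE('n) k * exp (- (norm w)\<^sup>2 * t / 2) /
      t powr (gamma_B TYPE('n) k + real CARD('n) / 2) *
    (LINT y:A|lborel.
      exp (- ((norm x)\<^sup>2 + (norm y)\<^sup>2) / (2 * t)) *
      (bessel_B k (x /\<^sub>R sqrt t) (y /\<^sub>R sqrt t) * bessel_B k y w / bessel_B k x w) *
      weight_B k y)"

definition past_sigma :: "'a measure \<Rightarrow> (real \<Rightarrow> 'a \<Rightarrow> 'v::topological_space) \<Rightarrow> real \<Rightarrow> 'a measure"
  where
  "past_sigma M X s =
    sigma (space M) {X u -` A \<inter> space M | u A. 0 \<le> u \<and> u \<le> s \<and> A \<in> sets borel}"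

text \<open>
  \<open>X\<close> is, on the probability space \<open>M\<close>, a continuous time-homogeneous Markov process on
  the chamber, started in \<open>x\<close>, with the above transition probabilities. (The Feller property
  is a property of the transition probabilities alone, hence no further condition on \<open>X\<close>.)
\<close>

definition bessel_process_B :: "'a measure \<Rightarrow> real \<times> real \<Rightarrow> 'n::{finite,linorder} rvec \<Rightarrow>
    'n rvec \<Rightarrow> (real \<Rightarrow> 'a \<Rightarrow> 'n rvec) \<Rightarrow> bool" where
  "bessel_process_B M k w x X \<longleftrightarrow>
    prob_space M \<and>
    (\<forall>t\<ge>0. X t \<in> M \<rightarrow>\<^sub>M restrict_space borel chamber_B) \<and>
    (AE \<omega> in M. X 0 \<omega> = x) \<and>
    (AE \<omega> in M. continuous_on {0..} (\<lambda>t. X t \<omega>)) \<and>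
    (\<forall>s\<ge>0. \<forall>t>0. \<forall>A\<in>sets borel. A \<subseteq> chamber_B \<longrightarrow>
      (AE \<omega> in M. real_cond_exp M (past_sigma M X s) (\<lambda>\<omega>'. indicator A (X (s + t) \<omega>')) \<omega> =
        bessel_transition_B k w t (X s \<omega>) A))"

definition freezing_limit ::
    "'n::finite rvec \<Rightarrow> 'n rvec \<Rightarrow> real \<Rightarrow> 'n rvec" where
  "freezing_limit x w t =
    (\<chi> i. sqrt ((x $ i)\<^sup>2 + (w $ i)\<^sup>2 * t\<^sup>2 + 2 * t * sqrt ((x $ i)\<^sup>2 * (w $ i)\<^sup>2 + 1)))"

end

theory Submission
  imports Defs
begin

text \<open>
  Put the starting point \<open>x\<close>, drift \<open>k1 w\<close> and time \<open>t / k1\<close> into the transition density at \<open>y\<close>. Up to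
  a factor that does not depend on \<open>y\<close> it is
  \<open>exp (- k1 \<parallel>y\<parallel>\<^sup>2 / 2t) J(x, k1 y / t) J(y, k1 w) \<Prod> \<bar>y\<^sub>i\<bar>\<close> to the power \<open>2 k1\<close> times
  \<open>\<Prod> \<bar>y\<^sub>i\<^sup>2 - y\<^sub>j\<^sup>2\<bar>\<close> to the power \<open>2 k2\<close>. The theorem is Laplace's method for this density, once it is
  known that in the chamber \<open>ln J(x, k1 y) = k1 (\<Sum> \<phi>(x\<^sub>i y\<^sub>i)) + o(k1)\<close> with
  \<open>\<phi>(s) = sqrt (1 + s\<^sup>2) - 1 - ln ((1 + sqrt (1 + s\<^sup>2)) / 2)\<close>, uniformly enough to control large \<open>y\<close> too
  (\<open>bessel_B_asymptotics\<close>). The exponential rate of the density is then a sum over the coordinates of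
  \<open>2 ln u - u\<^sup>2 / 2t + \<phi>(x\<^sub>i u / t) + \<phi>(w\<^sub>i u)\<close>. This function is strictly concave in \<open>u\<^sup>2\<close>, and its critical
  point is exactly \<open>sqrt (x\<^sub>i\<^sup>2 + w\<^sub>i\<^sup>2 t\<^sup>2 + 2t sqrt (x\<^sub>i\<^sup>2 w\<^sub>i\<^sup>2 + 1))\<close>; concavity even gives the explicit quadratic
  bound \<open>rate_le_gaussian\<close>. The unknown factor cancels because the mass far from the limit point is compared
  with the mass of a small box next to it, which is at most one. All constants depend only on bounds for
  \<open>x\<close>, \<open>w\<close>, \<open>t\<close>, which gives the local uniformity (\<open>bessel_transition_concentrates\<close>).

  The Bessel function is controlled through the Dunkl kernel. If \<open>f = E(\<bullet>, y)\<close> solves the Dunkl equations, then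
  the equation in the radial direction reads \<open>x \<bullet> \<nabla>f(x) + \<Sum> k\<^sub>\<alpha> (f(x) - f(\<sigma>\<^sub>\<alpha> x)) = (x \<bullet> y) f(x)\<close>. It couples \<open>f\<close> only to
  its values on the finite orbit of \<open>x\<close>, so that along the ray from \<open>0\<close> to \<open>x\<close> it is a finite linear system
  with nonnegative jump rates \<open>k\<^sub>\<alpha>\<close>. Such systems obey a maximum principle (\<open>orbit_comparison\<close>), which yields uniqueness,
  positivity, and comparison with super- and subsolutions. Suitable barriers are products of one-dimensional
  WKB approximations: a sign change of a coordinate happens at the large rate \<open>k1\<close>, for which the product is an approximate
  solution, while the long roots only act at the bounded rate \<open>k2\<close> and cost a factor independent
  of \<open>k1\<close>. Permuting the coordinates cannot increase the exponent, by a rearrangement inequality.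

  The existence of the Dunkl kernel is a consequence of the processes having total mass one: solvability
  of the Dunkl equations for \<open>y\<close> is the same question for all points \<open>c y\<close> with \<open>c > 0\<close>, and
  where it fails \<open>J(\<bullet>, y)\<close> and \<open>J(\<bullet>, 2 y)\<close> coincide, so that the transition kernels with
  drifts \<open>y\<close> and \<open>2 y\<close> would differ only by the factor \<open>exp (- \<parallel>w\<parallel>\<^sup>2 t / 2)\<close> and could not both have
  mass one (\<open>dunkl_eigen_exists\<close>).
\<close>

section \<open>Real analytic functions and difference quotients\<close>

text \<open>
  Rescaling by \<open>s\<close> puts all variables into \<open>[-1, 1]\<close>, where a product changes by at most the sum of the
  changes of its factors.
\<close>

lemma monomial_diff_bound:
  fixes h h' :: "'n::finite \<Rightarrow> real" and m :: "'n \<Rightarrow> nat"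
  assumes s: "0 < s" and h: "\<And>i. \<bar>h i\<bar> \<le> s" and h': "\<And>i. \<bar>h' i\<bar> \<le> s"
    and d: "\<And>i. \<bar>h i - h' i\<bar> \<le> d"
  shows "\<bar>(\<Prod>i\<in>UNIV. h i ^ m i) - (\<Prod>i\<in>UNIV. h' i ^ m i)\<bar> * s
    \<le> s ^ (\<Sum>i\<in>UNIV. m i) * (real (\<Sum>i\<in>UNIV. m i) * d)"
proof -
  have le1: "\<bar>h i / s\<bar> \<le> 1" "\<bar>h' i / s\<bar> \<le> 1" for i
    using s h[of i] h'[of i] by (auto simp: abs_divide)
  have "\<bar>(\<Prod>i\<in>UNIV. (h i / s) ^ m i) - (\<Prod>i\<in>UNIV. (h' i / s) ^ m i)\<bar>
      \<le> (\<Sum>i\<in>UNIV. \<bar>(h i / s) ^ m i - (h' i / s) ^ m i\<bar>)"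
    using norm_prod_diff[of UNIV "\<lambda>i. (h i / s) ^ m i" "\<lambda>i. (h' i / s) ^ m i"] le1
    by (simp add: power_abs power_le_one)
  also have "\<dots> \<le> (\<Sum>i\<in>UNIV. real (m i) * (d / s))"
  proof (rule sum_mono)
    fix i
    have "\<bar>(h i / s) ^ m i - (h' i / s) ^ m i\<bar> \<le> real (m i) * \<bar>h i / s - h' i / s\<bar>"
      using norm_power_diff[of "h i / s" "h' i / s" "m i"] le1[of i] by simp
    also have "\<bar>h i / s - h' i / s\<bar> = \<bar>h i - h' i\<bar> / s"
      using s by (simp add: diff_divide_distrib[symmetric] abs_divide)
    also have "real (m i) * (\<bar>h i - h' i\<bar> / s) \<le> real (m i) * (d / s)"
      using s d[of i] by (intro mult_left_mono divide_right_mono) auto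
    finally show "\<bar>(h i / s) ^ m i - (h' i / s) ^ m i\<bar> \<le> real (m i) * (d / s)" .
  qed
  also have "\<dots> = real (\<Sum>i\<in>UNIV. m i) * (d / s)"
    by (simp add: sum_distrib_right sum_distrib_left sum_divide_distrib)
  finally have *: "\<bar>(\<Prod>i\<in>UNIV. (h i / s) ^ m i) - (\<Prod>i\<in>UNIV. (h' i / s) ^ m i)\<bar>
      \<le> real (\<Sum>i\<in>UNIV. m i) * (d / s)" .
  have P: "(\<Prod>i\<in>UNIV. (g i / s) ^ m i) = (\<Prod>i\<in>UNIV. g i ^ m i) / s ^ (\<Sum>i\<in>UNIV. m i)" for g
    by (simp add: power_divide prod_dividef power_sum)
  have "\<bar>(\<Prod>i\<in>UNIV. h i ^ m i) - (\<Prod>i\<in>UNIV. h' i ^ m i)\<bar> / s ^ (\<Sum>i\<in>UNIV. m i)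
      \<le> real (\<Sum>i\<in>UNIV. m i) * (d / s)"
    using * s unfolding P by (simp add: diff_divide_distrib[symmetric] abs_divide)
  then show ?thesis using s by (simp add: field_simps)
qed

text \<open>
  Monomials of degree at least two gain a factor \<open>s\<^sup>2\<close>; halving the radius leaves \<open>2\<close> to the power \<open>2 - n\<close>,
  which absorbs the factor \<open>n\<close> that comes from differencing a monomial.
\<close>

lemma degree_ge_2_bound:
  fixes s \<rho> :: real
  assumes "0 < s" "s \<le> \<rho> / 2" "2 \<le> n"
  shows "s ^ n * real n \<le> \<rho> ^ n * (2 * s\<^sup>2 / \<rho>\<^sup>2)"
proof -
  have "\<rho> > 0" using assms by simp
  obtain l where n: "n = 2 + l" using \<open>2 \<le> n\<close> le_Suc_ex by blast
  have a: "real (2 + l) \<le> 2 * 2 ^ l" by (induction l) auto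
  have "s ^ l \<le> (\<rho> / 2) ^ l" using assms by (intro power_mono) auto
  then have "s ^ l * real (2 + l) \<le> (\<rho> / 2) ^ l * (2 * 2 ^ l)"
    using a \<open>\<rho> > 0\<close> by (intro mult_mono) auto
  also have "\<dots> = 2 * \<rho> ^ l" by (simp add: power_divide)
  finally have "s\<^sup>2 * (s ^ l * real (2 + l)) \<le> s\<^sup>2 * (2 * \<rho> ^ l)"
    by (intro mult_left_mono) auto
  then show ?thesis using \<open>\<rho> > 0\<close> by (simp add: n power_add power2_eq_square mult_ac)
qed

text \<open>
  The constant and linear terms of the power series at \<open>a\<close> are split off, and the rest is dominated by the
  absolutely convergent series at a positive radius. The derivative is obtained in the strict sense, with both
  points \<open>z\<close> and \<open>z'\<close> moving: the difference quotients of Dunkl operators compare \<open>f\<close> at a point and at its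
  mirror image.
\<close>

lemma real_analytic_strict_derivative:
  fixes f :: "'n::finite rvec \<Rightarrow> real"
  assumes "real_analytic f"
  obtains D where "bounded_linear D"
    "\<And>\<epsilon>. \<epsilon> > 0 \<Longrightarrow> \<exists>\<delta>>0. \<forall>z z'. norm (z - a) < \<delta> \<longrightarrow> norm (z' - a) < \<delta> \<longrightarrow>
      \<bar>f z - f z' - D (z - z')\<bar> \<le> \<epsilon> * norm (z - z')"
proof -
  obtain r c where r: "r > 0" and c: "\<And>x. x \<in> ball a r \<Longrightarrow>
      ((\<lambda>m. c m * (\<Prod>i\<in>UNIV. (x $ i - a $ i) ^ m i)) has_sum f x) (UNIV :: ('n \<Rightarrow> nat) set)"
    using assms unfolding real_analytic_def by blast
  define \<rho> where "\<rho> = r / (2 * real CARD('n))"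
  have \<rho>: "\<rho> > 0" using r by (simp add: \<rho>_def)
  define deg where "deg m = (\<Sum>i\<in>UNIV. m i)" for m :: "'n \<Rightarrow> nat"
  have "norm (\<chi> i::'n. \<rho>) \<le> r / 2"
    using norm_le_l1_cart[of "\<chi> i::'n. \<rho>"] r by (simp add: \<rho>_def)
  then have "a + (\<chi> i. \<rho>) \<in> ball a r" using r by (simp add: dist_norm)
  from c[OF this] have "(\<lambda>m. c m * \<rho> ^ deg m) summable_on UNIV"
    by (auto simp: deg_def power_sum dest: has_sum_imp_summable)
  then have "(\<lambda>m. norm (c m * \<rho> ^ deg m)) summable_on UNIV"
    by (rule summable_on_iff_abs_summable_on_real[THEN iffD1])
  then obtain S where S: "((\<lambda>m. \<bar>c m\<bar> * \<rho> ^ deg m) has_sum S) UNIV"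
    using \<rho> by (auto simp: abs_mult summable_on_def)
  have S0: "S \<ge> 0" by (rule has_sum_nonneg[OF S]) (use \<rho> in auto)
  define e where "e j = (\<lambda>i. if i = j then 1 else 0 :: nat)" for j :: 'n
  define D where "D v = (\<Sum>j\<in>UNIV. c (e j) * v $ j)" for v :: "'n rvec"
  have inj: "inj e" unfolding e_def by (rule injI) (metis zero_neq_one)
  have lin: "bounded_linear D"
    unfolding D_def
    by (intro bounded_linear_sum bounded_linear_const_mult bounded_linear_vec_nth)
  define low where "low = insert (\<lambda>_. 0) (range e)"
  have low: "deg m \<ge> 2" if "m \<notin> low" for m
  proof (rule ccontr)
    assume "\<not> deg m \<ge> 2"
    moreover have "deg m \<noteq> 0"
    proof
      assume "deg m = 0" then have "m = (\<lambda>_. 0)" by (auto simp: deg_def)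
      then show False using that by (simp add: low_def)
    qed
    ultimately have 1: "deg m = 1" by linarith
    then obtain j where j: "m j \<noteq> 0" unfolding deg_def by (metis sum.neutral zero_neq_one)
    have "deg m = m j + (\<Sum>i\<in>UNIV - {j}. m i)" unfolding deg_def by (subst sum.remove[of _ j]) auto
    then have "m j = 1" "(\<Sum>i\<in>UNIV - {j}. m i) = 0" using j 1 by linarith+
    then have "m i = e j i" for i by (cases "i = j") (auto simp: e_def)
    then have "m = e j" by blast
    then show False using that by (simp add: low_def)
  qed
  have key: "\<bar>f z - f z' - D (z - z')\<bar> \<le> S * (2 * s / \<rho>\<^sup>2) * norm (z - z')"
    if z: "norm (z - a) \<le> s" "norm (z' - a) \<le> s" and s: "0 < s" "s \<le> \<rho> / 2" for z z' s
  proof -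
    have \<rho>r: "\<rho> \<le> r"
    proof -
      have "1 \<le> 2 * real CARD('n)" by (simp add: Suc_leI order_trans[of 1 "real CARD('n)"])
      then show ?thesis using r by (simp add: \<rho>_def divide_le_eq)
    qed
    have zb: "z \<in> ball a r" "z' \<in> ball a r"
      using z s \<rho>r r \<rho> by (auto simp: dist_norm norm_minus_commute)
    define T where "T m = c m * (\<Prod>i\<in>UNIV. (z $ i - a $ i) ^ m i) -
      c m * (\<Prod>i\<in>UNIV. (z' $ i - a $ i) ^ m i)" for m
    have T: "(T has_sum (f z - f z')) UNIV"
      unfolding T_def using has_sum_add[OF c[OF zb(1)] has_sum_uminusI[OF c[OF zb(2)]]] by simp
    define U where "U m = (if m \<in> low then T m else 0)" for m
    have ne: "(\<lambda>_. 0) \<notin> range e" by (auto simp: e_def fun_eq_iff) (metis zero_neq_one)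
    have Te: "T (e j) = c (e j) * (z - z') $ j" for j
    proof -
      have "(\<Prod>i\<in>UNIV. (x $ i - a $ i) ^ e j i) = x $ j - a $ j" for x :: "'n rvec"
        by (subst prod.remove[of _ j]) (auto simp: e_def)
      then show ?thesis by (simp add: T_def right_diff_distrib)
    qed
    have "sum T low = D (z - z')"
      unfolding low_def D_def using ne
      by (simp add: sum.reindex[OF inj] Te) (simp add: T_def)
    then have U: "(U has_sum (D (z - z'))) UNIV"
      unfolding U_def by (intro has_sum_finite_neutralI[of low]) (auto simp: low_def)
    have TU: "((\<lambda>m. T m - U m) has_sum (f z - f z' - D (z - z'))) UNIV"
      using has_sum_add[OF T has_sum_uminusI[OF U]] by simp
    have bd: "\<bar>T m - U m\<bar> \<le> (\<bar>c m\<bar> * \<rho> ^ deg m) * (2 * s / \<rho>\<^sup>2 * norm (z - z'))" for m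
    proof (cases "m \<in> low")
      case True
      then show ?thesis using s \<rho> by (simp add: U_def)
    next
      case False
      have "\<bar>(\<Prod>i\<in>UNIV. (z $ i - a $ i) ^ m i) - (\<Prod>i\<in>UNIV. (z' $ i - a $ i) ^ m i)\<bar> * s
          \<le> s ^ deg m * (real (deg m) * norm (z - z'))"
        unfolding deg_def
      proof (rule monomial_diff_bound[OF s(1)])
        fix i
        show "\<bar>z $ i - a $ i\<bar> \<le> s" using component_le_norm_cart[of "z - a" i] z by simp
        show "\<bar>z' $ i - a $ i\<bar> \<le> s" using component_le_norm_cart[of "z' - a" i] z by simp
        show "\<bar>z $ i - a $ i - (z' $ i - a $ i)\<bar> \<le> norm (z - z')"
          using component_le_norm_cart[of "z - z'" i] by simp
      qed
      also have "\<dots> = (s ^ deg m * real (deg m)) * norm (z - z')" by simp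
      also have "\<dots> \<le> (\<rho> ^ deg m * (2 * s\<^sup>2 / \<rho>\<^sup>2)) * norm (z - z')"
        by (intro mult_right_mono degree_ge_2_bound s low False) auto
      also have "\<dots> = (\<rho> ^ deg m * (2 * s / \<rho>\<^sup>2 * norm (z - z'))) * s"
        by (simp add: power2_eq_square)
      finally have "\<bar>(\<Prod>i\<in>UNIV. (z $ i - a $ i) ^ m i) - (\<Prod>i\<in>UNIV. (z' $ i - a $ i) ^ m i)\<bar>
          \<le> \<rho> ^ deg m * (2 * s / \<rho>\<^sup>2 * norm (z - z'))"
        using s(1) by (rule mult_right_le_imp_le)
      then have "\<bar>c m\<bar> * \<bar>(\<Prod>i\<in>UNIV. (z $ i - a $ i) ^ m i) - (\<Prod>i\<in>UNIV. (z' $ i - a $ i) ^ m i)\<bar>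
          \<le> \<bar>c m\<bar> * (\<rho> ^ deg m * (2 * s / \<rho>\<^sup>2 * norm (z - z')))"
        by (intro mult_left_mono) auto
      then show ?thesis
        using False by (simp add: U_def T_def right_diff_distrib[symmetric] abs_mult mult_ac)
    qed
    have S': "((\<lambda>m. (\<bar>c m\<bar> * \<rho> ^ deg m) * (2 * s / \<rho>\<^sup>2 * norm (z - z')))
        has_sum S * (2 * s / \<rho>\<^sup>2 * norm (z - z'))) UNIV"
      by (rule has_sum_cmult_left[OF S])
    have "f z - f z' - D (z - z') \<le> S * (2 * s / \<rho>\<^sup>2 * norm (z - z'))"
      by (rule has_sum_mono[OF TU S']) (use bd in \<open>auto simp: abs_le_iff\<close>)
    moreover have "-(f z - f z' - D (z - z')) \<le> S * (2 * s / \<rho>\<^sup>2 * norm (z - z'))"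
      by (rule has_sum_mono[OF has_sum_uminusI[OF TU] S']) (use bd in \<open>auto simp: abs_le_iff\<close>)
    ultimately show ?thesis by (simp add: abs_le_iff mult_ac)
  qed
  show thesis
  proof (rule that[OF lin])
    fix \<epsilon> :: real assume \<epsilon>: "\<epsilon> > 0"
    define s where "s = min (\<rho> / 2) (\<epsilon> * \<rho>\<^sup>2 / (2 * (S + 1)))"
    have s: "0 < s" using \<rho> \<epsilon> S0 by (auto simp: s_def)
    have s2: "s \<le> \<rho> / 2" unfolding s_def by (rule min.cobounded1)
    have "s \<le> \<epsilon> * \<rho>\<^sup>2 / (2 * (S + 1))" by (simp add: s_def)
    then have "s * (2 * (S + 1)) \<le> \<epsilon> * \<rho>\<^sup>2" using S0 by (simp add: field_simps)
    moreover have "2 * (S * s) \<le> s * (2 * (S + 1))" using s by (simp add: algebra_simps)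
    ultimately have "S * (2 * s / \<rho>\<^sup>2) \<le> \<epsilon>" using \<rho> by (simp add: divide_simps mult_ac)
    then have "S * (2 * s / \<rho>\<^sup>2) * norm (z - z') \<le> \<epsilon> * norm (z - z')" for z z' :: "'n rvec"
      by (intro mult_right_mono) auto
    then have "\<forall>z z'. norm (z - a) < s \<longrightarrow> norm (z' - a) < s \<longrightarrow>
      \<bar>f z - f z' - D (z - z')\<bar> \<le> \<epsilon> * norm (z - z')"
      using key[OF _ _ s s2] by (meson less_imp_le order_trans)
    then show "\<exists>\<delta>>0. \<forall>z z'. norm (z - a) < \<delta> \<longrightarrow> norm (z' - a) < \<delta> \<longrightarrow>
      \<bar>f z - f z' - D (z - z')\<bar> \<le> \<epsilon> * norm (z - z')"
      using s by blast
  qed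
qed

lemma real_analytic_derivative:
  fixes f :: "'n::finite rvec \<Rightarrow> real"
  assumes "real_analytic f"
  shows "(f has_derivative frechet_derivative f (at a)) (at a)"
    and "\<epsilon> > 0 \<Longrightarrow> \<exists>\<delta>>0. \<forall>z z'. norm (z - a) < \<delta> \<longrightarrow> norm (z' - a) < \<delta> \<longrightarrow>
      \<bar>f z - f z' - frechet_derivative f (at a) (z - z')\<bar> \<le> \<epsilon> * norm (z - z')"
proof -
  obtain D where D: "bounded_linear D"
    "\<And>\<epsilon>. \<epsilon> > 0 \<Longrightarrow> \<exists>\<delta>>0. \<forall>z z'. norm (z - a) < \<delta> \<longrightarrow> norm (z' - a) < \<delta> \<longrightarrow>
      \<bar>f z - f z' - D (z - z')\<bar> \<le> \<epsilon> * norm (z - z')"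
    using real_analytic_strict_derivative[OF assms, of a] by blast
  have "(f has_derivative D) (at a)"
    unfolding has_derivative_at_alt
  proof (intro conjI allI impI D(1))
    fix e :: real assume "e > 0"
    then obtain \<delta> where \<delta>: "\<delta> > 0" "\<And>z z'. norm (z - a) < \<delta> \<Longrightarrow> norm (z' - a) < \<delta> \<Longrightarrow>
      \<bar>f z - f z' - D (z - z')\<bar> \<le> e * norm (z - z')" using D(2) by blast
    show "\<exists>d>0. \<forall>y. norm (y - a) < d \<longrightarrow> norm (f y - f a - D (y - a)) \<le> e * norm (y - a)"
      using \<delta>(1) \<delta>(2)[of _ a] by auto
  qed
  then have eq: "D = frechet_derivative f (at a)" by (rule frechet_derivative_at)
  then show "(f has_derivative frechet_derivative f (at a)) (at a)"
    using \<open>(f has_derivative D) (at a)\<close> by simp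
  show "\<epsilon> > 0 \<Longrightarrow> \<exists>\<delta>>0. \<forall>z z'. norm (z - a) < \<delta> \<longrightarrow> norm (z' - a) < \<delta> \<longrightarrow>
      \<bar>f z - f z' - frechet_derivative f (at a) (z - z')\<bar> \<le> \<epsilon> * norm (z - z')"
    using D(2) eq by simp
qed

text \<open>
  As \<open>z\<close> tends to a point of the hyperplane, so does its mirror image, and \<open>z - reflection \<alpha> z\<close> is
  \<open>\<alpha> \<bullet> z\<close> times a fixed vector; strict differentiability evaluates the limit. Dunkl operators are thereby expressed
  by values and derivatives only, which makes their transformation rules algebraic.
\<close>

lemma dunkl_quotient_on_hyperplane:
  fixes f :: "'n::finite rvec \<Rightarrow> real"
  assumes f: "real_analytic f" and \<alpha>: "\<alpha> \<noteq> 0" and x: "\<alpha> \<bullet> x = 0"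
  shows "dunkl_quotient \<alpha> f x = frechet_derivative f (at x) ((2 / (\<alpha> \<bullet> \<alpha>)) *\<^sub>R \<alpha>)"
proof -
  let ?v = "(2 / (\<alpha> \<bullet> \<alpha>)) *\<^sub>R \<alpha>" and ?D = "frechet_derivative f (at x)"
  let ?F = "at x within {z. \<alpha> \<bullet> z \<noteq> 0}"
  have pos: "\<alpha> \<bullet> \<alpha> > 0" using \<alpha> by simp
  have lin: "bounded_linear ?D"
    using real_analytic_derivative(1)[OF f] by (rule has_derivative_bounded_linear)
  have refl: "z - reflection \<alpha> z = (\<alpha> \<bullet> z) *\<^sub>R ?v" for z
    by (simp add: reflection_def)
  have refl_x: "reflection \<alpha> x = x" using x by (simp add: reflection_def)
  have nrefl: "norm (reflection \<alpha> z - x) \<le> 3 * norm (z - x)" for z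
  proof -
    have "norm (z - reflection \<alpha> z) = \<bar>\<alpha> \<bullet> (z - x)\<bar> * (2 / norm \<alpha>)"
      unfolding refl using x pos by (simp add: inner_diff_right dot_square_norm power2_eq_square abs_mult abs_divide)
    also have "\<dots> \<le> (norm \<alpha> * norm (z - x)) * (2 / norm \<alpha>)"
      by (intro mult_right_mono Cauchy_Schwarz_ineq2) auto
    also have "\<dots> = 2 * norm (z - x)" using \<alpha> by simp
    finally show ?thesis
      using norm_triangle_ineq4[of "z - x" "z - reflection \<alpha> z"] by simp
  qed
  have "((\<lambda>z. (f z - f (reflection \<alpha> z)) / (\<alpha> \<bullet> z)) \<longlongrightarrow> ?D ?v) ?F"
    unfolding tendsto_iff
  proof (intro allI impI)
    fix e :: real assume e: "e > 0"
    define e' where "e' = e / (2 * (norm ?v + 1))"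
    have e': "e' > 0" using e by (simp add: e'_def add_nonneg_pos)
    have nv: "e' * norm ?v < e"
    proof -
      have "e' * norm ?v \<le> e' * (norm ?v + 1)" using e' by (intro mult_left_mono) auto
      also have "\<dots> = e / 2" unfolding e'_def by (simp add: divide_simps add_nonneg_eq_0_iff)
      finally show ?thesis using e by simp
    qed
    obtain \<delta> where \<delta>: "\<delta> > 0" "\<And>z z'. norm (z - x) < \<delta> \<Longrightarrow> norm (z' - x) < \<delta> \<Longrightarrow>
      \<bar>f z - f z' - ?D (z - z')\<bar> \<le> e' * norm (z - z')"
      using real_analytic_derivative(2)[OF f e', of x] by blast
    show "\<forall>\<^sub>F z in ?F. dist ((f z - f (reflection \<alpha> z)) / (\<alpha> \<bullet> z)) (?D ?v) < e"
      unfolding eventually_at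
    proof (intro exI[of _ "\<delta> / 3"] conjI ballI impI)
      show "\<delta> / 3 > 0" using \<delta> by simp
      fix z assume z: "z \<in> {z. \<alpha> \<bullet> z \<noteq> 0}" "z \<noteq> x \<and> dist z x < \<delta> / 3"
      have zx: "norm (z - x) < \<delta> / 3" using z(2) by (simp add: dist_norm)
      have n1: "norm (z - x) < \<delta>" using zx \<delta>(1) by linarith
      have n2: "norm (reflection \<alpha> z - x) < \<delta>" using zx nrefl[of z] by linarith
      have "\<bar>f z - f (reflection \<alpha> z) - (\<alpha> \<bullet> z) * ?D ?v\<bar> \<le> e' * (\<bar>\<alpha> \<bullet> z\<bar> * norm ?v)"
        using \<delta>(2)[OF n1 n2] unfolding refl linear_cmul[OF bounded_linear.linear[OF lin]]
        by simp
      also have "\<dots> < e * \<bar>\<alpha> \<bullet> z\<bar>"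
        using mult_strict_right_mono[OF nv, of "\<bar>\<alpha> \<bullet> z\<bar>"] z(1) by (simp only: mult_ac) simp
      finally have "\<bar>f z - f (reflection \<alpha> z) - (\<alpha> \<bullet> z) * ?D ?v\<bar> / \<bar>\<alpha> \<bullet> z\<bar> < e"
        using z(1) by (simp add: field_simps)
      moreover have "(f z - f (reflection \<alpha> z)) / (\<alpha> \<bullet> z) - ?D ?v =
          (f z - f (reflection \<alpha> z) - (\<alpha> \<bullet> z) * ?D ?v) / (\<alpha> \<bullet> z)"
        using z(1) by (simp add: field_simps)
      ultimately show "dist ((f z - f (reflection \<alpha> z)) / (\<alpha> \<bullet> z)) (?D ?v) < e"
        by (simp only: dist_real_def abs_divide)
    qed
  qed
  moreover have "\<not> trivial_limit ?F"
    unfolding trivial_limit_within islimpt_approachable not_not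
  proof (intro allI impI)
    fix e :: real assume e: "e > 0"
    have "\<alpha> \<bullet> (x + (e / (2 * norm \<alpha>)) *\<^sub>R \<alpha>) \<noteq> 0"
      using x e pos \<alpha> by (simp add: inner_add_right)
    moreover have "dist (x + (e / (2 * norm \<alpha>)) *\<^sub>R \<alpha>) x < e" using e \<alpha> by (simp add: dist_norm)
    moreover have "x + (e / (2 * norm \<alpha>)) *\<^sub>R \<alpha> \<noteq> x" using e \<alpha> by simp
    ultimately show "\<exists>x'\<in>{z. \<alpha> \<bullet> z \<noteq> 0}. x' \<noteq> x \<and> dist x' x < e" by blast
  qed
  ultimately show ?thesis
    using x tendsto_Lim by (fastforce simp: dunkl_quotient_def)
qed

section \<open>Signed permutations and the Dunkl eigenvalue equation\<close>

definition dunkl_eigen ::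
    "real \<times> real \<Rightarrow> 'n::{finite,linorder} rvec \<Rightarrow> ('n rvec \<Rightarrow> real) \<Rightarrow> bool" where
  "dunkl_eigen k y f \<longleftrightarrow>
    real_analytic f \<and> f 0 = 1 \<and> (\<forall>\<xi> z. dunkl_op k \<xi> f z = (\<xi> \<bullet> y) * f z)"

text \<open>
  With \<open>\<bar>s i\<bar> = 1\<close> these are the elements of the Weyl group of type B. A common modulus \<open>l\<close> in place of \<open>1\<close>
  adds the dilations, so that equivariance and homogeneity of the Dunkl kernel are one statement.
\<close>

definition signed_perm :: "('n \<Rightarrow> 'n) \<Rightarrow> ('n \<Rightarrow> real) \<Rightarrow> 'n::finite rvec \<Rightarrow> 'n rvec" where
  "signed_perm p s x = (\<chi> i. s i * x $ p i)"

lemma signed_perm_nth [simp]: "signed_perm p s x $ i = s i * x $ p i"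
  by (simp add: signed_perm_def)

lemma linear_signed_perm: "linear (signed_perm p s)"
  by (rule linearI) (auto simp: vec_eq_iff algebra_simps)

lemma signed_perm_scaleR: "signed_perm p s (c *\<^sub>R x) = c *\<^sub>R signed_perm p s x"
  using linear_cmul[OF linear_signed_perm] .

lemma signed_perm_diff: "signed_perm p s (x - y) = signed_perm p s x - signed_perm p s y"
  using linear_diff[OF linear_signed_perm] .

lemma signed_perm_compose:
  "signed_perm p s (signed_perm p' s' x) = signed_perm (p' \<circ> p) (\<lambda>i. s i * s' (p i)) x"
  by (simp add: vec_eq_iff)

lemma signed_perm_adjoint:
  assumes "bij p"
  shows "signed_perm p s x \<bullet> y = x \<bullet> signed_perm (inv p) (s \<circ> inv p) y"
proof -
  have "signed_perm p s x \<bullet> y = (\<Sum>i\<in>UNIV. s (inv p (p i)) * x $ p i * y $ inv p (p i))"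
    by (simp add: inner_vec_def inv_f_f[OF bij_is_inj[OF assms]])
  also have "\<dots> = (\<Sum>j\<in>UNIV. s (inv p j) * x $ j * y $ inv p j)"
    using sum.reindex_bij_betw[OF assms, of "\<lambda>j. s (inv p j) * x $ j * y $ inv p j"] by simp
  also have "\<dots> = x \<bullet> signed_perm (inv p) (s \<circ> inv p) y"
    by (simp add: inner_vec_def mult_ac)
  finally show ?thesis .
qed

lemma signed_perm_inner:
  assumes "bij p" "\<And>i. \<bar>s i\<bar> = l"
  shows "signed_perm p s x \<bullet> signed_perm p s y = l\<^sup>2 * (x \<bullet> y)"
proof -
  have "(s i)\<^sup>2 = l\<^sup>2" for i using assms(2)[of i] by (metis power2_abs)
  then have "signed_perm p s x \<bullet> signed_perm p s y = (\<Sum>i\<in>UNIV. l\<^sup>2 * (x $ p i * y $ p i))"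
    by (simp add: inner_vec_def power2_eq_square mult_ac) (metis mult.assoc)
  also have "\<dots> = (\<Sum>i\<in>UNIV. l\<^sup>2 * (x $ i * y $ i))"
    using sum.reindex_bij_betw[OF assms(1), of "\<lambda>i. l\<^sup>2 * (x $ i * y $ i)"] by simp
  finally show ?thesis by (simp add: inner_vec_def sum_distrib_left)
qed

lemma norm_signed_perm:
  assumes "bij p" "\<And>i. \<bar>s i\<bar> = l" "l > 0"
  shows "norm (signed_perm p s x) = l * norm x"
  using signed_perm_inner[OF assms(1,2), where x = x and y = x] assms(3)
  by (simp add: norm_eq_sqrt_inner real_sqrt_mult)

lemma real_analytic_signed_perm:
  fixes f :: "'n::finite rvec \<Rightarrow> real"
  assumes f: "real_analytic f" and p: "bij p" and s: "\<And>i. \<bar>s i\<bar> = l" "l > 0"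
  shows "real_analytic (f \<circ> signed_perm p s)"
  unfolding real_analytic_def
proof
  fix a :: "'n rvec"
  let ?L = "signed_perm p s"
  obtain r c where r: "r > 0" and c: "\<And>x. x \<in> ball (?L a) r \<Longrightarrow>
      ((\<lambda>m. c m * (\<Prod>i\<in>UNIV. (x $ i - ?L a $ i) ^ m i)) has_sum f x) (UNIV :: ('n \<Rightarrow> nat) set)"
    using f unfolding real_analytic_def by blast
  define c' where "c' m = c (m \<circ> p) * (\<Prod>i\<in>UNIV. s i ^ m (p i))" for m :: "'n \<Rightarrow> nat"
  have "((\<lambda>m. c' m * (\<Prod>i\<in>UNIV. (x $ i - a $ i) ^ m i)) has_sum (f \<circ> ?L) x) UNIV"
    if x: "x \<in> ball a (r / l)" for x
  proof -
    have "norm (?L a - ?L x) = l * norm (a - x)"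
      using norm_signed_perm[where s = s, OF p s, where x = "a - x"] by (simp add: signed_perm_diff)
    then have "?L x \<in> ball (?L a) r"
      using x s(2) by (simp add: dist_norm field_simps)
    note this[THEN c]
    moreover have "bij (\<lambda>m :: 'n \<Rightarrow> nat. m \<circ> p)"
      by (rule bij_betw_byWitness[where f' = "\<lambda>m. m \<circ> inv p"])
        (auto simp: fun_eq_iff bij_is_inj[OF p] bij_is_surj[OF p] surj_f_inv_f)
    ultimately have "((\<lambda>m. c (m \<circ> p) * (\<Prod>i\<in>UNIV. (?L x $ i - ?L a $ i) ^ (m \<circ> p) i))
        has_sum f (?L x)) UNIV"
      using has_sum_reindex_bij_betw[of "\<lambda>m :: 'n \<Rightarrow> nat. m \<circ> p" UNIV UNIV
        "\<lambda>m. c m * (\<Prod>i\<in>UNIV. (?L x $ i - ?L a $ i) ^ m i)" "f (?L x)"] by simp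
    moreover have "c (m \<circ> p) * (\<Prod>i\<in>UNIV. (?L x $ i - ?L a $ i) ^ (m \<circ> p) i) =
        c' m * (\<Prod>i\<in>UNIV. (x $ i - a $ i) ^ m i)" for m
    proof -
      have "(\<Prod>i\<in>UNIV. (?L x $ i - ?L a $ i) ^ (m \<circ> p) i) =
          (\<Prod>i\<in>UNIV. s i ^ m (p i)) * (\<Prod>i\<in>UNIV. (x $ p i - a $ p i) ^ m (p i))"
        by (simp add: right_diff_distrib[symmetric] power_mult_distrib prod.distrib)
      also have "(\<Prod>i\<in>UNIV. (x $ p i - a $ p i) ^ m (p i)) = (\<Prod>i\<in>UNIV. (x $ i - a $ i) ^ m i)"
        using prod.reindex_bij_betw[OF p, of "\<lambda>i. (x $ i - a $ i) ^ m i"] by simp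
      finally show ?thesis by (simp add: c'_def)
    qed
    ultimately show ?thesis by simp
  qed
  moreover have "r / l > 0" using r s by simp
  ultimately show "\<exists>r>0. \<exists>c. \<forall>x\<in>ball a r.
      ((\<lambda>m. c m * (\<Prod>i\<in>UNIV. (x $ i - a $ i) ^ m i)) has_sum (f \<circ> ?L) x) UNIV" by blast
qed

lemma reflection_cscale: "reflection \<alpha> (r *\<^sub>R x) = r *\<^sub>R reflection \<alpha> x"
  by (simp add: reflection_def scaleR_right_diff_distrib)

lemma finite_pos_roots_B: "finite (pos_roots_B :: 'n::{finite,linorder} rvec set)"
proof -
  have 1: "(short_roots_B :: 'n rvec set) = range (\<lambda>i. axis i 1)"
    by (auto simp: short_roots_B_def)
  have 2: "(long_roots_B :: 'n rvec set) \<subseteq> range (\<lambda>(i, j). axis i 1 + axis j 1) \<union>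
      range (\<lambda>(i, j). axis i 1 - axis j 1)"
    by (auto simp: long_roots_B_def)
  show ?thesis unfolding pos_roots_B_def using finite_subset[OF 2] by (simp add: 1)
qed

lemma long_roots_B_signs:
  fixes i j :: "'n::{finite,linorder}"
  assumes "i \<noteq> j" "\<bar>a\<bar> = (1::real)" "\<bar>b\<bar> = 1"
  obtains \<beta> c where "\<beta> \<in> long_roots_B" "\<bar>c\<bar> = 1" "a *\<^sub>R axis i 1 + b *\<^sub>R axis j 1 = c *\<^sub>R \<beta>"
proof -
  have *: thesis if ij: "i < j" and ab: "\<bar>a\<bar> = (1::real)" "\<bar>b\<bar> = 1"
    and v: "v = a *\<^sub>R axis i 1 + b *\<^sub>R axis j 1" and
    t: "\<And>\<beta> c. \<beta> \<in> long_roots_B \<Longrightarrow> \<bar>c\<bar> = 1 \<Longrightarrow> v = c *\<^sub>R \<beta> \<Longrightarrow> thesis"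
    for i j :: 'n and a b :: real and v
  proof -
    consider "b = a" | "b = -a" using ab by (auto simp: abs_if split: if_splits)
    then show thesis
    proof cases
      case 1
      show thesis by (rule t[of "axis i 1 + axis j 1" a])
        (use 1 ij ab v in \<open>auto simp: long_roots_B_def scaleR_add_right\<close>)
    next
      case 2
      show thesis by (rule t[of "axis i 1 - axis j 1" a])
        (use 2 ij ab v in \<open>auto simp: long_roots_B_def scaleR_diff_right\<close>)
    qed
  qed
  show thesis
  proof (cases "i < j")
    case True
    from *[OF this assms(2,3) refl] that show ?thesis by blast
  next
    case False
    then have "j < i" using assms(1) by auto
    from *[OF this assms(3,2) refl] that show ?thesis by (metis add.commute)
  qed
qed

lemma long_root_B_cases:
  assumes "\<alpha> \<in> (long_roots_B :: 'n::{finite,linorder} rvec set)"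
  obtains i j b where "i < j" "\<bar>b\<bar> = 1" "\<alpha> = axis i 1 + b *\<^sub>R axis j 1"
proof -
  from assms consider i j where "i < j" "\<alpha> = axis i 1 + axis j 1"
    | i j where "i < j" "\<alpha> = axis i 1 - axis j 1" by (auto simp: long_roots_B_def)
  then show thesis
  proof cases
    case 1 then show thesis using that[of i j 1] by simp
  next
    case 2 then show thesis using that[of i j "-1"] by simp
  qed
qed

lemma inner_short_root_B:
  "\<alpha> \<in> short_roots_B \<Longrightarrow> \<alpha> \<bullet> \<alpha> = 1"
  by (auto simp: short_roots_B_def inner_axis_axis)

lemma inner_long_root_B:
  assumes "\<alpha> \<in> long_roots_B" shows "\<alpha> \<bullet> \<alpha> = 2"
proof -
  obtain i j b where *: "i < j" "\<bar>b\<bar> = 1" "\<alpha> = axis i 1 + b *\<^sub>R axis j 1"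
    using long_root_B_cases[OF assms] .
  have "b * b = 1" using *(2) by (metis abs_mult_self_eq mult_1)
  then show ?thesis using * by (simp add: inner_add_left inner_add_right inner_axis_axis)
qed

lemma short_long_disjoint: "short_roots_B \<inter> long_roots_B = {}"
  using inner_short_root_B inner_long_root_B by fastforce

lemma pos_root_B_nonzero: "\<alpha> \<in> pos_roots_B \<Longrightarrow> \<alpha> \<noteq> 0"
  using inner_short_root_B inner_long_root_B by (fastforce simp: pos_roots_B_def)

text \<open>
  The sign of the first nonzero coordinate tells positive roots from negative ones.
\<close>

lemma pos_root_B_leading:
  assumes "\<alpha> \<in> pos_roots_B"
  obtains i where "\<alpha> $ i > 0" "\<And>j. j < i \<Longrightarrow> \<alpha> $ j = 0"
proof (cases "\<alpha> \<in> short_roots_B")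
  case True
  then obtain i where "\<alpha> = axis i 1" by (auto simp: short_roots_B_def)
  then show thesis by (intro that[of i]) (auto simp: axis_def)
next
  case False
  then have "\<alpha> \<in> long_roots_B" using assms by (auto simp: pos_roots_B_def)
  then obtain i j b where "i < j" "\<alpha> = axis i 1 + b *\<^sub>R axis j 1"
    using long_root_B_cases by metis
  then show thesis by (intro that[of i]) (auto simp: axis_def)
qed

lemma uminus_pos_root_B: "\<alpha> \<in> pos_roots_B \<Longrightarrow> - \<alpha> \<notin> pos_roots_B"
proof
  assume "\<alpha> \<in> pos_roots_B" "- \<alpha> \<in> pos_roots_B"
  then obtain i i' where "\<alpha> $ i > 0" "\<And>j. j < i \<Longrightarrow> \<alpha> $ j = 0"
    "(- \<alpha>) $ i' > 0" "\<And>j. j < i' \<Longrightarrow> (- \<alpha>) $ j = 0"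
    using pos_root_B_leading by metis
  then show False by (cases i i' rule: linorder_cases) force+
qed

lemma signed_perm_axis:
  assumes "bij p"
  shows "signed_perm p s (axis i 1) = s (inv p i) *\<^sub>R axis (inv p i) 1"
  using inv_f_f[OF bij_is_inj[OF assms]] surj_f_inv_f[OF bij_is_surj[OF assms]]
  by (auto simp: vec_eq_iff axis_def)

lemma signed_perm_root:
  assumes p: "bij p" and s: "\<And>i. \<bar>s i\<bar> = l" "l > 0" and \<alpha>: "\<alpha> \<in> pos_roots_B"
  obtains \<beta> c where "\<beta> \<in> pos_roots_B" "\<bar>c\<bar> = l" "signed_perm p s \<alpha> = c *\<^sub>R \<beta>"
    "mult_B k \<beta> = mult_B k \<alpha>"
proof (cases "\<alpha> \<in> short_roots_B")
  case True
  then obtain i where "\<alpha> = axis i 1" by (auto simp: short_roots_B_def)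
  then show thesis using True s signed_perm_axis[OF p]
    by (intro that[of "axis (inv p i) 1" "s (inv p i)"])
      (auto simp: pos_roots_B_def mult_B_def short_roots_B_def)
next
  case False
  then have "\<alpha> \<in> long_roots_B" using \<alpha> by (auto simp: pos_roots_B_def)
  then obtain i j b where ij: "i < j" "\<bar>b\<bar> = 1" "\<alpha> = axis i 1 + b *\<^sub>R axis j 1"
    using long_root_B_cases by metis
  have "inv p i \<noteq> inv p j" using ij(1) bij_is_surj[OF p] by (metis less_irrefl surj_f_inv_f)
  moreover have "\<bar>s (inv p i) / l\<bar> = 1" "\<bar>b * s (inv p j) / l\<bar> = 1"
    using s ij(2) by (auto simp: abs_mult)
  ultimately obtain \<beta> c where \<beta>: "\<beta> \<in> long_roots_B" "\<bar>c\<bar> = 1"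
    "(s (inv p i) / l) *\<^sub>R axis (inv p i) 1 + (b * s (inv p j) / l) *\<^sub>R axis (inv p j) 1 = c *\<^sub>R \<beta>"
    using long_roots_B_signs by metis
  have "signed_perm p s \<alpha> = s (inv p i) *\<^sub>R axis (inv p i) 1 + (b * s (inv p j)) *\<^sub>R axis (inv p j) 1"
    using ij(3)
    by (simp add: signed_perm_axis[OF p] linear_add[OF linear_signed_perm] signed_perm_scaleR)
  also have "\<dots> = l *\<^sub>R (c *\<^sub>R \<beta>)"
    unfolding \<beta>(3)[symmetric] using s(2) by (simp add: scaleR_add_right)
  finally have "signed_perm p s \<alpha> = (l * c) *\<^sub>R \<beta>" by simp
  moreover have "\<beta> \<notin> short_roots_B" using \<beta>(1) short_long_disjoint by blast
  ultimately show thesis using \<beta> s(2) False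
    by (intro that[of \<beta> "l * c"]) (auto simp: pos_roots_B_def mult_B_def abs_mult)
qed

text \<open>
  The image of a positive root is a positive root up to a factor of modulus \<open>l\<close>, of the same length and hence of
  the same multiplicity. Distinct positive roots are not proportional, so this permutes them.
\<close>

lemma signed_perm_permutes_roots:
  fixes p :: "'n::{finite,linorder} \<Rightarrow> 'n"
  assumes p: "bij p" and s: "\<And>i. \<bar>s i\<bar> = l" "l > 0"
  obtains \<tau> c where "bij_betw \<tau> pos_roots_B pos_roots_B"
    "\<And>\<alpha>. \<alpha> \<in> pos_roots_B \<Longrightarrow> \<bar>c \<alpha>\<bar> = l"
    "\<And>\<alpha>. \<alpha> \<in> pos_roots_B \<Longrightarrow> signed_perm p s \<alpha> = c \<alpha> *\<^sub>R \<tau> \<alpha>"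
    "\<And>\<alpha>. \<alpha> \<in> pos_roots_B \<Longrightarrow> mult_B k (\<tau> \<alpha>) = mult_B k \<alpha>"
proof -
  have "\<forall>\<alpha>\<in>pos_roots_B. \<exists>\<beta>c. fst \<beta>c \<in> pos_roots_B \<and> \<bar>snd \<beta>c\<bar> = l \<and>
      signed_perm p s \<alpha> = snd \<beta>c *\<^sub>R fst \<beta>c \<and> mult_B k (fst \<beta>c) = mult_B k \<alpha>"
  proof
    fix \<alpha> :: "'n rvec" assume "\<alpha> \<in> pos_roots_B"
    then show "\<exists>\<beta>c. fst \<beta>c \<in> pos_roots_B \<and> \<bar>snd \<beta>c\<bar> = l \<and>
        signed_perm p s \<alpha> = snd \<beta>c *\<^sub>R fst \<beta>c \<and> mult_B k (fst \<beta>c) = mult_B k \<alpha>"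
    proof (rule signed_perm_root[where s = s, OF p s, where k = k])
      fix \<beta> c assume "\<beta> \<in> pos_roots_B" "\<bar>c\<bar> = l"
        "signed_perm p s \<alpha> = c *\<^sub>R \<beta>" "mult_B k \<beta> = mult_B k \<alpha>"
      then show ?thesis by (intro exI[of _ "(\<beta>, c)"]) simp
    qed
  qed
  from bchoice[OF this] obtain \<tau>c where \<tau>c: "\<And>\<alpha>. \<alpha> \<in> pos_roots_B \<Longrightarrow> fst (\<tau>c \<alpha>) \<in> pos_roots_B \<and> \<bar>snd (\<tau>c \<alpha>)\<bar> = l \<and>
      signed_perm p s \<alpha> = snd (\<tau>c \<alpha>) *\<^sub>R fst (\<tau>c \<alpha>) \<and> mult_B k (fst (\<tau>c \<alpha>)) = mult_B k \<alpha>"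
    by blast
  define \<tau> c where "\<tau> = fst \<circ> \<tau>c" and "c = snd \<circ> \<tau>c"
  have \<tau>: "\<tau> \<alpha> \<in> pos_roots_B" "\<bar>c \<alpha>\<bar> = l" "signed_perm p s \<alpha> = c \<alpha> *\<^sub>R \<tau> \<alpha>"
    "mult_B k (\<tau> \<alpha>) = mult_B k \<alpha>" if "\<alpha> \<in> pos_roots_B" for \<alpha>
    using \<tau>c[OF that] by (auto simp: \<tau>_def c_def)
  have "inj_on \<tau> pos_roots_B"
  proof (rule inj_onI)
    fix \<alpha> \<alpha>' assume \<alpha>: "\<alpha> \<in> pos_roots_B" "\<alpha>' \<in> pos_roots_B" and eq: "\<tau> \<alpha> = \<tau> \<alpha>'"
    have inj: "x = y" if "signed_perm p s x = signed_perm p s y" for x y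
      using norm_signed_perm[where s = s, OF p s, where x = "x - y"] that s(2) by (simp add: signed_perm_diff)
    consider "c \<alpha> = c \<alpha>'" | "c \<alpha> = - c \<alpha>'"
      using trans[OF \<tau>(2)[OF \<alpha>(1)] \<tau>(2)[OF \<alpha>(2), symmetric]] unfolding abs_eq_iff by blast
    then show "\<alpha> = \<alpha>'"
    proof cases
      case 1 then show ?thesis using \<tau>(3)[OF \<alpha>(1)] \<tau>(3)[OF \<alpha>(2)] eq by (simp add: inj)
    next
      case 2
      then have "signed_perm p s \<alpha> = signed_perm p s (- \<alpha>')"
        using \<tau>(3)[OF \<alpha>(1)] \<tau>(3)[OF \<alpha>(2)] eq linear_neg[OF linear_signed_perm, of p s \<alpha>'] by simp
      then have "\<alpha> = - \<alpha>'" by (rule inj)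
      then show ?thesis using \<alpha> uminus_pos_root_B by blast
    qed
  qed
  moreover have "\<tau> ` pos_roots_B \<subseteq> pos_roots_B" using \<tau>(1) by auto
  ultimately have "bij_betw \<tau> pos_roots_B pos_roots_B"
    using endo_inj_surj[OF finite_pos_roots_B] by (simp add: bij_betw_def)
  then show thesis using that \<tau> by blast
qed

text \<open>
  The substitution permutes the positive roots up to factors \<open>c \<alpha>\<close>, and these cancel in
  \<open>(\<alpha> \<bullet> \<xi>) / (\<alpha> \<bullet> x)\<close>.
\<close>

lemma dunkl_eigen_signed_perm:
  fixes f :: "'n::{finite,linorder} rvec \<Rightarrow> real"
  assumes f: "dunkl_eigen k y f" and p: "bij p" and s: "\<And>i. \<bar>s i\<bar> = l" "l > 0"
  shows "dunkl_eigen k (signed_perm (inv p) (s \<circ> inv p) y) (f \<circ> signed_perm p s)"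
proof -
  let ?L = "signed_perm p s"
  have ra: "real_analytic f" using f by (simp add: dunkl_eigen_def)
  have raL: "real_analytic (f \<circ> ?L)" by (rule real_analytic_signed_perm[where s = s, OF ra p s])
  have D: "frechet_derivative (f \<circ> ?L) (at x) = frechet_derivative f (at (?L x)) \<circ> ?L" for x
  proof (rule sym, rule frechet_derivative_at, rule diff_chain_at)
    show "(?L has_derivative ?L) (at x)"
      by (rule linear_imp_has_derivative[OF linear_signed_perm])
    show "(f has_derivative frechet_derivative f (at (?L x))) (at (?L x))"
      by (rule real_analytic_derivative(1)[OF ra])
  qed
  obtain \<tau> c where \<tau>: "bij_betw \<tau> pos_roots_B pos_roots_B"
    "\<And>\<alpha>. \<alpha> \<in> pos_roots_B \<Longrightarrow> \<bar>c \<alpha>\<bar> = l"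
    "\<And>\<alpha>. \<alpha> \<in> pos_roots_B \<Longrightarrow> ?L \<alpha> = c \<alpha> *\<^sub>R \<tau> \<alpha>"
    "\<And>\<alpha>. \<alpha> \<in> pos_roots_B \<Longrightarrow> mult_B k (\<tau> \<alpha>) = mult_B k \<alpha>"
    using signed_perm_permutes_roots[where s = s and k = k, OF p s] by blast
  have term_eq: "mult_B k (\<tau> \<alpha>) * (\<tau> \<alpha> \<bullet> ?L \<xi>) * dunkl_quotient (\<tau> \<alpha>) f (?L x) =
      mult_B k \<alpha> * (\<alpha> \<bullet> \<xi>) * dunkl_quotient \<alpha> (f \<circ> ?L) x"
    if \<alpha>: "\<alpha> \<in> pos_roots_B" for \<alpha> \<xi> x
  proof -
    define b where "b = c \<alpha>"
    have b: "b \<noteq> 0" "b\<^sup>2 = l\<^sup>2" using \<tau>(2)[OF \<alpha>] s(2) by (auto simp: b_def)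
    have \<tau>\<alpha>: "\<tau> \<alpha> = (1 / b) *\<^sub>R ?L \<alpha>" using \<tau>(3)[OF \<alpha>] b by (simp add: b_def)
    have inn: "\<tau> \<alpha> \<bullet> ?L z = b * (\<alpha> \<bullet> z)" for z
      unfolding \<tau>\<alpha> using b(1)
      by (simp add: signed_perm_inner[where s = s, OF p s(1)] flip: b(2)) (simp add: power2_eq_square)
    have ne: "\<alpha> \<noteq> 0" "\<tau> \<alpha> \<noteq> 0"
      using \<alpha> pos_root_B_nonzero \<tau>(1) bij_betwE by blast+
    have self: "\<tau> \<alpha> \<bullet> \<tau> \<alpha> = \<alpha> \<bullet> \<alpha>"
      using inn[of \<alpha>] \<tau>(3)[OF \<alpha>] b by (simp add: b_def)
    have refl: "reflection (\<tau> \<alpha>) (?L x) = ?L (reflection \<alpha> x)"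
      unfolding reflection_def self inn signed_perm_diff signed_perm_scaleR \<tau>(3)[OF \<alpha>]
      by (simp add: b_def)
    show ?thesis
    proof (cases "\<alpha> \<bullet> x = 0")
      case False
      then show ?thesis using b \<tau>(4)[OF \<alpha>] by (simp add: dunkl_quotient_def inn refl)
    next
      case True
      have lin: "linear (frechet_derivative f (at (?L x)))"
        using real_analytic_derivative(1)[OF ra, of "?L x"] has_derivative_linear by blast
      have "dunkl_quotient \<alpha> (f \<circ> ?L) x =
          frechet_derivative f (at (?L x)) ((2 / (\<alpha> \<bullet> \<alpha>)) *\<^sub>R (b *\<^sub>R \<tau> \<alpha>))"
        using True ne by (simp add: dunkl_quotient_on_hyperplane[OF raL] D signed_perm_scaleR
            \<tau>(3)[OF \<alpha>] b_def)
      also have "\<dots> = b * frechet_derivative f (at (?L x)) ((2 / (\<tau> \<alpha> \<bullet> \<tau> \<alpha>)) *\<^sub>R \<tau> \<alpha>)"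
        using linear_cmul[OF lin] by (simp add: self)
      also have "\<dots> = b * dunkl_quotient (\<tau> \<alpha>) f (?L x)"
        using True ne inn by (simp add: dunkl_quotient_on_hyperplane[OF ra])
      finally show ?thesis using \<tau>(4)[OF \<alpha>] by (simp add: inn)
    qed
  qed
  have "dunkl_op k \<xi> (f \<circ> ?L) x = dunkl_op k (?L \<xi>) f (?L x)" for \<xi> x
    unfolding dunkl_op_def D
    using sum.reindex_bij_betw[OF \<tau>(1), of
      "\<lambda>\<alpha>. mult_B k \<alpha> * (\<alpha> \<bullet> ?L \<xi>) * dunkl_quotient \<alpha> f (?L x)"] term_eq
    by simp
  then have "dunkl_op k \<xi> (f \<circ> ?L) x = (\<xi> \<bullet> signed_perm (inv p) (s \<circ> inv p) y) * (f \<circ> ?L) x" for \<xi> x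
    using f by (simp add: dunkl_eigen_def signed_perm_adjoint[OF p])
  moreover have "?L 0 = 0" by (simp add: vec_eq_iff)
  ultimately show ?thesis using f raL by (simp add: dunkl_eigen_def)
qed

lemma real_analytic_const: "real_analytic (\<lambda>_ :: 'n::finite rvec. C)"
  unfolding real_analytic_def
proof
  fix a :: "'n rvec"
  let ?c = "\<lambda>m. if m = (\<lambda>_. 0) then C else 0"
  have "((\<lambda>m. ?c m * (\<Prod>i\<in>UNIV. (x $ i - a $ i) ^ m i)) has_sum C) (UNIV :: ('n \<Rightarrow> nat) set)" for x
    by (rule has_sum_finite_neutralI[of "{\<lambda>_. 0}"]) auto
  then show "\<exists>r>0. \<exists>c. \<forall>x\<in>ball a r.
      ((\<lambda>m. c m * (\<Prod>i\<in>UNIV. (x $ i - a $ i) ^ m i)) has_sum C) (UNIV :: ('n \<Rightarrow> nat) set)"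
    by (intro exI[of _ 1] conjI exI[of _ ?c]) auto
qed

lemma dunkl_eigen_0: "dunkl_eigen k (0 :: 'n::{finite,linorder} rvec) (\<lambda>_. 1)"
proof -
  have "dunkl_quotient \<alpha> (\<lambda>_. 1) x = 0" if "\<alpha> \<in> pos_roots_B" for \<alpha> x :: "'n rvec"
    using dunkl_quotient_on_hyperplane[OF real_analytic_const[of 1] pos_root_B_nonzero[OF that]]
    by (cases "\<alpha> \<bullet> x = 0") (simp_all add: dunkl_quotient_def frechet_derivative_const)
  then show ?thesis
    by (simp add: dunkl_eigen_def real_analytic_const dunkl_op_def frechet_derivative_const)
qed

section \<open>Orbits of the Weyl group\<close>

definition orbit_B :: "'n::finite rvec \<Rightarrow> 'n rvec set" where
  "orbit_B x = {signed_perm p s x | p s. bij p \<and> (\<forall>i. \<bar>s i\<bar> = 1)}"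

lemma finite_signs: "finite {s :: 'n::finite \<Rightarrow> real. \<forall>i. \<bar>s i\<bar> = 1}"
proof -
  have "{s :: 'n \<Rightarrow> real. \<forall>i. \<bar>s i\<bar> = 1} \<subseteq> PiE UNIV (\<lambda>_. {-1, 1})"
    by (auto simp: PiE_def abs_if split: if_splits) 
  then show ?thesis by (rule finite_subset) (intro finite_PiE, auto)
qed

lemma finite_signed_perms:
  "finite {signed_perm p s :: 'n::finite rvec \<Rightarrow> _ | p s. bij p \<and> (\<forall>i. \<bar>s i\<bar> = 1)}"
proof -
  have "{signed_perm p s :: 'n rvec \<Rightarrow> _ | p s. bij p \<and> (\<forall>i. \<bar>s i\<bar> = 1)}
      \<subseteq> (\<lambda>(p, s). signed_perm p s) ` (UNIV \<times> {s. \<forall>i. \<bar>s i\<bar> = 1})"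
    by auto
  then show ?thesis by (rule finite_subset) (intro finite_imageI finite_cartesian_product finite_signs, simp)
qed

lemma finite_orbit_B: "finite (orbit_B x)"
proof -
  have "orbit_B x = (\<lambda>g. g x) ` {signed_perm p s | p s. bij p \<and> (\<forall>i. \<bar>s i\<bar> = 1)}"
    by (auto simp: orbit_B_def)
  then show ?thesis using finite_imageI[OF finite_signed_perms, of "\<lambda>g. g x"] by metis
qed

lemma signed_perm_id: "signed_perm id (\<lambda>_. 1) = id"
  by (auto simp: vec_eq_iff fun_eq_iff)

lemma orbit_B_self: "x \<in> orbit_B x"
  unfolding orbit_B_def using signed_perm_id[THEN fun_cong, of x]
  by (intro CollectI exI[of _ id] exI[of _ "\<lambda>_. 1"]) simp

lemma norm_orbit_B: "z \<in> orbit_B x \<Longrightarrow> norm z = norm x"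
  using norm_signed_perm[where l = 1] by (auto simp: orbit_B_def)

lemma orbit_B_abs:
  assumes "z \<in> orbit_B x"
  obtains p where "bij p" "\<And>i. \<bar>z $ i\<bar> = \<bar>x $ p i\<bar>"
  using assms by (auto simp: orbit_B_def abs_mult)

lemma orbit_B_signed_perm:
  assumes "z \<in> orbit_B x" "bij p" "\<And>i. \<bar>s i\<bar> = 1"
  shows "signed_perm p s z \<in> orbit_B x"
proof -
  obtain p' s' where *: "z = signed_perm p' s' x" "bij p'" "\<And>i. \<bar>s' i\<bar> = 1"
    using assms(1) by (auto simp: orbit_B_def)
  then show ?thesis unfolding orbit_B_def
    using assms(2,3) by (auto simp: signed_perm_compose abs_mult intro!: exI bij_comp)
qed

lemma reflection_short:
  fixes i :: "'n::{finite,linorder}"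
  shows "reflection (axis i 1) = signed_perm id (\<lambda>j. if j = i then - 1 else 1)"
proof
  fix x :: "'n rvec"
  have "reflection (axis i 1) x = x - (2 * x $ i) *\<^sub>R axis i 1"
    by (simp add: reflection_def inner_axis')
  then show "reflection (axis i 1) x = signed_perm id (\<lambda>j. if j = i then - 1 else 1) x"
    by (auto simp: vec_eq_iff axis_def)
qed

lemma reflection_long:
  fixes i j :: "'n::{finite,linorder}"
  assumes "i \<noteq> j" "\<bar>b\<bar> = 1"
  shows "reflection (axis i 1 + b *\<^sub>R axis j 1)
    = signed_perm (Transposition.transpose i j) (\<lambda>m. if m = i \<or> m = j then - b else 1)"
proof
  fix x :: "'n rvec"
  have b: "b * b = 1" using assms(2) by (metis abs_mult_self_eq mult_1)
  have "axis i (1::real) $ i = 1" "axis j (1::real) $ j = 1"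
    "axis i (1::real) $ j = 0" "axis j (1::real) $ i = 0"
    using assms(1) by (auto simp: axis_def)
  then have "reflection (axis i 1 + b *\<^sub>R axis j 1) x
      = x - (x $ i + b * x $ j) *\<^sub>R (axis i 1 + b *\<^sub>R axis j 1)"
    using assms(1) b
    by (simp add: reflection_def inner_add_left inner_add_right inner_axis')
  moreover have "(x - (x $ i + b * x $ j) *\<^sub>R (axis i 1 + b *\<^sub>R axis j 1)) $ m
      = signed_perm (Transposition.transpose i j) (\<lambda>m. if m = i \<or> m = j then - b else 1) x $ m" for m
  proof -
    have "b * b * x $ j = x $ j" using b by simp
    then have "x $ j - (x $ i + b * x $ j) * b = - b * x $ i" by (simp add: algebra_simps)
    then show ?thesis using assms(1)
      by (cases "m = i"; cases "m = j") (simp_all add: axis_def transpose_def)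
  qed
  ultimately show "reflection (axis i 1 + b *\<^sub>R axis j 1) x
      = signed_perm (Transposition.transpose i j) (\<lambda>m. if m = i \<or> m = j then - b else 1) x"
    by (simp add: vec_eq_iff)
qed

lemma reflection_signed_perm:
  assumes "\<alpha> \<in> pos_roots_B"
  obtains p s where "bij p" "\<And>i. \<bar>s i\<bar> = 1" "reflection \<alpha> = signed_perm p s"
proof (cases "\<alpha> \<in> short_roots_B")
  case True
  then obtain i where "\<alpha> = axis i 1" by (auto simp: short_roots_B_def)
  then show thesis by (intro that[OF _ _ reflection_short[of i, folded \<open>\<alpha> = axis i 1\<close>]]) auto
next
  case False
  then have "\<alpha> \<in> long_roots_B" using assms by (auto simp: pos_roots_B_def)
  then obtain i j b where *: "i < j" "\<bar>b\<bar> = 1" "\<alpha> = axis i 1 + b *\<^sub>R axis j 1"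
    using long_root_B_cases by metis
  have "i \<noteq> j" using * by auto
  then show thesis
    using *(2) by (intro that[OF _ _ reflection_long[of i j b, folded *(3)]]) auto
qed

lemma orbit_B_reflection: "\<alpha> \<in> pos_roots_B \<Longrightarrow> z \<in> orbit_B x \<Longrightarrow> reflection \<alpha> z \<in> orbit_B x"
  using reflection_signed_perm orbit_B_signed_perm by metis

lemma weyl_group_B_signed_perm:
  assumes "g \<in> weyl_group_B"
  obtains p s where "bij p" "\<And>i. \<bar>s i\<bar> = 1" "g = signed_perm p s"
proof -
  have "\<exists>p s. bij p \<and> (\<forall>i. \<bar>s i\<bar> = 1) \<and> g = signed_perm p s"
    using assms unfolding weyl_group_B_def
  proof (induction rule: reflection_group.induct)
    case 1
    show ?case
      by (intro exI[of _ id] exI[of _ "\<lambda>_. 1"] conjI bij_id signed_perm_id[symmetric]) simp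
  next
    case (2 \<alpha> g)
    then obtain p' s' where g: "bij p'" "\<forall>i. \<bar>s' i\<bar> = 1" "g = signed_perm p' s'" by blast
    obtain p s where r: "bij p" "\<And>i. \<bar>s i\<bar> = 1" "reflection \<alpha> = signed_perm p s"
      using reflection_signed_perm[OF 2(1)] by blast
    show ?case
    proof (intro exI conjI)
      show "bij (p' \<circ> p)" by (rule bij_comp[OF r(1) g(1)])
      show "\<forall>i. \<bar>s i * s' (p i)\<bar> = 1" using g(2) r(2) by (simp add: abs_mult)
      show "reflection \<alpha> \<circ> g = signed_perm (p' \<circ> p) (\<lambda>i. s i * s' (p i))"
        by (rule ext) (simp only: g(3) r(3) comp_apply[of "signed_perm p s"] signed_perm_compose)
    qed
  qed
  then show thesis using that by blast
qed

lemma finite_weyl_group_B: "finite (weyl_group_B :: ('n::{finite,linorder} rvec \<Rightarrow> _) set)"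
  by (rule finite_subset[OF _ finite_signed_perms]) (auto elim!: weyl_group_B_signed_perm)

lemma id_weyl_group_B: "id \<in> weyl_group_B"
  by (simp add: weyl_group_B_def reflection_group.intros)

lemma card_weyl_group_B_pos: "card (weyl_group_B :: ('n::{finite,linorder} rvec \<Rightarrow> _) set) > 0"
  using finite_weyl_group_B id_weyl_group_B by (auto simp: card_gt_0_iff)

section \<open>A comparison principle along rays\<close>

text \<open>
  A maximum principle for finite systems of linear differential inequalities that are singular at \<open>r = 0\<close>. After
  multiplication by \<open>exp (- m r)\<close> the potential \<open>p - m\<close> is negative. At a negative minimum over all components and all
  \<open>r\<close>, the coupling terms have the favourable sign because the \<open>\<kappa> \<alpha>\<close> are nonnegative, so the derivative there is
  strictly positive; then the function is smaller slightly to the left, a contradiction. For \<open>start = 0\<close> only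
  continuity at \<open>0\<close> enters, which is how the singularity is dealt with.
\<close>

lemma orbit_comparison:
  fixes d d' :: "'v \<Rightarrow> real \<Rightarrow> real" and \<sigma> :: "'b \<Rightarrow> 'v \<Rightarrow> 'v"
  assumes fin: "finite S" and start: "0 \<le> start" "start < 1"
    and cont: "\<And>z. z \<in> S \<Longrightarrow> continuous_on {start..1} (d z)"
    and deriv: "\<And>z r. z \<in> S \<Longrightarrow> start < r \<Longrightarrow> r \<le> 1 \<Longrightarrow> (d z has_real_derivative d' z r) (at r)"
    and ineq: "\<And>z r. z \<in> S \<Longrightarrow> start < r \<Longrightarrow> r \<le> 1 \<Longrightarrow>
      r * p z * d z r - (\<Sum>\<alpha>\<in>P. \<kappa> \<alpha> * (d z r - d (\<sigma> \<alpha> z) r)) \<le> r * d' z r"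
    and \<kappa>: "\<And>\<alpha>. \<alpha> \<in> P \<Longrightarrow> 0 \<le> \<kappa> \<alpha>"
    and inv: "\<And>\<alpha> z. \<alpha> \<in> P \<Longrightarrow> z \<in> S \<Longrightarrow> \<sigma> \<alpha> z \<in> S"
    and init: "\<And>z. z \<in> S \<Longrightarrow> 0 \<le> d z start"
    and z: "z \<in> S"
  shows "0 \<le> d z 1"
proof (rule ccontr)
  assume neg: "\<not> 0 \<le> d z 1"
  define m where "m = Max (p ` S) + 1"
  have m: "p v < m" if "v \<in> S" for v
  proof -
    have "p v \<le> Max (p ` S)" by (rule Max_ge) (use fin that in auto)
    then show ?thesis by (simp add: m_def)
  qed
  define D where "D v r = exp (- m * r) * d v r" for v r
  have "\<forall>v\<in>S. \<exists>\<rho>. \<rho> \<in> {start..1} \<and> (\<forall>r\<in>{start..1}. D v \<rho> \<le> D v r)"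
  proof
    fix v assume "v \<in> S"
    then have "continuous_on {start..1} (D v)"
      unfolding D_def by (intro continuous_intros cont)
    then show "\<exists>\<rho>. \<rho> \<in> {start..1} \<and> (\<forall>r\<in>{start..1}. D v \<rho> \<le> D v r)"
      using continuous_attains_inf[of "{start..1}" "D v"] start by auto
  qed
  from bchoice[OF this] obtain \<rho> where \<rho>: "\<forall>v\<in>S. \<rho> v \<in> {start..1} \<and> (\<forall>r\<in>{start..1}. D v (\<rho> v) \<le> D v r)"
    by blast
  have "Min ((\<lambda>v. D v (\<rho> v)) ` S) \<in> (\<lambda>v. D v (\<rho> v)) ` S"
    by (rule Min_in) (use fin z in auto)
  then obtain v where v: "v \<in> S" and vmin: "D v (\<rho> v) = Min ((\<lambda>v. D v (\<rho> v)) ` S)" by fastforce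
  define r where "r = \<rho> v"
  have min: "D v r \<le> D u r'" if "u \<in> S" "r' \<in> {start..1}" for u r'
  proof -
    have "D v r \<le> D u (\<rho> u)" using vmin fin that by (simp add: r_def)
    also have "\<dots> \<le> D u r'" using \<rho> that by blast
    finally show ?thesis .
  qed
  have r: "r \<in> {start..1}" using \<rho> v by (simp add: r_def)
  have "D v r \<le> D z 1" using min[OF z] start by simp
  also have "\<dots> < 0" using neg by (simp add: D_def mult_pos_neg)
  finally have Dneg: "D v r < 0" .
  then have dneg: "d v r < 0" by (simp add: D_def mult_less_0_iff)
  have "0 \<le> D v start" using init[OF v] by (simp add: D_def)
  then have "r \<noteq> start" using Dneg by auto
  then have r': "start < r" "r \<le> 1" "0 < r" using r start by auto
  have "(D v has_real_derivative exp (- m * r) * d' v r + (exp (- m * r) * (- m)) * d v r) (at r)"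
    unfolding D_def[abs_def]
    using DERIV_mult[OF DERIV_chain2[OF DERIV_exp DERIV_cmult_Id[of "-m" r]] deriv[OF v r'(1,2)]]
    by (simp add: add.commute mult_ac)
  moreover have "exp (- m * r) * d' v r + (exp (- m * r) * (- m)) * d v r
      = exp (- m * r) * (d' v r - m * d v r)"
    by (simp add: algebra_simps)
  ultimately have D': "(D v has_real_derivative exp (- m * r) * (d' v r - m * d v r)) (at r)" by simp
  have "(\<Sum>\<alpha>\<in>P. \<kappa> \<alpha> * (d v r - d (\<sigma> \<alpha> v) r)) \<le> 0"
  proof (rule sum_nonpos)
    fix \<alpha> assume \<alpha>: "\<alpha> \<in> P"
    have "D v r \<le> D (\<sigma> \<alpha> v) r" using min[OF inv[OF \<alpha> v] r] .
    then have "d v r \<le> d (\<sigma> \<alpha> v) r" by (simp add: D_def)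
    then show "\<kappa> \<alpha> * (d v r - d (\<sigma> \<alpha> v) r) \<le> 0" using \<kappa>[OF \<alpha>] by (simp add: mult_nonneg_nonpos)
  qed
  then have "r * p v * d v r \<le> r * d' v r" using ineq[OF v r'(1,2)] by linarith
  moreover have "r * m * d v r < r * p v * d v r"
    using m[OF v] r' dneg by (simp add: mult_strict_left_mono mult_strict_right_mono_neg)
  ultimately have "r * (d' v r - m * d v r) > 0" by (simp add: algebra_simps)
  then have "d' v r - m * d v r > 0" using r'(3) by (simp add: zero_less_mult_iff)
  then have "exp (- m * r) * (d' v r - m * d v r) > 0" by simp
  from DERIV_pos_inc_left[OF D' this] obtain e where e: "e > 0" "\<And>h. 0 < h \<Longrightarrow> h < e \<Longrightarrow> D v (r - h) < D v r"
    by blast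
  define h where "h = min (e / 2) (r - start)"
  have "0 < h" "h < e" "r - h \<in> {start..1}" using e(1) r' by (auto simp: h_def)
  then show False using e(2)[of h] min[OF v, of "r - h"] by force
qed

lemma mult_B_nonneg: "0 \<le> fst k \<Longrightarrow> 0 \<le> snd k \<Longrightarrow> 0 \<le> mult_B k \<alpha>"
  by (simp add: mult_B_def)

text \<open>
  In the direction \<open>\<xi> = x\<close> the factor \<open>\<alpha> \<bullet> \<xi>\<close> cancels the denominator of the difference quotient.
\<close>

lemma dunkl_euler:
  assumes "dunkl_eigen k y f"
  shows "frechet_derivative f (at x) x =
    (x \<bullet> y) * f x - (\<Sum>\<alpha>\<in>pos_roots_B. mult_B k \<alpha> * (f x - f (reflection \<alpha> x)))"
proof -
  have "(\<alpha> \<bullet> x) * dunkl_quotient \<alpha> f x = f x - f (reflection \<alpha> x)" for \<alpha>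
    by (cases "\<alpha> \<bullet> x = 0") (simp_all add: dunkl_quotient_def reflection_def)
  moreover have "dunkl_op k x f x = (x \<bullet> y) * f x" using assms by (simp add: dunkl_eigen_def)
  ultimately show ?thesis by (simp add: dunkl_op_def mult.assoc)
qed

lemma dunkl_eigen_ray:
  assumes f: "dunkl_eigen k y f"
  defines "f' \<equiv> \<lambda>z r. frechet_derivative f (at (r *\<^sub>R z)) z"
  shows "((\<lambda>r. f (r *\<^sub>R z)) has_real_derivative f' z r) (at r)"
    and "r * f' z r = r * (z \<bullet> y) * f (r *\<^sub>R z) -
      (\<Sum>\<alpha>\<in>pos_roots_B. mult_B k \<alpha> * (f (r *\<^sub>R z) - f (r *\<^sub>R reflection \<alpha> z)))"
proof -
  have ra: "real_analytic f" using f by (simp add: dunkl_eigen_def)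
  note D = real_analytic_derivative(1)[OF ra, of "r *\<^sub>R z"]
  have lin: "linear (frechet_derivative f (at (r *\<^sub>R z)))" using D by (rule has_derivative_linear)
  have "((\<lambda>r. r *\<^sub>R z) has_derivative (\<lambda>h. h *\<^sub>R z)) (at r)"
    by (auto intro!: derivative_eq_intros)
  from has_derivative_compose[OF this D]
  have "((\<lambda>r. f (r *\<^sub>R z)) has_derivative (\<lambda>h. h * f' z r)) (at r)"
    using linear_cmul[OF lin] by (simp add: f'_def)
  then show "((\<lambda>r. f (r *\<^sub>R z)) has_real_derivative f' z r) (at r)"
    unfolding has_field_derivative_def by (rule has_derivative_eq_rhs) (simp add: fun_eq_iff mult.commute)
  have "r * f' z r = frechet_derivative f (at (r *\<^sub>R z)) (r *\<^sub>R z)"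
    using linear_cmul[OF lin] by (simp add: f'_def)
  then show "r * f' z r = r * (z \<bullet> y) * f (r *\<^sub>R z) -
      (\<Sum>\<alpha>\<in>pos_roots_B. mult_B k \<alpha> * (f (r *\<^sub>R z) - f (r *\<^sub>R reflection \<alpha> z)))"
    unfolding dunkl_euler[OF f] by (simp add: reflection_cscale)
qed

lemma dunkl_ray_continuous:
  "dunkl_eigen k y f \<Longrightarrow> continuous_on S (\<lambda>r. f (r *\<^sub>R z))"
  using dunkl_eigen_ray(1) by (blast intro: DERIV_isCont continuous_at_imp_continuous_on)

lemma dunkl_supersolution:
  fixes f :: "'n::{finite,linorder} rvec \<Rightarrow> real"
  assumes f: "dunkl_eigen k y f" and k: "0 \<le> fst k" "0 \<le> snd k" and start: "0 \<le> start" "start < 1"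
    and cont: "\<And>z. z \<in> orbit_B x \<Longrightarrow> continuous_on {start..1} (V z)"
    and deriv: "\<And>z r. z \<in> orbit_B x \<Longrightarrow> start < r \<Longrightarrow> r \<le> 1 \<Longrightarrow> (V z has_real_derivative V' z r) (at r)"
    and ineq: "\<And>z r. z \<in> orbit_B x \<Longrightarrow> start < r \<Longrightarrow> r \<le> 1 \<Longrightarrow>
      r * (z \<bullet> y) * V z r - (\<Sum>\<alpha>\<in>pos_roots_B. mult_B k \<alpha> * (V z r - V (reflection \<alpha> z) r)) \<le> r * V' z r"
    and init: "\<And>z. z \<in> orbit_B x \<Longrightarrow> f (start *\<^sub>R z) \<le> V z start"
    and z: "z \<in> orbit_B x"
  shows "f z \<le> V z 1"
proof -
  let ?f' = "\<lambda>z r. frechet_derivative f (at (r *\<^sub>R z)) z"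
  have "0 \<le> V z 1 - f (1 *\<^sub>R z)"
  proof (rule orbit_comparison[where S = "orbit_B x" and start = start and p = "\<lambda>z. z \<bullet> y"
        and d = "\<lambda>z r. V z r - f (r *\<^sub>R z)" and d' = "\<lambda>z r. V' z r - ?f' z r"
        and P = pos_roots_B and \<kappa> = "mult_B k" and \<sigma> = reflection])
    show "continuous_on {start..1} (\<lambda>r. V z r - f (r *\<^sub>R z))" if "z \<in> orbit_B x" for z
      by (intro continuous_on_diff cont[OF that] dunkl_ray_continuous[OF f])
    show "((\<lambda>r. V z r - f (r *\<^sub>R z)) has_real_derivative V' z r - ?f' z r) (at r)"
      if "z \<in> orbit_B x" "start < r" "r \<le> 1" for z r
      by (intro DERIV_diff deriv[OF that] dunkl_eigen_ray(1)[OF f])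
    show "r * (z \<bullet> y) * (V z r - f (r *\<^sub>R z)) - (\<Sum>\<alpha>\<in>pos_roots_B. mult_B k \<alpha> *
        (V z r - f (r *\<^sub>R z) - (V (reflection \<alpha> z) r - f (r *\<^sub>R reflection \<alpha> z))))
        \<le> r * (V' z r - ?f' z r)"
      if "z \<in> orbit_B x" "start < r" "r \<le> 1" for z r
      using ineq[OF that] dunkl_eigen_ray(2)[OF f, of r z]
      by (simp add: algebra_simps sum_subtractf sum.distrib)
  qed (use finite_orbit_B start orbit_B_reflection mult_B_nonneg[OF k] init z in auto)
  then show ?thesis by simp
qed

lemma dunkl_subsolution:
  fixes f :: "'n::{finite,linorder} rvec \<Rightarrow> real"
  assumes f: "dunkl_eigen k y f" and k: "0 \<le> fst k" "0 \<le> snd k" and start: "0 \<le> start" "start < 1"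
    and cont: "\<And>z. z \<in> orbit_B x \<Longrightarrow> continuous_on {start..1} (V z)"
    and deriv: "\<And>z r. z \<in> orbit_B x \<Longrightarrow> start < r \<Longrightarrow> r \<le> 1 \<Longrightarrow> (V z has_real_derivative V' z r) (at r)"
    and ineq: "\<And>z r. z \<in> orbit_B x \<Longrightarrow> start < r \<Longrightarrow> r \<le> 1 \<Longrightarrow>
      r * V' z r \<le> r * (z \<bullet> y) * V z r - (\<Sum>\<alpha>\<in>pos_roots_B. mult_B k \<alpha> * (V z r - V (reflection \<alpha> z) r))"
    and init: "\<And>z. z \<in> orbit_B x \<Longrightarrow> V z start \<le> f (start *\<^sub>R z)"
    and z: "z \<in> orbit_B x"
  shows "V z 1 \<le> f z"
proof -
  let ?f' = "\<lambda>z r. frechet_derivative f (at (r *\<^sub>R z)) z"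
  have "0 \<le> f (1 *\<^sub>R z) - V z 1"
  proof (rule orbit_comparison[where S = "orbit_B x" and start = start and p = "\<lambda>z. z \<bullet> y"
        and d = "\<lambda>z r. f (r *\<^sub>R z) - V z r" and d' = "\<lambda>z r. ?f' z r - V' z r"
        and P = pos_roots_B and \<kappa> = "mult_B k" and \<sigma> = reflection])
    show "continuous_on {start..1} (\<lambda>r. f (r *\<^sub>R z) - V z r)" if "z \<in> orbit_B x" for z
      by (intro continuous_on_diff cont[OF that] dunkl_ray_continuous[OF f])
    show "((\<lambda>r. f (r *\<^sub>R z) - V z r) has_real_derivative ?f' z r - V' z r) (at r)"
      if "z \<in> orbit_B x" "start < r" "r \<le> 1" for z r
      by (intro DERIV_diff deriv[OF that] dunkl_eigen_ray(1)[OF f])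
    show "r * (z \<bullet> y) * (f (r *\<^sub>R z) - V z r) - (\<Sum>\<alpha>\<in>pos_roots_B. mult_B k \<alpha> *
        (f (r *\<^sub>R z) - V z r - (f (r *\<^sub>R reflection \<alpha> z) - V (reflection \<alpha> z) r)))
        \<le> r * (?f' z r - V' z r)"
      if "z \<in> orbit_B x" "start < r" "r \<le> 1" for z r
      using ineq[OF that] dunkl_eigen_ray(2)[OF f, of r z]
      by (simp add: algebra_simps sum_subtractf sum.distrib)
  qed (use finite_orbit_B start orbit_B_reflection mult_B_nonneg[OF k] init z in auto)
  then show ?thesis by simp
qed

text \<open>
  Two solutions agree at the origin; each is a supersolution for the other.
\<close>

lemma dunkl_eigen_le:
  fixes f g :: "'n::{finite,linorder} rvec \<Rightarrow> real"
  assumes f: "dunkl_eigen k y f" and g: "dunkl_eigen k y g" and k: "0 \<le> fst k" "0 \<le> snd k"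
  shows "f x \<le> g x"
proof -
  have "f x \<le> g (1 *\<^sub>R x)"
  proof (rule dunkl_supersolution[OF f k, where x = x and start = 0 and V = "\<lambda>z r. g (r *\<^sub>R z)"])
    fix z :: "'n rvec" and r :: real
    show "((\<lambda>r. g (r *\<^sub>R z)) has_real_derivative frechet_derivative g (at (r *\<^sub>R z)) z) (at r)"
      by (rule dunkl_eigen_ray(1)[OF g])
    show "r * (z \<bullet> y) * g (r *\<^sub>R z) -
        (\<Sum>\<alpha>\<in>pos_roots_B. mult_B k \<alpha> * (g (r *\<^sub>R z) - g (r *\<^sub>R reflection \<alpha> z)))
        \<le> r * frechet_derivative g (at (r *\<^sub>R z)) z"
      using dunkl_eigen_ray(2)[OF g, of r z] by simp
    show "f (0 *\<^sub>R z) \<le> g (0 *\<^sub>R z)" using f g by (simp add: dunkl_eigen_def)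
  qed (use dunkl_ray_continuous[OF g] orbit_B_self in auto)
  then show ?thesis by simp
qed

lemma dunkl_eigen_unique:
  fixes f g :: "'n::{finite,linorder} rvec \<Rightarrow> real"
  assumes "dunkl_eigen k y f" "dunkl_eigen k y g" "0 \<le> fst k" "0 \<le> snd k"
  shows "f = g"
  using dunkl_eigen_le[OF assms] dunkl_eigen_le[OF assms(2,1,3,4)] by (intro ext antisym)

lemma dunkl_kernel_eq:
  assumes "dunkl_eigen k y f" "0 \<le> fst k" "0 \<le> snd k"
  shows "dunkl_kernel k x y = f x"
proof -
  have "(THE f. dunkl_eigen k y f) = f"
    by (rule the_equality[of "dunkl_eigen k y", OF assms(1)])
      (rule dunkl_eigen_unique[OF _ assms])
  then show ?thesis by (simp add: dunkl_kernel_def dunkl_eigen_def)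
qed

text \<open>
  The functions \<open>exp (\<plusminus> r \<parallel>x\<parallel> \<parallel>y\<parallel>)\<close> are constant on orbits, so the jump terms vanish, and Cauchy-Schwarz makes them
  a super- and a subsolution. In particular the kernel is positive.
\<close>

lemma dunkl_eigen_exp_bounds:
  fixes f :: "'n::{finite,linorder} rvec \<Rightarrow> real"
  assumes f: "dunkl_eigen k y f" and k: "0 \<le> fst k" "0 \<le> snd k"
  shows "f x \<le> exp (norm x * norm y)" and "exp (- (norm x * norm y)) \<le> f x"
proof -
  let ?R = "norm x * norm y"
  have D: "((\<lambda>r. exp (r * c)) has_real_derivative exp (r * c) * c) (at r)" for c r :: real
    by (auto intro!: derivative_eq_intros)
  have cont: "continuous_on {0..1} (\<lambda>r. exp (r * c))" for c :: real by (intro continuous_intros)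
  have ip: "z \<bullet> y \<le> ?R" "- ?R \<le> z \<bullet> y" if "z \<in> orbit_B x" for z
    using Cauchy_Schwarz_ineq2[of z y] norm_orbit_B[OF that] by auto
  have "f x \<le> exp (1 * ?R)"
  proof (rule dunkl_supersolution[OF f k, where x = x and start = 0 and V = "\<lambda>z r. exp (r * ?R)"])
    fix z r assume z: "z \<in> orbit_B x" "0 < r" "r \<le> (1::real)"
    have "r * (z \<bullet> y) * exp (r * ?R) \<le> r * ?R * exp (r * ?R)"
      using ip[OF z(1)] z(2) by (intro mult_right_mono mult_left_mono) auto
    then show "r * (z \<bullet> y) * exp (r * ?R) -
        (\<Sum>\<alpha>\<in>pos_roots_B. mult_B k \<alpha> * (exp (r * ?R) - exp (r * ?R))) \<le> r * (exp (r * ?R) * ?R)"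
      by (simp add: mult_ac)
  qed (use D cont orbit_B_self f in \<open>auto simp: dunkl_eigen_def\<close>)
  then show "f x \<le> exp ?R" by simp
  have "exp (1 * (- ?R)) \<le> f x"
  proof (rule dunkl_subsolution[OF f k, where x = x and start = 0 and V = "\<lambda>z r. exp (r * (- ?R))"])
    fix z r assume z: "z \<in> orbit_B x" "0 < r" "r \<le> (1::real)"
    have "r * (- ?R) * exp (r * (- ?R)) \<le> r * (z \<bullet> y) * exp (r * (- ?R))"
      using ip[OF z(1)] z(2) by (intro mult_right_mono mult_left_mono) auto
    then show "r * (exp (r * (- ?R)) * (- ?R)) \<le> r * (z \<bullet> y) * exp (r * (- ?R)) -
        (\<Sum>\<alpha>\<in>pos_roots_B. mult_B k \<alpha> * (exp (r * (- ?R)) - exp (r * (- ?R))))"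
      by (simp add: mult_ac)
    show "((\<lambda>r. exp (r * (- ?R))) has_real_derivative exp (r * (- ?R)) * (- ?R)) (at r)"
      by (rule D)
  qed (use cont[of "- ?R"] orbit_B_self f in \<open>auto simp: dunkl_eigen_def\<close>)
  then show "exp (- ?R) \<le> f x" by simp
qed

section \<open>The Bessel function as an orbit average\<close>

text \<open>
  By equivariance and uniqueness, \<open>E(x, g y) = E(g\<^sup>-\<^sup>1 x, y)\<close>. All terms of the Bessel function are thus values of
  one solution on the orbit of \<open>x\<close>.
\<close>

lemma dunkl_kernel_orbit:
  fixes f :: "'n::{finite,linorder} rvec \<Rightarrow> real"
  assumes f: "dunkl_eigen k y f" and k: "0 \<le> fst k" "0 \<le> snd k" and g: "g \<in> weyl_group_B"
  shows "\<exists>z\<in>orbit_B x. dunkl_kernel k x (g y) = f z"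
proof -
  obtain p s where p: "bij p" and s: "\<And>i. \<bar>s i\<bar> = 1" and g: "g = signed_perm p s"
    using weyl_group_B_signed_perm[OF g] by blast
  let ?p = "inv p" and ?s = "s \<circ> inv p"
  have p': "bij ?p" "inv ?p = p" using p by (auto simp: bij_imp_bij_inv inv_inv_eq)
  have "dunkl_eigen k (signed_perm (inv ?p) (?s \<circ> inv ?p) y) (f \<circ> signed_perm ?p ?s)"
    by (rule dunkl_eigen_signed_perm[OF f p'(1), where l = 1]) (use s in auto)
  moreover have "?s \<circ> inv ?p = s" using p p' by (auto simp: fun_eq_iff bij_is_inj)
  ultimately have "dunkl_eigen k (g y) (f \<circ> signed_perm ?p ?s)" using p' g by simp
  then have "dunkl_kernel k x (g y) = f (signed_perm ?p ?s x)"
    using dunkl_kernel_eq[OF _ k] by fastforce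
  moreover have "signed_perm ?p ?s x \<in> orbit_B x"
    by (rule orbit_B_signed_perm[OF orbit_B_self p'(1)]) (use s in auto)
  ultimately show ?thesis by blast
qed

lemma bessel_B_bounds:
  fixes f :: "'n::{finite,linorder} rvec \<Rightarrow> real"
  assumes f: "dunkl_eigen k y f" and k: "0 \<le> fst k" "0 \<le> snd k"
  shows "f x / real (card (weyl_group_B :: ('n rvec \<Rightarrow> 'n rvec) set)) \<le> bessel_B k x y"
    and "(\<And>z. z \<in> orbit_B x \<Longrightarrow> f z \<le> C) \<Longrightarrow> bessel_B k x y \<le> C"
proof -
  let ?W = "weyl_group_B :: ('n rvec \<Rightarrow> 'n rvec) set"
  note W = finite_weyl_group_B[where 'n = 'n] card_weyl_group_B_pos[where 'n = 'n]
  have pos: "0 \<le> f z" for z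
    using dunkl_eigen_exp_bounds(2)[OF f k, of z] exp_ge_zero order_trans by blast
  have nn: "0 \<le> dunkl_kernel k x (g y)" if "g \<in> ?W" for g
    using dunkl_kernel_orbit[OF f k that] pos by metis
  have "f x = dunkl_kernel k x (id y)" using dunkl_kernel_eq[OF f k] by simp
  also have "\<dots> \<le> (\<Sum>g\<in>?W. dunkl_kernel k x (g y))"
    by (rule member_le_sum[where f = "\<lambda>g. dunkl_kernel k x (g y)", OF id_weyl_group_B])
      (use nn W in auto)
  finally show "f x / real (card ?W) \<le> bessel_B k x y"
    unfolding bessel_B_def by (intro divide_right_mono) auto
  assume C: "\<And>z. z \<in> orbit_B x \<Longrightarrow> f z \<le> C"
  have "(\<Sum>g\<in>?W. dunkl_kernel k x (g y)) \<le> (\<Sum>g\<in>?W. C)"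
    by (rule sum_mono) (metis dunkl_kernel_orbit[OF f k] C)
  then show "bessel_B k x y \<le> C"
    unfolding bessel_B_def using W by (simp add: divide_le_eq mult.commute)
qed

text \<open>
  If the Dunkl equations have no solution for \<open>y\<close>, they have none for any point of its orbit and its ray, and
  the definite description denotes the same default value at all these points.
\<close>

lemma dunkl_kernel_no_eigen:
  fixes y :: "'n::{finite,linorder} rvec"
  assumes no: "\<nexists>f. dunkl_eigen k y f" and c: "c > 0" and g: "g \<in> weyl_group_B"
  shows "dunkl_kernel k x (g (c *\<^sub>R y)) = (THE f. False) x"
proof -
  obtain p s where p: "bij p" and s: "\<And>i. \<bar>s i\<bar> = 1" and g: "g = signed_perm p s"
    using weyl_group_B_signed_perm[OF g] by blast
  have "\<not> dunkl_eigen k (g (c *\<^sub>R y)) f" for f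
  proof
    assume f: "dunkl_eigen k (g (c *\<^sub>R y)) f"
    (* The inverse of the signed permutation and dilation that lead from y to g (c y). *)
    define t where "t i = s i / c" for i
    have "dunkl_eigen k (signed_perm (inv p) (t \<circ> inv p) (g (c *\<^sub>R y))) (f \<circ> signed_perm p t)"
      by (rule dunkl_eigen_signed_perm[OF f p, where l = "1 / c"]) (use s c in \<open>auto simp: t_def\<close>)
    moreover have "signed_perm (inv p) (t \<circ> inv p) (g (c *\<^sub>R y)) = y"
    proof -
      have "s i * s i = 1" for i using s[of i] by (metis abs_mult_self_eq mult_1)
      then show ?thesis
        using c surj_f_inv_f[OF bij_is_surj[OF p]] by (simp add: vec_eq_iff g t_def mult.assoc[symmetric])
    qed
    ultimately show False using no by metis
  qed
  then have "(\<lambda>f. dunkl_eigen k (g (c *\<^sub>R y)) f) = (\<lambda>f. False)" by auto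
  then have "(THE f. dunkl_eigen k (g (c *\<^sub>R y)) f) = (THE f. False)" by (rule arg_cong)
  then show ?thesis by (simp add: dunkl_kernel_def dunkl_eigen_def)
qed

lemma bessel_B_no_eigen:
  fixes y :: "'n::{finite,linorder} rvec"
  assumes no: "\<nexists>f. dunkl_eigen k y f" and c: "c > 0"
  shows "bessel_B k x (c *\<^sub>R y) = bessel_B k x y"
  using dunkl_kernel_no_eigen[OF no c] dunkl_kernel_no_eigen[OF no zero_less_one]
  by (simp add: bessel_B_def cong: sum.cong)

section \<open>The exponential growth rate in one dimension\<close>

text \<open>
  The derivative of \<open>phi\<close> below.
\<close>

definition phi' :: "real \<Rightarrow> real" where
  "phi' s = s / (1 + sqrt (1 + s\<^sup>2))"

text \<open>
  The exponential growth rate of the one-dimensional Bessel function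
  \<open>j\<^sub>k(k s) = \<Sum>n. (k s / 2)\<close> to the power \<open>2 n\<close> divided by \<open>n! (k + 1/2) \<dots> (k + n - 1/2)\<close>, namely the limit
  of \<open>ln (j\<^sub>k(k s)) / k\<close> for large \<open>k\<close>.
\<close>

definition phi :: "real \<Rightarrow> real" where
  "phi s = sqrt (1 + s\<^sup>2) - 1 - ln ((1 + sqrt (1 + s\<^sup>2)) / 2)"

lemma sqrt_1_plus_square_pos: "sqrt (1 + s\<^sup>2) \<ge> 1" "sqrt (1 + s\<^sup>2) > 0" "1 + sqrt (1 + s\<^sup>2) > 0"
  by (auto intro: add_pos_nonneg)

lemma sqrt_1_plus_square_gt: "\<bar>s\<bar> < sqrt (1 + s\<^sup>2)"
  by (rule real_less_rsqrt) simp

lemma sqrt_1_plus_square_deriv: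
  "((\<lambda>s. sqrt (1 + s\<^sup>2)) has_real_derivative s / sqrt (1 + s\<^sup>2)) (at s)"
proof -
  have "((\<lambda>s. 1 + s\<^sup>2) has_real_derivative 2 * s) (at s)"
    by (auto intro!: derivative_eq_intros)
  moreover have "(sqrt has_real_derivative inverse (sqrt (1 + s\<^sup>2)) / 2) (at (1 + s\<^sup>2))"
    by (rule DERIV_real_sqrt) (simp add: add_pos_nonneg)
  ultimately have "((\<lambda>s. sqrt (1 + s\<^sup>2)) has_real_derivative inverse (sqrt (1 + s\<^sup>2)) / 2 * (2 * s)) (at s)"
    by (rule DERIV_chain2[where f = sqrt and g = "\<lambda>s. 1 + s\<^sup>2", rotated])
  moreover have "inverse w / 2 * (2 * s) = s / w" for w :: real
    by (cases "w = 0") (auto simp: field_simps)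
  ultimately show ?thesis by simp
qed

lemma mult_phi': "s * phi' s = sqrt (1 + s\<^sup>2) - 1"
proof -
  have "(sqrt (1 + s\<^sup>2))\<^sup>2 = 1 + s\<^sup>2" by simp
  then have "s * s = (sqrt (1 + s\<^sup>2) - 1) * (1 + sqrt (1 + s\<^sup>2))"
    by (simp add: power2_eq_square algebra_simps)
  then show ?thesis using sqrt_1_plus_square_pos(3)[of s] by (simp add: phi'_def divide_simps)
qed

lemma phi_deriv: "(phi has_real_derivative phi' s) (at s)"
proof -
  define w where "w = sqrt (1 + s\<^sup>2)"
  have w: "w > 0" using sqrt_1_plus_square_pos by (simp add: w_def)
  have "((\<lambda>s. sqrt (1 + s\<^sup>2) - 1 - ln ((1 + sqrt (1 + s\<^sup>2)) / 2)) has_real_derivative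
      s / w - (s / w / 2) / ((1 + w) / 2)) (at s)"
    using DERIV_diff[OF DERIV_diff[OF sqrt_1_plus_square_deriv[of s] DERIV_const[of 1]]
        DERIV_chain2[OF DERIV_ln_divide[of "(1 + w) / 2", unfolded w_def]
          DERIV_cdivide[OF DERIV_add[OF DERIV_const[of 1] sqrt_1_plus_square_deriv[of s]]]]]
      sqrt_1_plus_square_pos[of s]
    by (simp add: w_def mult.commute)
  moreover have "s / w - (s / w / 2) / ((1 + w) / 2) = phi' s"
    using w unfolding phi'_def w_def[symmetric] by (simp add: divide_simps) (simp add: algebra_simps)
  ultimately show ?thesis by (simp add: phi_def[abs_def])
qed

lemma phi'_deriv:
  "(phi' has_real_derivative 1 / (sqrt (1 + s\<^sup>2) * (1 + sqrt (1 + s\<^sup>2)))) (at s)"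
proof -
  define w where "w = sqrt (1 + s\<^sup>2)"
  have w: "w > 0" "w * w = 1 + s * s"
    using sqrt_1_plus_square_pos by (auto simp: w_def power2_eq_square)
  have "((\<lambda>s. s / (1 + sqrt (1 + s\<^sup>2))) has_real_derivative
      (1 * (1 + w) - s * (s / w)) / ((1 + w) * (1 + w))) (at s)"
    using DERIV_divide[OF DERIV_ident DERIV_add[OF DERIV_const[of 1] sqrt_1_plus_square_deriv[of s]]]
      sqrt_1_plus_square_pos(3)[of s]
    by (simp add: w_def)
  moreover have "1 * (1 + w) - s * (s / w) = (1 + w) / w"
    using w by (simp add: divide_simps) (simp add: algebra_simps)
  ultimately show ?thesis
    using w unfolding w_def[symmetric] by (simp add: phi'_def[abs_def] divide_simps)
qed

lemma abs_phi'_less_1: "\<bar>phi' s\<bar> < 1"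
  using sqrt_1_plus_square_gt[of s] sqrt_1_plus_square_pos[of s]
  by (simp add: phi'_def abs_divide)

lemma phi'_minus [simp]: "phi' (- s) = - phi' s"
  by (simp add: phi'_def)

lemma phi_minus [simp]: "phi (- s) = phi s"
  by (simp add: phi_def)

lemma phi_abs [simp]: "phi \<bar>s\<bar> = phi s"
  by (simp add: phi_def)

lemma phi_0 [simp]: "phi 0 = 0"
  by (simp add: phi_def)

lemma phi'_nonneg: "s \<ge> 0 \<Longrightarrow> phi' s \<ge> 0"
  using sqrt_1_plus_square_pos[of s] by (simp add: phi'_def)

lemma phi_mono: "0 \<le> a \<Longrightarrow> a \<le> b \<Longrightarrow> phi a \<le> phi b"
  by (rule DERIV_nonneg_imp_nondecreasing) (use phi_deriv phi'_nonneg in \<open>auto intro!: exI\<close>)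

lemma phi_nonneg: "phi s \<ge> 0"
  using phi_mono[of 0 "\<bar>s\<bar>"] by simp

lemma phi_le_abs: "phi s \<le> \<bar>s\<bar>"
proof -
  have "0 - phi 0 \<le> \<bar>s\<bar> - phi \<bar>s\<bar>"
  proof (rule DERIV_nonneg_imp_nondecreasing[of 0 "\<bar>s\<bar>" "\<lambda>s. s - phi s"])
    fix x :: real
    have "((\<lambda>s. s - phi s) has_real_derivative 1 - phi' x) (at x)"
      by (intro DERIV_diff DERIV_ident phi_deriv)
    then show "\<exists>y. ((\<lambda>s. s - phi s) has_real_derivative y) (at x) \<and> 0 \<le> y"
      using abs_phi'_less_1[of x] by (intro exI[of _ "1 - phi' x"]) auto
  qed simp
  then show ?thesis by simp
qed

lemma abs_mult_phi'_deriv_le: "\<bar>s * (1 / (sqrt (1 + s\<^sup>2) * (1 + sqrt (1 + s\<^sup>2))))\<bar> \<le> 1"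
proof -
  have "\<bar>s\<bar> * 1 \<le> sqrt (1 + s\<^sup>2) * (1 + sqrt (1 + s\<^sup>2))"
    using sqrt_1_plus_square_gt[of s] sqrt_1_plus_square_pos[of s] by (intro mult_mono) auto
  then show ?thesis using sqrt_1_plus_square_pos[of s] by (simp add: abs_mult abs_divide)
qed

text \<open>
  The eikonal equation of the one-dimensional Dunkl equation. Inserting \<open>exp (k \<phi>(s)) (1 + \<phi>'(s))\<close> into
  \<open>s E'(s) + k (E(s) - E(- s)) = k s E(s)\<close> and keeping the terms of order \<open>k\<close> leaves this identity.
\<close>

lemma phi'_eq: "s * phi' s + 2 * phi' s / (1 + phi' s) = s"
proof -
  define w where "w = sqrt (1 + s\<^sup>2)"
  have w: "1 + w > 0" "w * w = 1 + s * s" "\<bar>s\<bar> < w"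
    using sqrt_1_plus_square_pos sqrt_1_plus_square_gt by (auto simp: w_def power2_eq_square)
  have 1: "1 + phi' s = (1 + w + s) / (1 + w)"
    using w unfolding phi'_def w_def[symmetric] by (simp add: divide_simps)
  have ne: "1 + w + s \<noteq> 0" using w(3) by auto
  have "2 * phi' s / (1 + phi' s) = 2 * s / (1 + w + s)"
    unfolding 1 using w(1) ne unfolding phi'_def w_def[symmetric] by (simp add: divide_simps)
  moreover have "w - 1 + 2 * s / (1 + w + s) = s"
    using ne w(2) by (simp add: divide_simps) (simp add: algebra_simps)
  ultimately show ?thesis unfolding mult_phi' w_def[symmetric] by simp
qed

text \<open>
  Damping the prefactor \<open>1 + \<phi>'\<close> to \<open>1 + \<theta> \<phi>'\<close> keeps it away from \<open>0\<close>, uniformly in \<open>s\<close>. The eikonal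
  equation is then violated in the wrong direction by at most \<open>(1 - \<theta>) \<bar>s\<bar>\<close>.
\<close>

lemma phi'_ineq:
  assumes "0 \<le> \<theta>" "\<theta> \<le> 1"
  shows "s \<le> s * phi' s + 2 * (\<theta> * phi' s) / (1 + \<theta> * phi' s) + (1 - \<theta>) * \<bar>s\<bar>"
proof -
  define q where "q = phi' s"
  have q: "\<bar>q\<bar> < 1" using abs_phi'_less_1 by (simp add: q_def)
  have "\<bar>\<theta> * q\<bar> \<le> \<bar>q\<bar>" using assms by (simp add: abs_mult mult_left_le_one_le)
  then have tq: "1 + \<theta> * q > 0" "1 + q > 0" using q by auto
  have e: "s = s * q + 2 * q / (1 + q)" using phi'_eq[of s] by (simp add: q_def)
  have d: "2 * q / (1 + q) - 2 * (\<theta> * q) / (1 + \<theta> * q) = 2 * q * (1 - \<theta>) / ((1 + q) * (1 + \<theta> * q))"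
    using tq by (simp add: divide_simps) (simp add: algebra_simps)
  have "2 * q * (1 - \<theta>) / ((1 + q) * (1 + \<theta> * q)) \<le> (1 - \<theta>) * \<bar>s\<bar>"
  proof (cases "s \<ge> 0")
    case False
    then have "q \<le> 0" using sqrt_1_plus_square_pos[of s] by (simp add: q_def phi'_def divide_le_0_iff)
    then have "2 * q * (1 - \<theta>) \<le> 0" using assms by (simp add: mult_nonpos_nonneg)
    then have "2 * q * (1 - \<theta>) / ((1 + q) * (1 + \<theta> * q)) \<le> 0"
      using tq by (simp add: divide_nonpos_pos)
    also have "0 \<le> (1 - \<theta>) * \<bar>s\<bar>" using assms by simp
    finally show ?thesis .
  next
    case True
    then have q0: "q \<ge> 0" using phi'_nonneg by (simp add: q_def)
    have "2 * q \<le> s"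
    proof -
      have "s * 2 \<le> s * (1 + sqrt (1 + s\<^sup>2))" using True by (intro mult_left_mono) auto
      then show ?thesis
        using sqrt_1_plus_square_pos(3)[of s] by (simp add: q_def phi'_def pos_divide_le_eq mult_ac)
    qed
    have "2 * q * (1 - \<theta>) / ((1 + q) * (1 + \<theta> * q)) \<le> 2 * q * (1 - \<theta>) / 1"
    proof (rule divide_left_mono)
      show "1 \<le> (1 + q) * (1 + \<theta> * q)" using q0 assms by (simp add: algebra_simps)
      show "0 \<le> 2 * q * (1 - \<theta>)" using q0 assms by simp
    qed (use tq in auto)
    also have "\<dots> \<le> (1 - \<theta>) * \<bar>s\<bar>"
      using \<open>2 * q \<le> s\<close> True assms mult_left_mono[of "2 * q" s "1 - \<theta>"] by (simp add: mult.commute)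
    finally show ?thesis .
  qed
  then show ?thesis using d e by (simp add: q_def)
qed

text \<open>
  The difference of the two functions \<open>sqrt (1 + (a v)\<^sup>2)\<close> and \<open>sqrt (1 + (a' v)\<^sup>2)\<close> increases in \<open>v\<close>, because
  \<open>u / sqrt (1 + u\<^sup>2)\<close> does in \<open>u\<close>.
\<close>

lemma sqrt_1_plus_square_supermodular:
  fixes a a' b b' :: real
  assumes "0 \<le> a'" "a' \<le> a" "0 \<le> b'" "b' \<le> b"
  shows "sqrt (1 + (a * b')\<^sup>2) + sqrt (1 + (a' * b)\<^sup>2) \<le> sqrt (1 + (a * b)\<^sup>2) + sqrt (1 + (a' * b')\<^sup>2)"
proof -
  define g where "g v = sqrt (1 + (a * v)\<^sup>2) - sqrt (1 + (a' * v)\<^sup>2)" for v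
  have D: "(g has_real_derivative (a * v) / sqrt (1 + (a * v)\<^sup>2) * a - (a' * v) / sqrt (1 + (a' * v)\<^sup>2) * a') (at v)" for v
    unfolding g_def
    using DERIV_chain2[OF sqrt_1_plus_square_deriv DERIV_cmult_Id, of a v]
      DERIV_chain2[OF sqrt_1_plus_square_deriv DERIV_cmult_Id, of a' v]
    by (rule DERIV_diff)
  have mono: "u / sqrt (1 + u\<^sup>2) \<le> v / sqrt (1 + v\<^sup>2)" if "0 \<le> u" "u \<le> v" for u v :: real
  proof -
    have "u * sqrt (1 + v\<^sup>2) \<le> v * sqrt (1 + u\<^sup>2)"
    proof (rule power2_le_imp_le)
      have "u\<^sup>2 \<le> v\<^sup>2" using that by (intro power_mono) auto
      then show "(u * sqrt (1 + v\<^sup>2))\<^sup>2 \<le> (v * sqrt (1 + u\<^sup>2))\<^sup>2"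
        by (simp add: power_mult_distrib algebra_simps)
    qed (use that in auto)
    then show ?thesis using sqrt_1_plus_square_pos[of u] sqrt_1_plus_square_pos[of v]
      by (simp add: divide_simps mult.commute)
  qed
  have "g b' \<le> g b"
  proof (rule DERIV_nonneg_imp_nondecreasing[OF assms(4)])
    fix v assume v: "b' \<le> v" "v \<le> b"
    have "(a' * v) / sqrt (1 + (a' * v)\<^sup>2) * a' \<le> (a * v) / sqrt (1 + (a * v)\<^sup>2) * a"
      using v assms by (intro mult_mono mono mult_right_mono) (auto intro!: divide_nonneg_nonneg)
    then show "\<exists>y. (g has_real_derivative y) (at v) \<and> 0 \<le> y" using D[of v] by (intro exI conjI) auto
  qed
  then show ?thesis by (simp add: g_def)
qed

text \<open>
  Induction on the maximal index: composing \<open>p\<close> with a transposition makes it fix the maximum, and supermodularity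
  says that this does not decrease the sum.
\<close>

lemma rearrangement_supermodular:
  fixes F :: "'a::linorder \<Rightarrow> 'a \<Rightarrow> real"
  assumes super: "\<And>i i' j j'. i \<le> i' \<Longrightarrow> j \<le> j' \<Longrightarrow> F i j' + F i' j \<le> F i j + F i' j'"
    and "finite S" "p permutes S"
  shows "(\<Sum>i\<in>S. F (p i) i) \<le> (\<Sum>i\<in>S. F i i)"
  using assms(2,3)
proof (induction S arbitrary: p rule: finite_linorder_max_induct)
  case empty
  then show ?case by simp
next
  case (insert m S)
  have notin: "m \<notin> S" using insert.hyps(2) by auto
  define p' where "p' = Transposition.transpose m (p m) \<circ> p"
  have p': "p' permutes S" unfolding p'_def by (rule permutes_insert_lemma[OF insert.prems])
  have IH: "(\<Sum>i\<in>S. F (p' i) i) \<le> (\<Sum>i\<in>S. F i i)" by (rule insert.IH[OF p'])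
  have inj: "inj p" using insert.prems by (rule permutes_inj)
  show ?case
  proof (cases "p m = m")
    case True
    then have "p' = p" by (simp add: p'_def)
    then show ?thesis using IH insert.hyps True notin by simp
  next
    case False
    obtain b where b: "p b = m" using insert.prems by (metis permutes_surj surjD)
    have bS: "b \<in> S" using b False insert.prems by (metis insert_iff permutes_def)
    have pmS: "p m \<in> S" using False insert.prems by (metis insert_iff permutes_in_image)
    have p'b: "p' b = p m" by (simp add: p'_def b)
    have p'i: "p' i = p i" if "i \<in> S - {b}" for i
    proof -
      have "p i \<noteq> p m" "p i \<noteq> p b" using that inj notin by (auto dest: injD)
      then show ?thesis by (simp add: p'_def b transpose_apply_other)
    qed
    have "(\<Sum>i\<in>insert m S. F (p i) i) = F (p m) m + F m b + (\<Sum>i\<in>S - {b}. F (p i) i)"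
      using insert.hyps notin bS by (simp add: sum.remove[of S b] b)
    also have "\<dots> \<le> F m m + F (p m) b + (\<Sum>i\<in>S - {b}. F (p i) i)"
      using super[of "p m" m b m] insert.hyps(2) bS pmS by (simp add: less_imp_le)
    also have "\<dots> = F m m + (\<Sum>i\<in>S. F (p' i) i)"
      using insert.hyps bS p'i by (simp add: sum.remove[of S b] p'b)
    also have "\<dots> \<le> (\<Sum>i\<in>insert m S. F i i)" using IH insert.hyps notin by simp
    finally show ?thesis .
  qed
qed

text \<open>
  The map \<open>u \<mapsto> \<phi>(a sqrt u)\<close> is concave; this is its tangent bound at \<open>y'\<^sup>2\<close>. In terms of \<open>b = (1 + v) / (1 + V)\<close> it
  reduces to \<open>ln b \<ge> 1 - 1 / b\<close>.
\<close>

lemma phi_tangent: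
  fixes a y y' :: real
  defines "V \<equiv> sqrt (1 + (a * y')\<^sup>2)"
  shows "phi (a * y) - phi (a * y') \<le> a\<^sup>2 * (y\<^sup>2 - y'\<^sup>2) / (2 * (1 + V))"
proof -
  define v where "v = sqrt (1 + (a * y)\<^sup>2)"
  have V: "V \<ge> 1" "V\<^sup>2 = 1 + a\<^sup>2 * y'\<^sup>2" and v: "v \<ge> 1" "v\<^sup>2 = 1 + a\<^sup>2 * y\<^sup>2"
    by (auto simp: V_def v_def power_mult_distrib)
  define b where "b = (1 + v) / (1 + V)"
  have b: "b > 0" using V v by (simp add: b_def)
  have bV: "1 + v = b * (1 + V)" using V by (simp add: b_def)
  have "phi (a * y) - phi (a * y') = v - V - (ln ((1 + v) / 2) - ln ((1 + V) / 2))"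
    by (simp add: phi_def v_def V_def)
  also have "ln ((1 + v) / 2) - ln ((1 + V) / 2) = ln b"
    using V v by (simp add: b_def ln_div)
  also have "v - V = (b - 1) * (1 + V)" using bV by (simp add: algebra_simps)
  finally have L: "phi (a * y) - phi (a * y') = (b - 1) * (1 + V) - ln b" .
  have "a\<^sup>2 * (y\<^sup>2 - y'\<^sup>2) = v\<^sup>2 - V\<^sup>2" using V v by (simp add: algebra_simps)
  also have "\<dots> = (1 + v - (1 + V)) * (1 + v + (1 + V) - 2)" by (simp add: power2_eq_square algebra_simps)
  also have "\<dots> = (1 + V) * ((b - 1) * ((b + 1) * (1 + V) - 2))" unfolding bV by (simp add: algebra_simps)
  finally have R: "a\<^sup>2 * (y\<^sup>2 - y'\<^sup>2) / (2 * (1 + V)) = (b - 1) * ((b + 1) * (1 + V) - 2) / 2"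
    using V by (simp add: field_simps)
  have RL: "(b - 1) * ((b + 1) * (1 + V) - 2) / 2 - ((b - 1) * (1 + V) - ln b)
      = (b - 1)\<^sup>2 * (1 + V) / 2 - (b - 1) + ln b"
    by (simp add: power2_eq_square field_simps)
  have lnb: "ln b \<ge> 1 - 1 / b" using ln_le_minus_one[of "1 / b"] b by (simp add: ln_div)
  have "0 \<le> (b - 1)\<^sup>2 * (1 + V) / 2 - (b - 1) + ln b"
  proof (cases "b \<ge> 1")
    case True
    have "(b - 1)\<^sup>2 * 2 \<le> (b - 1)\<^sup>2 * (1 + V)" using V by (intro mult_left_mono) auto
    moreover have "(b - 1)\<^sup>2 - (b - 1) + (1 - 1 / b) = (b - 1) * (b - 1)\<^sup>2 / b"
      using b by (simp add: power2_eq_square field_simps)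
    moreover have "0 \<le> (b - 1) * (b - 1)\<^sup>2 / b" using True b by simp
    ultimately show ?thesis using lnb by linarith
  next
    case False
    have "2 / b \<le> 1 + V" using bV v b by (simp add: divide_simps mult.commute)
    then have "(b - 1)\<^sup>2 * (2 / b) \<le> (b - 1)\<^sup>2 * (1 + V)" by (intro mult_left_mono) auto
    moreover have "(b - 1)\<^sup>2 * (2 / b) = 2 * (b - 1 - (1 - 1 / b))"
      using b by (simp add: power2_eq_square field_simps)
    ultimately have "2 * (b - 1 - (1 - 1 / b)) \<le> (b - 1)\<^sup>2 * (1 + V)" by simp
    moreover have "0 \<le> T / 2 - (b - 1) + d" if "2 * (b - 1 - c) \<le> T" "c \<le> d" for T c d :: real
      using that by simp
    ultimately show ?thesis using lnb by blast
  qed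
  then show ?thesis using L R RL by linarith
qed

section \<open>Exponential asymptotics of the Bessel function\<close>

lemma sum_pos_roots_B:
  fixes F :: "'n::{finite,linorder} rvec \<Rightarrow> real"
  shows "(\<Sum>\<alpha>\<in>pos_roots_B. mult_B (k1, k2) \<alpha> * F \<alpha>) =
    k1 * (\<Sum>i\<in>UNIV. F (axis i 1)) + k2 * (\<Sum>\<alpha>\<in>long_roots_B. F \<alpha>)"
proof -
  have fin: "finite (short_roots_B :: 'n rvec set)" "finite (long_roots_B :: 'n rvec set)"
    using finite_pos_roots_B[where 'n = 'n] by (auto simp: pos_roots_B_def)
  have "(\<Sum>\<alpha>\<in>pos_roots_B. mult_B (k1, k2) \<alpha> * F \<alpha>) =
      (\<Sum>\<alpha>\<in>short_roots_B. mult_B (k1, k2) \<alpha> * F \<alpha>) + (\<Sum>\<alpha>\<in>long_roots_B. mult_B (k1, k2) \<alpha> * F \<alpha>)"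
    unfolding pos_roots_B_def using fin short_long_disjoint by (rule sum.union_disjoint)
  also have "(\<Sum>\<alpha>\<in>short_roots_B. mult_B (k1, k2) \<alpha> * F \<alpha>) = (\<Sum>\<alpha>\<in>short_roots_B. k1 * F \<alpha>)"
    by (rule sum.cong) (auto simp: mult_B_def)
  also have "\<dots> = k1 * (\<Sum>\<alpha>\<in>short_roots_B. F \<alpha>)" by (simp add: sum_distrib_left)
  also have "(\<Sum>\<alpha>\<in>short_roots_B. F \<alpha>) = (\<Sum>i\<in>UNIV. F (axis i 1))"
  proof -
    have 1: "(short_roots_B :: 'n rvec set) = range (\<lambda>i. axis i 1)"
      by (auto simp: short_roots_B_def)
    have 2: "inj (\<lambda>i :: 'n. axis i (1 :: real))" by (rule injI) (simp add: axis_eq_axis)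
    show ?thesis unfolding 1 sum.reindex[OF 2] by simp
  qed
  also have "(\<Sum>\<alpha>\<in>long_roots_B. mult_B (k1, k2) \<alpha> * F \<alpha>) = (\<Sum>\<alpha>\<in>long_roots_B. k2 * F \<alpha>)"
    using short_long_disjoint by (intro sum.cong) (auto simp: mult_B_def)
  finally show ?thesis by (simp add: sum_distrib_left)
qed

lemma chamber_B_nonneg: "x \<in> chamber_B \<Longrightarrow> 0 \<le> x $ i"
  and chamber_B_antimono: "x \<in> chamber_B \<Longrightarrow> i \<le> j \<Longrightarrow> x $ j \<le> x $ i"
  by (auto simp: chamber_B_def)

text \<open>
  The coordinates of \<open>x\<close> and \<open>y\<close> both decrease, so their own pairing is the extremal one.
\<close>

lemma orbit_B_rearrangement:
  assumes z: "z \<in> orbit_B x" and x: "x \<in> chamber_B" and y: "y \<in> chamber_B"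
  shows "(\<Sum>i\<in>UNIV. sqrt (1 + (r * (z $ i * y $ i))\<^sup>2)) \<le> (\<Sum>i\<in>UNIV. sqrt (1 + (r * (x $ i * y $ i))\<^sup>2))"
proof -
  obtain p where p: "bij p" "\<And>i. \<bar>z $ i\<bar> = \<bar>x $ p i\<bar>" using orbit_B_abs[OF z] by blast
  define F where "F i j = sqrt (1 + ((\<bar>r\<bar> * x $ i) * y $ j)\<^sup>2)" for i j
  have eq: "(\<Sum>i\<in>UNIV. sqrt (1 + (r * (z $ i * y $ i))\<^sup>2)) = (\<Sum>i\<in>UNIV. F (p i) i)"
  proof (rule sum.cong[OF refl])
    fix i
    have "(z $ i)\<^sup>2 = (x $ p i)\<^sup>2" using p(2)[of i] by (metis power2_abs)
    then show "sqrt (1 + (r * (z $ i * y $ i))\<^sup>2) = F (p i) i"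
      by (simp add: F_def power_mult_distrib)
  qed
  have eq': "(\<Sum>i\<in>UNIV. sqrt (1 + (r * (x $ i * y $ i))\<^sup>2)) = (\<Sum>i\<in>UNIV. F i i)"
    by (simp add: F_def power_mult_distrib mult_ac)
  have "(\<Sum>i\<in>UNIV. F (p i) i) \<le> (\<Sum>i\<in>UNIV. F i i)"
  proof (rule rearrangement_supermodular)
    fix i i' j j' :: 'a assume "i \<le> i'" "j \<le> j'"
    then show "F i j' + F i' j \<le> F i j + F i' j'"
      unfolding F_def using chamber_B_nonneg[OF x] chamber_B_nonneg[OF y]
        chamber_B_antimono[OF x] chamber_B_antimono[OF y]
      by (intro sqrt_1_plus_square_supermodular mult_left_mono) auto
  next
    show "p permutes UNIV" by (rule bij_imp_permutes) (use p(1) in auto)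
  qed auto
  then show ?thesis by (simp add: eq eq')
qed

lemma sum_abs_mult_le_norm:
  fixes z y :: "'n::finite rvec"
  shows "(\<Sum>i\<in>UNIV. \<bar>z $ i * y $ i\<bar>) \<le> norm z * norm y"
proof -
  let ?a = "\<lambda>v :: 'n rvec. (\<chi> i. \<bar>v $ i\<bar>) :: 'n rvec"
  have n: "norm (?a v) = norm v" for v by (simp add: norm_vec_def)
  have "(\<Sum>i\<in>UNIV. \<bar>z $ i * y $ i\<bar>) = ?a z \<bullet> ?a y" by (simp add: inner_vec_def abs_mult)
  also have "\<dots> \<le> norm (?a z) * norm (?a y)" by (rule norm_cauchy_schwarz)
  finally show ?thesis by (simp only: n)
qed

text \<open>
  The WKB ansatz, as a function of the parameter \<open>r\<close> of the ray: \<open>s\<close> holds the products of coordinates, with signs, at the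
  point of the orbit under consideration, \<open>c\<close> those at the ordered point, so that the exponent is
  constant on orbits and only the prefactor depends on \<open>s\<close>. The powers of \<open>exp r\<close> and \<open>r\<close> leave room to absorb
  errors.
\<close>

definition barrier ::
    "real \<Rightarrow> real \<Rightarrow> real \<Rightarrow> real \<Rightarrow> real \<Rightarrow> 'n::finite rvec \<Rightarrow> 'n rvec \<Rightarrow> real \<Rightarrow> real" where
  "barrier a C k D \<theta> c s r = exp (a + C * ln r + k * (\<Sum>i\<in>UNIV. phi (r * c $ i)) + D * r +
    (\<Sum>i\<in>UNIV. ln (1 + \<theta> * phi' (r * s $ i))))"

text \<open>
  The logarithmic derivative of \<open>barrier\<close>, multiplied by \<open>r\<close>.
\<close>

definition barrier_slope ::
    "real \<Rightarrow> real \<Rightarrow> real \<Rightarrow> real \<Rightarrow> 'n::finite rvec \<Rightarrow> 'n rvec \<Rightarrow> real \<Rightarrow> real" where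
  "barrier_slope C k D \<theta> c s r = C + k * (\<Sum>i\<in>UNIV. sqrt (1 + (r * c $ i)\<^sup>2) - 1) + D * r +
    (\<Sum>i\<in>UNIV. \<theta> * (r * s $ i * (1 / (sqrt (1 + (r * s $ i)\<^sup>2) * (1 + sqrt (1 + (r * s $ i)\<^sup>2)))))
      / (1 + \<theta> * phi' (r * s $ i)))"

lemma one_plus_theta_phi'_bounds:
  assumes "0 \<le> \<theta>" "\<theta> \<le> 1"
  shows "0 < 1 + \<theta> * phi' u" "1 - \<theta> \<le> 1 + \<theta> * phi' u" "1 + \<theta> * phi' u \<le> 2"
proof -
  have q: "\<bar>phi' u\<bar> < 1" by (rule abs_phi'_less_1)
  have 1: "\<theta> * \<bar>phi' u\<bar> \<le> \<theta> * 1" "\<theta> * \<bar>phi' u\<bar> \<le> 1 * \<bar>phi' u\<bar>"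
    using q assms by (intro mult_left_mono mult_right_mono; simp)+
  have "\<bar>\<theta> * phi' u\<bar> = \<theta> * \<bar>phi' u\<bar>" using assms by (simp add: abs_mult)
  then show "0 < 1 + \<theta> * phi' u" "1 - \<theta> \<le> 1 + \<theta> * phi' u" "1 + \<theta> * phi' u \<le> 2"
    using 1 q assms by linarith+
qed

lemma barrier_pos: "0 < barrier a C k D \<theta> c s r"
  by (simp add: barrier_def)

lemma barrier_deriv:
  assumes r: "0 < r" and \<theta>: "0 \<le> \<theta>" "\<theta> \<le> 1"
  shows "(barrier a C k D \<theta> c s has_real_derivative
    barrier a C k D \<theta> c s r * barrier_slope C k D \<theta> c s r / r) (at r)"
proof -
  let ?q = "\<lambda>u. 1 / (sqrt (1 + u\<^sup>2) * (1 + sqrt (1 + u\<^sup>2)))"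
  have lin: "((\<lambda>r. r * u) has_real_derivative u) (at r)" for u :: real
    by (auto intro!: derivative_eq_intros)
  have d1: "((\<lambda>r. phi (r * u)) has_real_derivative phi' (r * u) * u) (at r)" for u
    by (rule DERIV_chain2[OF phi_deriv lin])
  have d2: "((\<lambda>r. ln (1 + \<theta> * phi' (r * u))) has_real_derivative
      1 / (1 + \<theta> * phi' (r * u)) * (0 + \<theta> * (?q (r * u) * u))) (at r)" for u
    by (intro DERIV_chain2[OF DERIV_ln_divide] one_plus_theta_phi'_bounds(1)[OF \<theta>] DERIV_add DERIV_const
        DERIV_cmult DERIV_chain2[OF phi'_deriv lin])
  let ?g = "\<lambda>r. a + C * ln r + k * (\<Sum>i\<in>UNIV. phi (r * c $ i)) + D * r +
      (\<Sum>i\<in>UNIV. ln (1 + \<theta> * phi' (r * s $ i)))"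
  have "(?g has_real_derivative
      0 + C * (1 / r) + k * (\<Sum>i\<in>UNIV. phi' (r * c $ i) * c $ i) + D +
      (\<Sum>i\<in>UNIV. 1 / (1 + \<theta> * phi' (r * s $ i)) * (0 + \<theta> * (?q (r * s $ i) * s $ i)))) (at r)"
    by (intro DERIV_add DERIV_const DERIV_cmult DERIV_ln_divide r DERIV_sum d1 d2 DERIV_cmult_Id)
  moreover have "0 + C * (1 / r) + k * (\<Sum>i\<in>UNIV. phi' (r * c $ i) * c $ i) + D +
      (\<Sum>i\<in>UNIV. 1 / (1 + \<theta> * phi' (r * s $ i)) * (0 + \<theta> * (?q (r * s $ i) * s $ i)))
      = barrier_slope C k D \<theta> c s r / r"
  proof -
    have 1: "r * (\<Sum>i\<in>UNIV. phi' (r * c $ i) * c $ i) = (\<Sum>i\<in>UNIV. sqrt (1 + (r * c $ i)\<^sup>2) - 1)"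
      by (simp add: sum_distrib_left mult_phi'[symmetric] mult_ac)
    have 2: "r * (\<Sum>i\<in>UNIV. 1 / (1 + \<theta> * phi' (r * s $ i)) * (0 + \<theta> * (?q (r * s $ i) * s $ i)))
      = (\<Sum>i\<in>UNIV. \<theta> * (r * s $ i * ?q (r * s $ i)) / (1 + \<theta> * phi' (r * s $ i)))"
      unfolding sum_distrib_left by (rule sum.cong) (simp_all add: mult_ac)
    show ?thesis
      unfolding barrier_slope_def 1[symmetric] 2[symmetric] using r
      by (simp add: add_divide_distrib)
  qed
  ultimately have "(?g has_real_derivative barrier_slope C k D \<theta> c s r / r) (at r)" by simp
  from DERIV_chain2[OF DERIV_exp this] show ?thesis
    by (simp add: barrier_def[abs_def])
qed

lemma barrier_continuous:
  assumes "0 < start" "0 \<le> \<theta>" "\<theta> \<le> 1"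
  shows "continuous_on {start..1} (barrier a C k D \<theta> c s)"
proof (intro continuous_at_imp_continuous_on ballI)
  fix r assume "r \<in> {start..1}"
  then have "0 < r" using assms(1) by simp
  then show "isCont (barrier a C k D \<theta> c s) r" by (rule DERIV_isCont[OF barrier_deriv[OF _ assms(2,3)]])
qed

text \<open>
  A sign change of one coordinate replaces one prefactor \<open>1 + \<theta> \<phi>'\<close> by \<open>1 - \<theta> \<phi>'\<close>.
\<close>

lemma barrier_flip:
  assumes \<theta>: "0 \<le> \<theta>" "\<theta> \<le> 1" and s': "s' $ i = - s $ i" "\<And>j. j \<noteq> i \<Longrightarrow> s' $ j = s $ j"
  shows "barrier a C k D \<theta> c s r - barrier a C k D \<theta> c s' r =
    barrier a C k D \<theta> c s r * (2 * (\<theta> * phi' (r * s $ i)) / (1 + \<theta> * phi' (r * s $ i)))"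
proof -
  let ?q = "\<theta> * phi' (r * s $ i)"
  have pos: "0 < 1 + ?q" "0 < 1 - ?q"
    using one_plus_theta_phi'_bounds(1)[OF \<theta>, of "r * s $ i"]
      one_plus_theta_phi'_bounds(1)[OF \<theta>, of "- (r * s $ i)"] by auto
  have "(\<Sum>j\<in>UNIV. ln (1 + \<theta> * phi' (r * s' $ j))) =
      (\<Sum>j\<in>UNIV. ln (1 + \<theta> * phi' (r * s $ j))) - ln (1 + ?q) + ln (1 - ?q)"
    using s' by (simp add: sum.remove[of UNIV i])
  then have "barrier a C k D \<theta> c s' r = barrier a C k D \<theta> c s r * exp (ln (1 - ?q) - ln (1 + ?q))"
    by (simp add: barrier_def exp_add[symmetric])
  also have "exp (ln (1 - ?q) - ln (1 + ?q)) = (1 - ?q) / (1 + ?q)"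
    using pos by (simp add: exp_diff)
  finally show ?thesis using pos by (simp add: field_simps)
qed

text \<open>
  The damped prefactors lie between \<open>\<delta>\<close> and \<open>2\<close>; this bounds the effect of the long roots independently
  of \<open>k1\<close>.
\<close>

lemma barrier_ratio:
  fixes c s s' :: "'n::finite rvec"
  assumes \<delta>: "0 < \<delta>" "\<delta> < 1"
  shows "barrier a C k D (1 - \<delta>) c s' r \<le> barrier a C k D (1 - \<delta>) c s r * (2 / \<delta>) ^ CARD('n)"
proof -
  let ?l = "\<lambda>s i. ln (1 + (1 - \<delta>) * phi' (r * s $ i))"
  note b = one_plus_theta_phi'_bounds[of "1 - \<delta>"]
  have "?l s' i \<le> ?l s i + ln (2 / \<delta>)" for i
  proof -
    have "?l s' i \<le> ln 2" using b[of "r * s' $ i"] \<delta> by simp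
    moreover have "ln \<delta> \<le> ?l s i" using b[of "r * s $ i"] \<delta> by simp
    ultimately show ?thesis using \<delta> by (simp add: ln_div)
  qed
  then have "(\<Sum>i\<in>UNIV. ?l s' i) \<le> (\<Sum>i\<in>UNIV. ?l s i + ln (2 / \<delta>))" by (intro sum_mono)
  also have "\<dots> = (\<Sum>i\<in>UNIV. ?l s i) + real CARD('n) * ln (2 / \<delta>)" by (simp add: sum.distrib)
  finally have "barrier a C k D (1 - \<delta>) c s' r
      \<le> barrier a C k D (1 - \<delta>) c s r * exp (real CARD('n) * ln (2 / \<delta>))"
    by (simp add: barrier_def exp_add[symmetric])
  also have "exp (real CARD('n) * ln (2 / \<delta>)) = (2 / \<delta>) ^ CARD('n)"
    using \<delta> by (simp add: exp_of_nat_mult)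
  finally show ?thesis .
qed

lemma reflection_short_nth:
  fixes z :: "'n::{finite,linorder} rvec"
  shows "reflection (axis i 1) z $ j = (if j = i then - z $ j else z $ j)"
  by (simp add: reflection_short)

text \<open>
  The damped WKB ansatz is a supersolution on \<open>[\<delta>, 1]\<close>: the short roots are handled by \<open>phi'_ineq\<close> and the
  rearrangement inequality, which compares the actual point of the orbit with the ordered one, while the long
  roots and the derivative of the prefactor contribute bounded terms, absorbed by \<open>r\<close> to the power \<open>C\<close>. The latter
  vanishes at \<open>0\<close>, whereas the kernel is \<open>1\<close> there, so the comparison starts at \<open>r = \<delta>\<close>, where the crude exponential bound costs
  \<open>\<delta> \<parallel>x\<parallel> \<parallel>y\<parallel>\<close>.
\<close>

lemma dunkl_eigen_upper_bound:
  fixes f :: "'n::{finite,linorder} rvec \<Rightarrow> real"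
  assumes f: "dunkl_eigen (k1, k2) y f" and k: "0 < k1" "0 \<le> k2"
    and x: "x \<in> chamber_B" and y: "y \<in> chamber_B" and \<delta>: "0 < \<delta>" "\<delta> < 1" and z: "z \<in> orbit_B x"
  defines "C \<equiv> real CARD('n) / \<delta> + k2 * real (card (long_roots_B :: 'n rvec set)) * (2 / \<delta>) ^ CARD('n)"
  shows "f z \<le> exp (k1 * (\<Sum>i\<in>UNIV. phi (x $ i * y $ i / k1)) + 2 * \<delta> * (norm x * norm y) +
    (real CARD('n) * ln 2 - (C + real CARD('n)) * ln \<delta>))"
proof -
  let ?N = "real CARD('n)"
  define R where "R = norm x * norm y"
  have R: "R \<ge> 0" by (simp add: R_def)
  (* At r = \<delta> the barrier has to dominate exp (\<delta> R); its prefactors may be as small as \<delta>. *)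
  define a where "a = \<delta> * R - (C + ?N) * ln \<delta>"
  define c where "c = (\<chi> i. x $ i * y $ i / k1)"
  define s where "s v = (\<chi> i. v $ i * y $ i / k1)" for v :: "'n rvec"
  define V where "V v = barrier a C k1 (\<delta> * R) (1 - \<delta>) c (s v)" for v
  have \<theta>: "0 \<le> 1 - \<delta>" "1 - \<delta> \<le> 1" using \<delta> by auto
  note b = one_plus_theta_phi'_bounds[OF \<theta>]
  have Vpos: "0 < V v r" for v r by (simp add: V_def barrier_pos)
  have sumln: "?N * ln \<delta> \<le> (\<Sum>i\<in>UNIV. ln (1 + (1 - \<delta>) * phi' (r * s v $ i)))"
    "(\<Sum>i\<in>UNIV. ln (1 + (1 - \<delta>) * phi' (r * s v $ i))) \<le> ?N * ln 2" for r v
  proof -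
    have "ln \<delta> \<le> ln (1 + (1 - \<delta>) * phi' u)" "ln (1 + (1 - \<delta>) * phi' u) \<le> ln 2" for u
      using b[of u] \<delta> by auto
    then show "?N * ln \<delta> \<le> (\<Sum>i\<in>UNIV. ln (1 + (1 - \<delta>) * phi' (r * s v $ i)))"
      "(\<Sum>i\<in>UNIV. ln (1 + (1 - \<delta>) * phi' (r * s v $ i))) \<le> ?N * ln 2"
      using sum_bounded_below[of UNIV "ln \<delta>" "\<lambda>i. ln (1 + (1 - \<delta>) * phi' (r * s v $ i))"]
        sum_bounded_above[of UNIV "\<lambda>i. ln (1 + (1 - \<delta>) * phi' (r * s v $ i))" "ln 2"] by auto
  qed
  have "f z \<le> V z 1"
  proof (rule dunkl_supersolution[OF f, where x = x and start = \<delta>])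
    fix v r assume v: "v \<in> orbit_B x" and r: "\<delta> < r" "r \<le> 1"
    have r0: "0 < r" using r \<delta> by simp
    define B where "B = (2 / \<delta>) ^ CARD('n)"
    let ?u = "\<lambda>i. r * s v $ i" and ?L = "real (card (long_roots_B :: 'n rvec set))"
    let ?Q = "\<lambda>i. 2 * ((1 - \<delta>) * phi' (?u i)) / (1 + (1 - \<delta>) * phi' (?u i))"
    show "(V v has_real_derivative V v r * barrier_slope C k1 (\<delta> * R) (1 - \<delta>) c (s v) r / r) (at r)"
      unfolding V_def by (rule barrier_deriv[OF r0 \<theta>])
    have short: "V v r - V (reflection (axis i 1) v) r = V v r * ?Q i" for i
      unfolding V_def by (rule barrier_flip[OF \<theta>]) (auto simp: s_def reflection_short_nth)
    have long: "- (B * V v r) \<le> V v r - V (reflection \<alpha> v) r" for \<alpha>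
      using barrier_ratio[OF \<delta>, of a C k1 "\<delta> * R" c "s (reflection \<alpha> v)" r "s v"] Vpos[of v r]
      unfolding V_def B_def by (simp add: mult.commute)
    have "?L * (- (B * V v r)) \<le> (\<Sum>\<alpha>\<in>long_roots_B. V v r - V (reflection \<alpha> v) r)"
      by (rule sum_bounded_below) (rule long)
    then have long': "k2 * (?L * (- (B * V v r))) \<le> k2 * (\<Sum>\<alpha>\<in>long_roots_B. V v r - V (reflection \<alpha> v) r)"
      using k by (intro mult_left_mono) auto
    have "(\<Sum>\<alpha>\<in>pos_roots_B. mult_B (k1, k2) \<alpha> * (V v r - V (reflection \<alpha> v) r)) =
        k1 * (V v r * (\<Sum>i\<in>UNIV. ?Q i)) + k2 * (\<Sum>\<alpha>\<in>long_roots_B. V v r - V (reflection \<alpha> v) r)"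
      by (simp add: sum_pos_roots_B short sum_distrib_left)
    then have roots: "V v r * (k1 * (\<Sum>i\<in>UNIV. ?Q i) - k2 * ?L * B)
        \<le> (\<Sum>\<alpha>\<in>pos_roots_B. mult_B (k1, k2) \<alpha> * (V v r - V (reflection \<alpha> v) r))"
      using long' by (simp add: algebra_simps)
    have inner: "r * (v \<bullet> y) = k1 * (\<Sum>i\<in>UNIV. ?u i)"
      using k by (simp add: s_def inner_vec_def sum_distrib_left)
    have "(\<Sum>i\<in>UNIV. ?u i) \<le> (\<Sum>i\<in>UNIV. (sqrt (1 + (?u i)\<^sup>2) - 1) + ?Q i + \<delta> * \<bar>?u i\<bar>)"
      using phi'_ineq[OF \<theta>] by (intro sum_mono) (simp add: mult_phi')
    also have "\<dots> = (\<Sum>i\<in>UNIV. sqrt (1 + (?u i)\<^sup>2)) - ?N + (\<Sum>i\<in>UNIV. ?Q i) + \<delta> * (\<Sum>i\<in>UNIV. \<bar>?u i\<bar>)"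
      by (simp add: sum.distrib sum_subtractf sum_distrib_left)
    also have "(\<Sum>i\<in>UNIV. sqrt (1 + (?u i)\<^sup>2)) \<le> (\<Sum>i\<in>UNIV. sqrt (1 + (r * c $ i)\<^sup>2))"
      using orbit_B_rearrangement[OF v x y, of "r / k1"] by (simp add: s_def c_def)
    finally have "(\<Sum>i\<in>UNIV. ?u i) \<le> (\<Sum>i\<in>UNIV. sqrt (1 + (r * c $ i)\<^sup>2)) - ?N + (\<Sum>i\<in>UNIV. ?Q i) +
        \<delta> * (\<Sum>i\<in>UNIV. \<bar>?u i\<bar>)" by simp
    then have "k1 * (\<Sum>i\<in>UNIV. ?u i) \<le> k1 * ((\<Sum>i\<in>UNIV. sqrt (1 + (r * c $ i)\<^sup>2)) - ?N + (\<Sum>i\<in>UNIV. ?Q i) +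
        \<delta> * (\<Sum>i\<in>UNIV. \<bar>?u i\<bar>))" using k by (intro mult_left_mono) auto
    also have "\<dots> = k1 * (\<Sum>i\<in>UNIV. sqrt (1 + (r * c $ i)\<^sup>2) - 1) + k1 * (\<Sum>i\<in>UNIV. ?Q i) +
        \<delta> * (k1 * (\<Sum>i\<in>UNIV. \<bar>?u i\<bar>))"
      by (simp add: sum_subtractf algebra_simps)
    also have "k1 * (\<Sum>i\<in>UNIV. \<bar>?u i\<bar>) = r * (\<Sum>i\<in>UNIV. \<bar>v $ i * y $ i\<bar>)"
      using k r0 by (simp add: s_def sum_distrib_left abs_mult)
    also have "\<dots> \<le> r * R"
      using sum_abs_mult_le_norm[of v y] r0 norm_orbit_B[OF v] by (simp add: R_def)
    finally have main: "r * (v \<bullet> y) - k1 * (\<Sum>i\<in>UNIV. ?Q i)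
        \<le> k1 * (\<Sum>i\<in>UNIV. sqrt (1 + (r * c $ i)\<^sup>2) - 1) + \<delta> * R * r"
      using \<delta> unfolding inner by (simp add: mult_ac)
    let ?E = "\<lambda>i. (1 - \<delta>) * (?u i * (1 / (sqrt (1 + (?u i)\<^sup>2) * (1 + sqrt (1 + (?u i)\<^sup>2)))))
      / (1 + (1 - \<delta>) * phi' (?u i))"
    have "- (1 / \<delta>) \<le> ?E i" for i
    proof -
      let ?e = "?u i * (1 / (sqrt (1 + (?u i)\<^sup>2) * (1 + sqrt (1 + (?u i)\<^sup>2))))"
      have "\<bar>?e\<bar> \<le> 1" by (rule abs_mult_phi'_deriv_le)
      then have "(1 - \<delta>) * \<bar>?e\<bar> \<le> 1 * 1" using \<theta> by (intro mult_mono) auto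
      moreover have "\<bar>(1 - \<delta>) * ?e\<bar> = (1 - \<delta>) * \<bar>?e\<bar>" using \<theta> by (simp only: abs_mult[of "1 - \<delta>"] abs_of_nonneg)
      ultimately have "\<bar>(1 - \<delta>) * ?e\<bar> \<le> 1" by (simp only: mult_1)
      then have "\<bar>?E i\<bar> \<le> 1 / \<delta>"
        using b[of "?u i"] \<delta> unfolding abs_divide by (intro frac_le) auto
      then show ?thesis by linarith
    qed
    then have err: "?N * (- (1 / \<delta>)) \<le> (\<Sum>i\<in>UNIV. ?E i)"
      using sum_bounded_below[of UNIV "- (1 / \<delta>)" ?E] by simp
    have "r * (v \<bullet> y) - (k1 * (\<Sum>i\<in>UNIV. ?Q i) - k2 * ?L * B)
        \<le> barrier_slope C k1 (\<delta> * R) (1 - \<delta>) c (s v) r"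
      using main err unfolding barrier_slope_def C_def B_def[symmetric] by simp
    then have "V v r * (r * (v \<bullet> y) - (k1 * (\<Sum>i\<in>UNIV. ?Q i) - k2 * ?L * B))
        \<le> V v r * barrier_slope C k1 (\<delta> * R) (1 - \<delta>) c (s v) r"
      using Vpos[of v r] by (intro mult_left_mono) auto
    then show "r * (v \<bullet> y) * V v r -
        (\<Sum>\<alpha>\<in>pos_roots_B. mult_B (k1, k2) \<alpha> * (V v r - V (reflection \<alpha> v) r))
        \<le> r * (V v r * barrier_slope C k1 (\<delta> * R) (1 - \<delta>) c (s v) r / r)"
      using roots r0 by (simp add: algebra_simps)
  next
    fix v assume v: "v \<in> orbit_B x"
    show "continuous_on {\<delta>..1} (V v)"
      unfolding V_def by (rule barrier_continuous) (use \<delta> in auto)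
    have "f (\<delta> *\<^sub>R v) \<le> exp (\<delta> * R)"
      using dunkl_eigen_exp_bounds(1)[OF f, of "\<delta> *\<^sub>R v"] k \<delta> norm_orbit_B[OF v]
      by (simp add: R_def mult.assoc)
    also have "\<dots> \<le> V v \<delta>"
    proof -
      have "0 \<le> k1 * (\<Sum>i\<in>UNIV. phi (\<delta> * c $ i)) + \<delta> * R * \<delta>"
        using k \<delta> R by (intro add_nonneg_nonneg mult_nonneg_nonneg sum_nonneg phi_nonneg) auto
      then show ?thesis
        using sumln(1)[of \<delta> v] unfolding V_def barrier_def a_def by (simp add: algebra_simps)
    qed
    finally show "f (\<delta> *\<^sub>R v) \<le> V v \<delta>" .
  qed (use \<delta> k z in auto)
  also have "V z 1 \<le> exp (k1 * (\<Sum>i\<in>UNIV. phi (c $ i)) + 2 * \<delta> * R + (?N * ln 2 - (C + ?N) * ln \<delta>))"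
    using sumln(2)[of 1 z] unfolding V_def barrier_def a_def by simp
  finally show ?thesis by (simp add: c_def R_def)
qed

text \<open>
  The undamped ansatz, cut off to \<open>0\<close> outside the points that differ from \<open>x\<close> by signs only, is a
  subsolution: short roots preserve this set, on which the eikonal equation is exact, and leaving it through a long root costs at most
  the value itself, which \<open>r\<close> to the power \<open>- C\<close> pays for.
\<close>

lemma dunkl_eigen_lower_bound:
  fixes f :: "'n::{finite,linorder} rvec \<Rightarrow> real"
  assumes f: "dunkl_eigen (k1, k2) y f" and k: "0 < k1" "0 \<le> k2"
    and x: "x \<in> chamber_B" and y: "y \<in> chamber_B" and \<delta>: "0 < \<delta>" "\<delta> < 1"
  defines "C \<equiv> real CARD('n) + k2 * real (card (long_roots_B :: 'n rvec set))"
  shows "exp (k1 * (\<Sum>i\<in>UNIV. phi (x $ i * y $ i / k1)) - 2 * \<delta> * (norm x * norm y) +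
    (C * ln \<delta> - real CARD('n) * ln 2)) \<le> f x"
proof -
  let ?N = "real CARD('n)"
  define R where "R = norm x * norm y"
  (* At r = \<delta> the barrier has to stay below exp (- \<delta> R), although its exponent may reach \<delta> R
     and its prefactors 2. *)
  define a where "a = C * ln \<delta> - ?N * ln 2 - 2 * \<delta> * R"
  define c where "c = (\<chi> i. x $ i * y $ i / k1)"
  have c0: "0 \<le> c $ i" for i
    using chamber_B_nonneg[OF x] chamber_B_nonneg[OF y] k by (simp add: c_def)
  define s where "s v = (\<chi> i. v $ i * y $ i / k1)" for v :: "'n rvec"
  define G where "G v = barrier a (- C) k1 0 1 c (s v)" for v
  define T where "T = {v :: 'n rvec. \<forall>i. \<bar>v $ i\<bar> = x $ i}"
  define V where "V v r = (if v \<in> T then G v r else 0)" for v r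
  have Gpos: "0 < G v r" for v r by (simp add: G_def barrier_pos)
  have Vnn: "0 \<le> V v r" for v r using Gpos[of v r] by (simp add: V_def)
  have flipT: "reflection (axis i 1) v \<in> T \<longleftrightarrow> v \<in> T" for v i
  proof -
    have "\<bar>reflection (axis i 1) v $ j\<bar> = \<bar>v $ j\<bar>" for j by (simp add: reflection_short_nth)
    then show ?thesis by (simp add: T_def)
  qed
  have "V x 1 \<le> f x"
  proof (rule dunkl_subsolution[OF f, where x = x and start = \<delta>])
    fix v r assume v: "v \<in> orbit_B x" and r: "\<delta> < r" "r \<le> 1"
    have r0: "0 < r" using r \<delta> by simp
    let ?u = "\<lambda>i. r * s v $ i" and ?L = "real (card (long_roots_B :: 'n rvec set))"
    let ?Q = "\<lambda>i. 2 * (1 * phi' (?u i)) / (1 + 1 * phi' (?u i))"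
    let ?V' = "if v \<in> T then G v r * barrier_slope (- C) k1 0 1 c (s v) r / r else 0"
    show "(V v has_real_derivative ?V') (at r)"
    proof (cases "v \<in> T")
      case True
      then have "V v = G v" by (simp add: V_def fun_eq_iff)
      then show ?thesis using True barrier_deriv[OF r0, of 1] by (simp add: G_def)
    next
      case False
      then have "V v = (\<lambda>_. 0)" by (simp add: V_def fun_eq_iff)
      then show ?thesis using False by simp
    qed
    show "r * ?V' \<le> r * (v \<bullet> y) * V v r -
        (\<Sum>\<alpha>\<in>pos_roots_B. mult_B (k1, k2) \<alpha> * (V v r - V (reflection \<alpha> v) r))"
    proof (cases "v \<in> T")
      case False
      then have "(\<Sum>\<alpha>\<in>pos_roots_B. mult_B (k1, k2) \<alpha> * (V v r - V (reflection \<alpha> v) r)) \<le> 0"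
      proof (intro sum_nonpos)
        fix \<alpha> :: "'n rvec"
        have "0 \<le> mult_B (k1, k2) \<alpha> * V (reflection \<alpha> v) r"
          using Vnn k by (intro mult_nonneg_nonneg mult_B_nonneg) auto
        then show "mult_B (k1, k2) \<alpha> * (V v r - V (reflection \<alpha> v) r) \<le> 0"
          using False by (simp add: V_def)
      qed
      then show ?thesis using False by (simp add: V_def)
    next
      case True
      have VG: "V v r = G v r" using True by (simp add: V_def)
      have short: "V v r - V (reflection (axis i 1) v) r = G v r * ?Q i" for i
        using True flipT[of i v] barrier_flip[of 1 "s (reflection (axis i 1) v)" i "s v" a "- C" k1 0 c r]
        by (simp add: V_def G_def s_def reflection_short_nth)
      have "(\<Sum>\<alpha>\<in>long_roots_B. V v r - V (reflection \<alpha> v) r) \<le> ?L * G v r"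
        by (rule sum_bounded_above) (use Vnn VG in simp)
      then have long: "k2 * (\<Sum>\<alpha>\<in>long_roots_B. V v r - V (reflection \<alpha> v) r) \<le> k2 * (?L * G v r)"
        using k by (intro mult_left_mono) auto
      have "(\<Sum>\<alpha>\<in>pos_roots_B. mult_B (k1, k2) \<alpha> * (V v r - V (reflection \<alpha> v) r)) =
          k1 * (G v r * (\<Sum>i\<in>UNIV. ?Q i)) + k2 * (\<Sum>\<alpha>\<in>long_roots_B. V v r - V (reflection \<alpha> v) r)"
        by (simp add: sum_pos_roots_B short sum_distrib_left)
      then have roots: "(\<Sum>\<alpha>\<in>pos_roots_B. mult_B (k1, k2) \<alpha> * (V v r - V (reflection \<alpha> v) r))
          \<le> G v r * (k1 * (\<Sum>i\<in>UNIV. ?Q i) + k2 * ?L)"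
        using long by (simp add: algebra_simps)
      have inner: "r * (v \<bullet> y) = k1 * (\<Sum>i\<in>UNIV. ?u i)"
        using k by (simp add: s_def inner_vec_def sum_distrib_left)
      have "?u i = (sqrt (1 + (r * c $ i)\<^sup>2) - 1) + ?Q i" for i
      proof -
        have "(v $ i)\<^sup>2 = (x $ i)\<^sup>2" using True unfolding T_def by (metis (mono_tags) mem_Collect_eq power2_abs)
        then have "(?u i)\<^sup>2 = (r * c $ i)\<^sup>2"
          by (simp add: s_def c_def power_mult_distrib power_divide)
        then show ?thesis using phi'_eq[of "?u i"] mult_phi'[of "?u i"] by simp
      qed
      then have "(\<Sum>i\<in>UNIV. ?u i) = (\<Sum>i\<in>UNIV. (sqrt (1 + (r * c $ i)\<^sup>2) - 1) + ?Q i)" by simp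
      then have main: "r * (v \<bullet> y) - k1 * (\<Sum>i\<in>UNIV. ?Q i) = k1 * (\<Sum>i\<in>UNIV. sqrt (1 + (r * c $ i)\<^sup>2) - 1)"
        unfolding inner sum.distrib by (simp add: algebra_simps)
      let ?E = "\<lambda>i. 1 * (?u i * (1 / (sqrt (1 + (?u i)\<^sup>2) * (1 + sqrt (1 + (?u i)\<^sup>2)))))
        / (1 + 1 * phi' (?u i))"
      have "?E i \<le> 1" for i
      proof (cases "?u i \<ge> 0")
        case True
        let ?e = "?u i * (1 / (sqrt (1 + (?u i)\<^sup>2) * (1 + sqrt (1 + (?u i)\<^sup>2))))"
        have "?e \<le> 1" using abs_mult_phi'_deriv_le[of "?u i"] by linarith
        also have "1 \<le> 1 + 1 * phi' (?u i)" using phi'_nonneg[OF True] by simp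
        finally have le: "?e \<le> 1 + 1 * phi' (?u i)" .
        have quot: "1 * e / (1 + 1 * q) \<le> 1" if "e \<le> 1 + 1 * q" "0 < 1 + 1 * q" for e q :: real
          using that by simp
        show ?thesis by (rule quot[OF le one_plus_theta_phi'_bounds(1)]) auto
      next
        case False
        have neg: "?u i \<le> 0" using False by linarith
        have "?u i * (1 / (sqrt (1 + (?u i)\<^sup>2) * (1 + sqrt (1 + (?u i)\<^sup>2)))) \<le> 0"
          by (rule mult_nonpos_nonneg[OF neg]) simp
        then have "1 * (?u i * (1 / (sqrt (1 + (?u i)\<^sup>2) * (1 + sqrt (1 + (?u i)\<^sup>2))))) \<le> 0" by linarith
        then have "?E i \<le> 0" by (intro divide_nonpos_pos one_plus_theta_phi'_bounds(1)) auto
        then show ?thesis by simp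
      qed
      then have err: "(\<Sum>i\<in>UNIV. ?E i) \<le> ?N"
        using sum_bounded_above[of UNIV ?E 1] by simp
      have "barrier_slope (- C) k1 0 1 c (s v) r \<le> r * (v \<bullet> y) - (k1 * (\<Sum>i\<in>UNIV. ?Q i) + k2 * ?L)"
        using main err unfolding barrier_slope_def C_def by simp
      then have "G v r * barrier_slope (- C) k1 0 1 c (s v) r
          \<le> G v r * (r * (v \<bullet> y) - (k1 * (\<Sum>i\<in>UNIV. ?Q i) + k2 * ?L))"
        using Gpos[of v r] by (intro mult_left_mono) auto
      then show ?thesis using roots r0 True VG by (simp add: algebra_simps)
    qed
  next
    fix v assume v: "v \<in> orbit_B x"
    show "continuous_on {\<delta>..1} (V v)"
      using barrier_continuous[OF \<delta>(1), of 1] by (cases "v \<in> T") (simp_all add: V_def[abs_def] G_def)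
    have "V v \<delta> \<le> exp (- (\<delta> * R))"
    proof (cases "v \<in> T")
      case True
      have "(\<Sum>i\<in>UNIV. ln (1 + 1 * phi' (\<delta> * s v $ i))) \<le> ?N * ln 2"
        using sum_bounded_above[of UNIV "\<lambda>i. ln (1 + 1 * phi' (\<delta> * s v $ i))" "ln 2"]
          one_plus_theta_phi'_bounds[of 1] by simp
      moreover have "k1 * (\<Sum>i\<in>UNIV. phi (\<delta> * c $ i)) \<le> \<delta> * R"
      proof -
        have "(\<Sum>i\<in>UNIV. phi (\<delta> * c $ i)) \<le> (\<Sum>i\<in>UNIV. \<delta> * (\<bar>x $ i * y $ i\<bar> / k1))"
        proof (rule sum_mono)
          fix i show "phi (\<delta> * c $ i) \<le> \<delta> * (\<bar>x $ i * y $ i\<bar> / k1)"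
            using phi_le_abs[of "\<delta> * c $ i"] \<delta> k by (simp add: c_def abs_mult)
        qed
        then have "k1 * (\<Sum>i\<in>UNIV. phi (\<delta> * c $ i)) \<le> k1 * (\<Sum>i\<in>UNIV. \<delta> * (\<bar>x $ i * y $ i\<bar> / k1))"
          using k by (intro mult_left_mono) auto
        also have "\<dots> = \<delta> * (\<Sum>i\<in>UNIV. \<bar>x $ i * y $ i\<bar>)" using k by (simp add: sum_distrib_left)
        also have "\<dots> \<le> \<delta> * R" using sum_abs_mult_le_norm[of x y] \<delta> by (simp add: R_def)
        finally show ?thesis .
      qed
      ultimately show ?thesis using True
        unfolding V_def G_def barrier_def a_def by (simp add: mult.commute[of R \<delta>])
    qed (simp add: V_def)
    also have "\<dots> \<le> f (\<delta> *\<^sub>R v)"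
      using dunkl_eigen_exp_bounds(2)[OF f, of "\<delta> *\<^sub>R v"] k \<delta> norm_orbit_B[OF v]
      by (simp add: R_def mult.assoc)
    finally show "V v \<delta> \<le> f (\<delta> *\<^sub>R v)" .
  qed (use \<delta> k orbit_B_self in auto)
  moreover have "exp (k1 * (\<Sum>i\<in>UNIV. phi (c $ i)) - 2 * \<delta> * R + (C * ln \<delta> - ?N * ln 2)) \<le> V x 1"
  proof -
    have "x \<in> T" using chamber_B_nonneg[OF x] by (simp add: T_def)
    moreover have "0 \<le> (\<Sum>i\<in>UNIV. ln (1 + 1 * phi' (1 * s x $ i)))"
      using c0 phi'_nonneg by (intro sum_nonneg) (simp add: s_def c_def)
    ultimately show ?thesis unfolding V_def G_def barrier_def a_def by simp
  qed
  ultimately show ?thesis by (simp add: c_def R_def)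
qed

text \<open>
  The error is small relative to \<open>k1 + \<parallel>x\<parallel> \<parallel>y\<parallel>\<close> for large \<open>k1\<close>, uniformly in the whole chamber. The linear growth
  in \<open>\<parallel>y\<parallel>\<close> is harmless against the Gaussian factor of the transition density.
\<close>

lemma bessel_B_asymptotics:
  fixes k2 \<delta> :: real
  assumes k2: "0 \<le> k2" and \<delta>: "0 < \<delta>" "\<delta> < 1"
  obtains K where "\<And>k1 (x :: 'n::{finite,linorder} rvec) y f. 0 < k1 \<Longrightarrow> x \<in> chamber_B \<Longrightarrow> y \<in> chamber_B \<Longrightarrow>
    dunkl_eigen (k1, k2) y f \<Longrightarrow>
    0 < bessel_B (k1, k2) x y \<and>
    \<bar>ln (bessel_B (k1, k2) x y) - k1 * (\<Sum>i\<in>UNIV. phi (x $ i * y $ i / k1))\<bar> \<le> 2 * \<delta> * (norm x * norm y) + K"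
proof -
  let ?N = "real CARD('n)" and ?L = "real (card (long_roots_B :: 'n rvec set))"
    and ?W = "real (card (weyl_group_B :: ('n rvec \<Rightarrow> 'n rvec) set))"
  define K1 where "K1 = ?N * ln 2 - (?N / \<delta> + k2 * ?L * (2 / \<delta>) ^ CARD('n) + ?N) * ln \<delta>"
  define K2 where "K2 = ln ?W - ((?N + k2 * ?L) * ln \<delta> - ?N * ln 2)"
  have W: "?W > 0" using card_weyl_group_B_pos[where 'n = 'n] by simp
  show thesis
  proof (rule that[of "max K1 K2"])
    fix k1 :: real and x y :: "'n rvec" and f
    assume k1: "0 < k1" and x: "x \<in> chamber_B" and y: "y \<in> chamber_B" and f: "dunkl_eigen (k1, k2) y f"
    let ?P = "k1 * (\<Sum>i\<in>UNIV. phi (x $ i * y $ i / k1))" and ?R = "norm x * norm y"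
    have k: "0 \<le> fst (k1, k2)" "0 \<le> snd (k1, k2)" using k1 k2 by auto
    have "bessel_B (k1, k2) x y \<le> exp (?P + 2 * \<delta> * ?R + K1)"
      by (rule bessel_B_bounds(2)[OF f k])
        (use dunkl_eigen_upper_bound[OF f k1 k2 x y \<delta>] in \<open>simp add: K1_def\<close>)
    also have "\<dots> \<le> exp (?P + (2 * \<delta> * ?R + max K1 K2))" by simp
    finally have upper: "bessel_B (k1, k2) x y \<le> exp (?P + (2 * \<delta> * ?R + max K1 K2))" .
    have "exp (?P - (2 * \<delta> * ?R + max K1 K2)) \<le> exp (?P - 2 * \<delta> * ?R - K2)" by simp
    also have "\<dots> = exp (?P - 2 * \<delta> * ?R + ((?N + k2 * ?L) * ln \<delta> - ?N * ln 2)) / ?W"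
    proof -
      have "exp (?P - 2 * \<delta> * ?R - K2) =
          exp ((?P - 2 * \<delta> * ?R + ((?N + k2 * ?L) * ln \<delta> - ?N * ln 2)) - ln ?W)"
        by (simp add: K2_def)
      then show ?thesis using W by (simp only: exp_diff exp_ln)
    qed
    also have "\<dots> \<le> f x / ?W"
      using dunkl_eigen_lower_bound[OF f k1 k2 x y \<delta>] W by (intro divide_right_mono) auto
    also have "\<dots> \<le> bessel_B (k1, k2) x y" by (rule bessel_B_bounds(1)[OF f k])
    finally have lower: "exp (?P - (2 * \<delta> * ?R + max K1 K2)) \<le> bessel_B (k1, k2) x y" .
    have pos: "0 < bessel_B (k1, k2) x y" by (rule less_le_trans[OF exp_gt_zero lower])
    have "?P - (2 * \<delta> * ?R + max K1 K2) \<le> ln (bessel_B (k1, k2) x y)"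
      using lower ln_ge_iff[OF pos] by blast
    moreover have "ln (bessel_B (k1, k2) x y) \<le> ?P + (2 * \<delta> * ?R + max K1 K2)"
      using ln_mono[OF upper pos] by simp
    ultimately show "0 < bessel_B (k1, k2) x y \<and>
        \<bar>ln (bessel_B (k1, k2) x y) - ?P\<bar> \<le> 2 * \<delta> * ?R + max K1 K2"
      using pos by (simp add: abs_le_iff)
  qed
qed

section \<open>The law of the process and the existence of the Dunkl kernel\<close>

lemma closed_chamber_B: "closed (chamber_B :: 'n::{finite,linorder} rvec set)"
proof -
  have "(chamber_B :: 'n rvec set) =
      (\<Inter>i. \<Inter>j\<in>{j. i \<le> j}. {x. x $ j \<le> x $ i}) \<inter> (\<Inter>i. {x. 0 \<le> x $ i})"
    by (auto simp: chamber_B_def)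
  moreover have "closed \<dots>"
    by (intro closed_Int closed_INT ballI closed_Collect_le continuous_intros)
  ultimately show ?thesis by simp
qed

lemma chamber_B_scaleR: "0 \<le> c \<Longrightarrow> x \<in> chamber_B \<Longrightarrow> c *\<^sub>R x \<in> chamber_B"
  by (auto simp: chamber_B_def intro: mult_left_mono)

lemma zero_in_chamber_B: "0 \<in> chamber_B"
  by (simp add: chamber_B_def)

text \<open>
  The Markov property at time \<open>0\<close>, integrated over the whole space, with the starting point inserted.
\<close>

lemma bessel_process_law:
  fixes X :: "real \<Rightarrow> 'a \<Rightarrow> 'n::{finite,linorder} rvec"
  assumes X: "bessel_process_B M k w x X" and t: "0 < t" and A: "A \<in> sets borel" "A \<subseteq> chamber_B"
  shows "measure M {\<omega> \<in> space M. X t \<omega> \<in> A} = bessel_transition_B k w t x A"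
proof -
  interpret prob_space M using X by (simp add: bessel_process_B_def)
  have Xm [measurable]: "X u \<in> borel_measurable M" if "0 \<le> u" for u
    using X that by (simp add: bessel_process_B_def measurable_restrict_space2_iff)
  let ?F = "past_sigma M X 0"
  let ?G = "{X u -` A \<inter> space M | u A. 0 \<le> u \<and> u \<le> 0 \<and> A \<in> sets borel}"
  have G: "?G \<subseteq> sets M" using measurable_sets[OF Xm] by auto
  have "sets ?F = sigma_sets (space M) ?G"
    unfolding past_sigma_def by (rule sets_measure_of) (use G sets.space_closed in blast)
  also have "\<dots> \<subseteq> sets M" using G by (rule sets.sigma_sets_subset)
  finally have "subalgebra M ?F"
    unfolding subalgebra_def by (simp add: past_sigma_def space_measure_of_conv)
  then interpret finite_measure_subalgebra M ?F by unfold_locales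
  let ?f = "\<lambda>\<omega>. indicator A (X (0 + t) \<omega>) :: real"
  have m: "?f \<in> borel_measurable M"
    using measurable_compose[OF Xm borel_measurable_indicator[OF A(1)], of t] t by simp
  then have int: "integrable M ?f" by (intro integrable_const_bound[where B = 1]) auto
  have "AE \<omega> in M. real_cond_exp M ?F ?f \<omega> = bessel_transition_B k w t (X 0 \<omega>) A"
    using X t A unfolding bessel_process_B_def by blast
  moreover have "AE \<omega> in M. X 0 \<omega> = x" using X by (simp add: bessel_process_B_def)
  ultimately have "AE \<omega> in M. real_cond_exp M ?F ?f \<omega> = bessel_transition_B k w t x A"
    by eventually_elim simp
  then have "(\<integral>\<omega>. real_cond_exp M ?F ?f \<omega> \<partial>M) = (\<integral>\<omega>. bessel_transition_B k w t x A \<partial>M)"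
    by (intro integral_cong_AE) auto
  then have "bessel_transition_B k w t x A = (\<integral>\<omega>. ?f \<omega> \<partial>M)"
    using real_cond_exp_int(2)[OF int] by (simp add: prob_space)
  also have "\<dots> = (\<integral>\<omega>. indicator {\<omega> \<in> space M. X t \<omega> \<in> A} \<omega> \<partial>M)"
    by (rule Bochner_Integration.integral_cong) (auto simp: indicator_def)
  also have "\<dots> = measure M {\<omega> \<in> space M. X t \<omega> \<in> A}"
    by (simp add: Int_absorb2 Int_def conj_ac) 
  finally show ?thesis by simp
qed

lemma bessel_process_in_chamber:
  assumes "bessel_process_B M k w x X" "0 \<le> t" "\<omega> \<in> space M"
  shows "X t \<omega> \<in> chamber_B"
  using assms by (auto simp: bessel_process_B_def measurable_restrict_space2_iff)

lemma bessel_transition_chamber: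
  fixes X :: "real \<Rightarrow> 'a \<Rightarrow> 'n::{finite,linorder} rvec"
  assumes X: "bessel_process_B M k w x X" and t: "0 < t"
  shows "bessel_transition_B k w t x chamber_B = 1"
proof -
  interpret prob_space M using X by (simp add: bessel_process_B_def)
  have "{\<omega> \<in> space M. X t \<omega> \<in> chamber_B} = space M"
    using bessel_process_in_chamber[OF X] t by auto
  then show ?thesis
    using bessel_process_law[OF X t borel_closed[OF closed_chamber_B] subset_refl]
    by (simp add: prob_space)
qed

text \<open>
  If there were no solution for \<open>y\<close>, then the integrands of the kernels with drift \<open>y\<close> and \<open>2 y\<close> would be equal by
  \<open>bessel_B_no_eigen\<close>, and total mass one for both would force
  \<open>exp (- \<parallel>y\<parallel>\<^sup>2 / 2) = exp (- \<parallel>2 y\<parallel>\<^sup>2 / 2)\<close>. For \<open>y = 0\<close> constants solve the equations.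
\<close>

lemma dunkl_eigen_exists:
  fixes y :: "'n::{finite,linorder} rvec"
  assumes mass: "\<And>w :: 'n rvec. w \<in> chamber_B \<Longrightarrow> bessel_transition_B k w 1 0 chamber_B = 1"
    and y: "y \<in> chamber_B"
  shows "\<exists>f. dunkl_eigen k y f"
proof (cases "y = 0")
  case True
  then show ?thesis using dunkl_eigen_0 by blast
next
  case False
  show ?thesis
  proof (rule ccontr)
    assume no: "\<nexists>f. dunkl_eigen k y f"
    define c where "c = 2 ^ CARD('n) * fact CARD('n) * norm_const_B TYPE('n) k"
    define I where "I = (LINT v:chamber_B|lborel.
      exp (- ((norm (0 :: 'n rvec))\<^sup>2 + (norm v)\<^sup>2) / (2 * 1)) *
      (bessel_B k (0 /\<^sub>R sqrt 1) (v /\<^sub>R sqrt 1) * bessel_B k v y / bessel_B k 0 y) * weight_B k v)"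
    have "1 = c * exp (- (norm y)\<^sup>2 * 1 / 2) / 1 powr (gamma_B TYPE('n) k + real CARD('n) / 2) * I"
      unfolding c_def I_def
      by (rule mass[OF y, unfolded bessel_transition_B_def, symmetric])
    then have 1: "1 = c * I * exp (- (norm y)\<^sup>2 / 2)" by (simp add: mult_ac)
    have y2: "2 *\<^sub>R y \<in> chamber_B" using y chamber_B_scaleR[of 2] by simp
    have "bessel_B k v (2 *\<^sub>R y) = bessel_B k v y" for v by (rule bessel_B_no_eigen[OF no]) simp
    then have "1 = c * exp (- (norm (2 *\<^sub>R y))\<^sup>2 * 1 / 2) /
        1 powr (gamma_B TYPE('n) k + real CARD('n) / 2) * I"
      using mass[OF y2, unfolded bessel_transition_B_def, symmetric] unfolding c_def I_def
      by (simp only:)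
    then have 2: "1 = c * I * exp (- (norm (2 *\<^sub>R y))\<^sup>2 / 2)" by (simp add: mult_ac)
    have "c * I * exp (- (norm y)\<^sup>2 / 2) = c * I * exp (- (norm (2 *\<^sub>R y))\<^sup>2 / 2)"
      using 1 2 by (rule trans[OF sym])
    moreover have "c * I \<noteq> 0" using 1 by auto
    ultimately have "(norm y)\<^sup>2 = (norm (2 *\<^sub>R y))\<^sup>2" by simp
    then show False using False by (simp add: power_mult_distrib)
  qed
qed

section \<open>The rate function of the transition density\<close>

text \<open>
  The contribution of one coordinate to the transition density, to the power \<open>1 / k1\<close>, at leading order.
\<close>

definition rate :: "real \<Rightarrow> real \<Rightarrow> real \<Rightarrow> real \<Rightarrow> real" where
  "rate x w t u = u\<^sup>2 * exp (- u\<^sup>2 / (2 * t) + phi (x * u / t) + phi (w * u))"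

lemma rate_nonneg: "0 \<le> rate x w t u"
  by (simp add: rate_def)

definition frozen :: "real \<Rightarrow> real \<Rightarrow> real \<Rightarrow> real" where
  "frozen x w t = sqrt (x\<^sup>2 + w\<^sup>2 * t\<^sup>2 + 2 * t * sqrt (x\<^sup>2 * w\<^sup>2 + 1))"

lemma frozen_pos: "0 < t \<Longrightarrow> 0 < frozen x w t"
  by (simp add: frozen_def add_nonneg_pos)

text \<open>
  With \<open>a = u / Y\<close>, the tangent bounds of \<open>\<phi>\<close> at the critical point \<open>Y\<close> give
  \<open>rate u / rate Y \<le> a\<^sup>2 exp (1 - a\<^sup>2)\<close>, and \<open>ln a \<le> a - 1\<close> turns this into \<open>exp (- (a - 1)\<^sup>2)\<close>. At \<open>Y\<close> both
  square roots that occur in \<open>\<phi>'\<close> become rational in \<open>sqrt (x\<^sup>2 w\<^sup>2 + 1)\<close>; this is where the formula for the limit comes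
  from.
\<close>

lemma rate_le_gaussian:
  fixes x w t u :: real
  assumes t: "0 < t" and u: "0 \<le> u"
  defines "Y \<equiv> frozen x w t"
  shows "rate x w t u \<le> rate x w t Y * exp (- (u / Y - 1)\<^sup>2)"
proof (cases "u = 0")
  case True
  then show ?thesis by (simp add: rate_def)
next
  case False
  define s where "s = sqrt (x\<^sup>2 * w\<^sup>2 + 1)"
  have s: "0 \<le> s" "s\<^sup>2 = x\<^sup>2 * w\<^sup>2 + 1" by (auto simp: s_def)
  have Y: "0 < Y" using frozen_pos[OF t] by (simp add: Y_def)
  have Y2: "Y\<^sup>2 = x\<^sup>2 + w\<^sup>2 * t\<^sup>2 + 2 * t * s"
    using t s by (simp add: Y_def frozen_def s_def)
  define V1 where "V1 = sqrt (1 + (x / t * Y)\<^sup>2)"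
  define V2 where "V2 = sqrt (1 + (w * Y)\<^sup>2)"
  have "1 + (x / t * Y)\<^sup>2 = ((x\<^sup>2 + t * s) / t)\<^sup>2"
  proof -
    have "t\<^sup>2 + x\<^sup>2 * Y\<^sup>2 = (x\<^sup>2 + t * s)\<^sup>2 + t\<^sup>2 * (x\<^sup>2 * w\<^sup>2 + 1 - s\<^sup>2)"
      unfolding Y2 by (simp add: power2_eq_square algebra_simps)
    then have "t\<^sup>2 + x\<^sup>2 * Y\<^sup>2 = (x\<^sup>2 + t * s)\<^sup>2" using s by simp
    then show ?thesis using t by (simp add: power_mult_distrib power_divide field_simps)
  qed
  then have V1: "V1 = (x\<^sup>2 + t * s) / t" using t s by (simp add: V1_def)
  have "1 + (w * Y)\<^sup>2 = (t * w\<^sup>2 + s)\<^sup>2 + (x\<^sup>2 * w\<^sup>2 + 1 - s\<^sup>2)"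
    unfolding power_mult_distrib Y2 by (simp add: power2_eq_square algebra_simps)
  then have "1 + (w * Y)\<^sup>2 = (t * w\<^sup>2 + s)\<^sup>2" using s by simp
  then have V2: "V2 = t * w\<^sup>2 + s" using t s by (simp add: V2_def)
  have Vpos: "1 \<le> V1" "1 \<le> V2" by (auto simp: V1_def V2_def)
  have Vsq: "V1\<^sup>2 = 1 + (x / t)\<^sup>2 * Y\<^sup>2" "V2\<^sup>2 = 1 + w\<^sup>2 * Y\<^sup>2"
    by (auto simp: V1_def V2_def power_mult_distrib power_divide)
  have quot: "A / (2 * (1 + V)) = (V - 1) / (2 * Y\<^sup>2)"
    if "V\<^sup>2 = 1 + A * Y\<^sup>2" "1 \<le> V" for A V
  proof -
    have "A * (2 * Y\<^sup>2) = (V - 1) * (2 * (1 + V))"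
      using that(1) by (simp add: power2_eq_square algebra_simps)
    then show ?thesis using Y that(2) by (subst frac_eq_eq) auto
  qed
  note q1 = quot[OF Vsq(1) Vpos(1)] and q2 = quot[OF Vsq(2) Vpos(2)]
  have crit: "V1 + V2 = Y\<^sup>2 / t"
    unfolding V1 V2 Y2 using t by (simp add: field_simps power2_eq_square)
  have "phi (x * u / t) - phi (x * Y / t) + (phi (w * u) - phi (w * Y))
      \<le> (x / t)\<^sup>2 * (u\<^sup>2 - Y\<^sup>2) / (2 * (1 + V1)) + w\<^sup>2 * (u\<^sup>2 - Y\<^sup>2) / (2 * (1 + V2))"
    using phi_tangent[of "x / t" u Y] phi_tangent[of w u Y] by (simp add: V1_def V2_def)
  also have "\<dots> = (u\<^sup>2 - Y\<^sup>2) * ((x / t)\<^sup>2 / (2 * (1 + V1)) + w\<^sup>2 / (2 * (1 + V2)))"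
    by (simp add: algebra_simps)
  also have "\<dots> = (u\<^sup>2 - Y\<^sup>2) * (1 / (2 * t) - 1 / Y\<^sup>2)"
  proof -
    have "(V1 - 1) / (2 * Y\<^sup>2) + (V2 - 1) / (2 * Y\<^sup>2) = (V1 + V2 - 2) / (2 * Y\<^sup>2)"
      by (simp add: add_divide_distrib[symmetric])
    also have "\<dots> = 1 / (2 * t) - 1 / Y\<^sup>2"
      unfolding crit using Y t by (simp add: field_simps)
    finally show ?thesis unfolding q1 q2 by simp
  qed
  also have "\<dots> = u\<^sup>2 / (2 * t) - Y\<^sup>2 / (2 * t) + (1 - (u / Y)\<^sup>2)"
    using Y t by (simp add: power_divide field_simps)
  finally have E: "- u\<^sup>2 / (2 * t) + phi (x * u / t) + phi (w * u)
      \<le> - Y\<^sup>2 / (2 * t) + phi (x * Y / t) + phi (w * Y) + (1 - (u / Y)\<^sup>2)"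
    by simp
  define a where "a = u / Y"
  have a: "0 < a" using u False Y by (simp add: a_def)
  have "ln a \<le> a - 1" using a by (rule ln_le_minus_one)
  then have "a \<le> exp (a - 1)" using a by (metis exp_le_cancel_iff exp_ln)
  then have "a\<^sup>2 \<le> (exp (a - 1))\<^sup>2" using a by (intro power_mono) auto
  then have a2: "a\<^sup>2 \<le> exp (2 * (a - 1))" by (simp only: exp_double)
  have "rate x w t u = (Y\<^sup>2 * a\<^sup>2) * exp (- u\<^sup>2 / (2 * t) + phi (x * u / t) + phi (w * u))"
    using Y by (simp add: rate_def a_def power_divide)
  also have "\<dots> \<le> (Y\<^sup>2 * exp (2 * (a - 1))) *
      exp (- Y\<^sup>2 / (2 * t) + phi (x * Y / t) + phi (w * Y) + (1 - a\<^sup>2))"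
    using E a2 by (intro mult_mono) (auto simp: a_def)
  also have "\<dots> = rate x w t Y * exp (2 * (a - 1) + (1 - a\<^sup>2))"
    unfolding rate_def exp_add by (simp only: mult_ac)
  also have "2 * (a - 1) + (1 - a\<^sup>2) = - (a - 1)\<^sup>2" by (simp add: power2_eq_square algebra_simps)
  finally show ?thesis by (simp add: a_def)
qed

text \<open>
  To the right of the maximum only the factor \<open>exp (- u\<^sup>2 / 2t)\<close> decreases.
\<close>

lemma rate_lower:
  assumes t: "0 < t" and x: "0 \<le> x" "0 \<le> w" and u: "0 \<le> Y" "Y \<le> u"
  shows "rate x w t Y * exp (- (u\<^sup>2 - Y\<^sup>2) / (2 * t)) \<le> rate x w t u"
proof -
  have "phi (x * Y / t) \<le> phi (x * u / t)" "phi (w * Y) \<le> phi (w * u)"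
    using t x u by (auto intro!: phi_mono divide_right_mono mult_left_mono)
  then have "- Y\<^sup>2 / (2 * t) + phi (x * Y / t) + phi (w * Y) + (- (u\<^sup>2 - Y\<^sup>2) / (2 * t))
      \<le> - u\<^sup>2 / (2 * t) + phi (x * u / t) + phi (w * u)"
    by (simp add: diff_divide_distrib)
  moreover have "Y\<^sup>2 \<le> u\<^sup>2" using u by (intro power_mono) auto
  ultimately have "Y\<^sup>2 * exp (- Y\<^sup>2 / (2 * t) + phi (x * Y / t) + phi (w * Y) + (- (u\<^sup>2 - Y\<^sup>2) / (2 * t)))
      \<le> u\<^sup>2 * exp (- u\<^sup>2 / (2 * t) + phi (x * u / t) + phi (w * u))"
    by (intro mult_mono) auto
  then show ?thesis by (simp add: rate_def exp_add)
qed

definition pair_weight :: "real \<Rightarrow> 'n::{finite,linorder} rvec \<Rightarrow> real" where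
  "pair_weight k2 y = (\<Prod>(i, j)\<in>{(i, j). i < j}. \<bar>(y $ i)\<^sup>2 - (y $ j)\<^sup>2\<bar> powr (2 * k2))"

definition rate_prod :: "real \<Rightarrow> 'n::finite rvec \<Rightarrow> 'n rvec \<Rightarrow> real \<Rightarrow> 'n rvec \<Rightarrow> real" where
  "rate_prod k x w t y = (\<Prod>i\<in>UNIV. rate (x $ i) (w $ i) t (y $ i) powr k)"

text \<open>
  The part of the transition density that depends on \<open>y\<close>, for time \<open>t / k1\<close> and drift \<open>k1 w\<close>.
\<close>

definition drift_density ::
    "real \<Rightarrow> real \<Rightarrow> 'n::{finite,linorder} rvec \<Rightarrow> 'n rvec \<Rightarrow> real \<Rightarrow> 'n rvec \<Rightarrow> real" where
  "drift_density k1 k2 x w t y = exp (- (norm y)\<^sup>2 / (2 * (t / k1))) *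
    (bessel_B (k1, k2) (x /\<^sub>R sqrt (t / k1)) (y /\<^sub>R sqrt (t / k1)) * bessel_B (k1, k2) y (k1 *\<^sub>R w)) *
    weight_B (k1, k2) y"

lemma freezing_limit_nth: "freezing_limit x w t $ i = frozen (x $ i) (w $ i) t"
  by (simp add: freezing_limit_def frozen_def)

lemma frozen_mono:
  assumes "0 \<le> x" "x \<le> x'" "0 \<le> w" "w \<le> w'" "0 \<le> t"
  shows "frozen x w t \<le> frozen x' w' t"
proof -
  have "x\<^sup>2 \<le> x'\<^sup>2" "w\<^sup>2 \<le> w'\<^sup>2" using assms by (auto intro: power_mono)
  then show ?thesis
    unfolding frozen_def using assms
    by (intro real_sqrt_le_mono add_mono mult_mono mult_left_mono) auto
qed

lemma freezing_limit_in_chamber_B: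
  fixes x w :: "'n::{finite,linorder} rvec"
  assumes "x \<in> chamber_B" "w \<in> chamber_B" "0 < t"
  shows "freezing_limit x w t \<in> chamber_B"
proof -
  have "freezing_limit x w t $ j \<le> freezing_limit x w t $ i" if "i \<le> j" for i j
    unfolding freezing_limit_nth using assms that
    by (intro frozen_mono) (auto simp: chamber_B_nonneg chamber_B_antimono)
  then show ?thesis
    using frozen_pos[OF assms(3)] by (simp add: chamber_B_def freezing_limit_nth less_imp_le)
qed

lemma frozen_le:
  assumes "\<bar>x\<bar> \<le> b" "\<bar>w\<bar> \<le> b" "0 < t" "t \<le> b"
  shows "frozen x w t \<le> sqrt (b\<^sup>2 + b\<^sup>2 * b\<^sup>2 + 2 * b * (b\<^sup>2 + 1))"
proof -
  have sq: "x\<^sup>2 \<le> b\<^sup>2" "w\<^sup>2 \<le> b\<^sup>2" "t\<^sup>2 \<le> b\<^sup>2"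
    using power_mono[OF assms(1), of 2] power_mono[OF assms(2), of 2] power_mono[OF assms(4), of 2] assms(3)
    by auto
  have "x\<^sup>2 * w\<^sup>2 + 1 \<le> b\<^sup>2 * b\<^sup>2 + 1" using sq by (intro add_mono mult_mono) auto
  also have "\<dots> \<le> (b\<^sup>2 + 1)\<^sup>2" by (simp add: power2_eq_square algebra_simps)
  finally have "sqrt (x\<^sup>2 * w\<^sup>2 + 1) \<le> b\<^sup>2 + 1" by (intro real_le_lsqrt) auto
  then show ?thesis unfolding frozen_def
    using sq assms by (intro real_sqrt_le_mono add_mono mult_mono) auto
qed

lemma weight_B_eq:
  "weight_B (k1, k2) y = pair_weight k2 y * (\<Prod>i\<in>UNIV. \<bar>y $ i\<bar> powr (2 * k1))"
  by (simp add: weight_B_def pair_weight_def)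

lemma pair_weight_nonneg: "0 \<le> pair_weight k2 y"
  unfolding pair_weight_def by (intro prod_nonneg) auto

lemma card_ordered_pairs_le: "card {(i :: 'n::{finite,linorder}, j). i < j} \<le> CARD('n)\<^sup>2"
proof -
  have "card {(i :: 'n, j). i < j} \<le> card (UNIV :: ('n \<times> 'n) set)" by (rule card_mono) auto
  then show ?thesis by (simp add: card_cartesian_product power2_eq_square flip: UNIV_Times_UNIV)
qed

lemma pair_weight_le:
  fixes y :: "'n::{finite,linorder} rvec"
  assumes k2: "0 \<le> k2"
  shows "pair_weight k2 y \<le> exp (2 * k2 * real (CARD('n)\<^sup>2) * (norm y)\<^sup>2)"
proof -
  let ?S = "{(i :: 'n, j). i < j}" and ?e = "exp (2 * k2 * (norm y)\<^sup>2)"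
  have comp: "(y $ i)\<^sup>2 \<le> (norm y)\<^sup>2" for i
    using power_mono[OF component_le_norm_cart[of y i], of 2] by simp
  have "\<bar>(y $ i)\<^sup>2 - (y $ j)\<^sup>2\<bar> powr (2 * k2) \<le> ?e" for i j
  proof -
    have "\<bar>(y $ i)\<^sup>2 - (y $ j)\<^sup>2\<bar> \<le> (norm y)\<^sup>2"
      using comp[of i] comp[of j] zero_le_power2[of "y $ i"] zero_le_power2[of "y $ j"] by linarith
    also have "\<dots> \<le> exp ((norm y)\<^sup>2)" using exp_ge_add_one_self[of "(norm y)\<^sup>2"] by linarith
    finally have "\<bar>(y $ i)\<^sup>2 - (y $ j)\<^sup>2\<bar> powr (2 * k2) \<le> exp ((norm y)\<^sup>2) powr (2 * k2)"
      using k2 by (intro powr_mono2) auto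
    then show ?thesis by (simp add: powr_def)
  qed
  then have "pair_weight k2 y \<le> (\<Prod>p\<in>?S. ?e)"
    unfolding pair_weight_def by (intro prod_mono) auto
  also have "\<dots> = ?e ^ card ?S" by simp
  also have "\<dots> \<le> ?e ^ (CARD('n)\<^sup>2)"
    using k2 by (intro power_increasing card_ordered_pairs_le) simp
  also have "\<dots> = exp (2 * k2 * real (CARD('n)\<^sup>2) * (norm y)\<^sup>2)"
    by (simp add: exp_of_nat_mult[symmetric] mult_ac)
  finally show ?thesis .
qed

lemma pair_weight_ge:
  fixes y :: "'n::{finite,linorder} rvec"
  assumes k2: "0 \<le> k2" and \<rho>: "0 < \<rho>" and y: "\<And>i. 0 \<le> y $ i" "\<And>i j. i < j \<Longrightarrow> y $ j + \<rho> \<le> y $ i"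
  shows "((\<rho>\<^sup>2) powr (2 * k2)) ^ card {(i :: 'n, j). i < j} \<le> pair_weight k2 y"
proof -
  have "(\<rho>\<^sup>2) powr (2 * k2) \<le> \<bar>(y $ i)\<^sup>2 - (y $ j)\<^sup>2\<bar> powr (2 * k2)" if "i < j" for i j
  proof (rule powr_mono2)
    have "\<rho> * \<rho> \<le> (y $ i - y $ j) * (y $ i + y $ j)"
      using y(2)[OF that] y(1)[of j] \<rho> by (intro mult_mono) auto
    then show "\<rho>\<^sup>2 \<le> \<bar>(y $ i)\<^sup>2 - (y $ j)\<^sup>2\<bar>"
      by (simp add: power2_eq_square algebra_simps)
  qed (use k2 in auto)
  then have "(\<Prod>p\<in>{(i :: 'n, j). i < j}. (\<rho>\<^sup>2) powr (2 * k2)) \<le> pair_weight k2 y"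
    unfolding pair_weight_def by (intro prod_mono) auto
  then show ?thesis by simp
qed

lemma rate_prod_nonneg: "0 \<le> rate_prod k x w t y"
  unfolding rate_prod_def by (intro prod_nonneg) auto

lemma rate_prod_pos:
  assumes "0 < t" shows "0 < rate_prod k x w t (freezing_limit x w t)"
proof -
  have "rate (x $ i) (w $ i) t (frozen (x $ i) (w $ i) t) \<noteq> 0" for i
    using frozen_pos[OF assms, of "x $ i" "w $ i"] by (simp add: rate_def)
  then show ?thesis unfolding rate_prod_def freezing_limit_nth
    using rate_nonneg by (intro prod_pos) (simp add: order_less_le)
qed

lemma rate_prod_eq:
  fixes x w y :: "'n::finite rvec"
  assumes k: "0 < k" and t: "0 < t"
  shows "rate_prod k x w t y = exp (- (norm y)\<^sup>2 / (2 * (t / k))) *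
    exp (k * (\<Sum>i\<in>UNIV. phi (x $ i * y $ i / t))) * exp (k * (\<Sum>i\<in>UNIV. phi (w $ i * y $ i))) *
    (\<Prod>i\<in>UNIV. \<bar>y $ i\<bar> powr (2 * k))"
proof -
  let ?E = "\<lambda>i. - (y $ i)\<^sup>2 / (2 * t) + phi (x $ i * y $ i / t) + phi (w $ i * y $ i)"
  have "rate (x $ i) (w $ i) t (y $ i) powr k = exp (k * ?E i) * \<bar>y $ i\<bar> powr (2 * k)" for i
  proof -
    have "((y $ i)\<^sup>2) powr k = \<bar>y $ i\<bar> powr (2 * k)"
    proof (cases "y $ i = 0")
      case False
      then have "(y $ i)\<^sup>2 = \<bar>y $ i\<bar> powr 2" by (simp add: powr_numeral)
      then show ?thesis by (simp only: powr_powr)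
    qed simp
    moreover have "exp (?E i) powr k = exp (k * ?E i)" by (simp add: powr_def)
    ultimately show ?thesis unfolding rate_def by (subst powr_mult) (simp_all add: mult.commute)
  qed
  then have "rate_prod k x w t y = exp (\<Sum>i\<in>UNIV. k * ?E i) * (\<Prod>i\<in>UNIV. \<bar>y $ i\<bar> powr (2 * k))"
    by (simp add: rate_prod_def prod.distrib exp_sum)
  also have "(\<Sum>i\<in>UNIV. k * ?E i) = - (norm y)\<^sup>2 / (2 * (t / k)) +
      k * (\<Sum>i\<in>UNIV. phi (x $ i * y $ i / t)) + k * (\<Sum>i\<in>UNIV. phi (w $ i * y $ i))"
  proof -
    have "(norm y)\<^sup>2 = (\<Sum>i\<in>UNIV. (y $ i)\<^sup>2)"
      unfolding power2_norm_eq_inner by (simp add: inner_vec_def power2_eq_square)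
    then have "- (norm y)\<^sup>2 / (2 * (t / k)) = k * (\<Sum>i\<in>UNIV. - (y $ i)\<^sup>2 / (2 * t))"
      using k t by (simp add: sum_negf sum_divide_distrib[symmetric] field_simps)
    then show ?thesis by (simp only: sum.distrib distrib_left sum_distrib_left)
  qed
  finally show ?thesis by (simp only: exp_add)
qed

lemma rate_prod_le:
  fixes x w y :: "'n::{finite,linorder} rvec"
  assumes k: "0 < k" and t: "0 < t" and y: "y \<in> chamber_B"
    and B: "\<And>i. freezing_limit x w t $ i \<le> B"
  shows "rate_prod k x w t y \<le> rate_prod k x w t (freezing_limit x w t) *
    exp (- k * (norm (y - freezing_limit x w t))\<^sup>2 / B\<^sup>2)"
proof -
  let ?Y = "freezing_limit x w t"
  let ?r = "\<lambda>i u. rate (x $ i) (w $ i) t u"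
  have Y: "0 < ?Y $ i" for i using frozen_pos[OF t] by (simp add: freezing_limit_nth)
  have "?r i (y $ i) powr k \<le> ?r i (?Y $ i) powr k * exp (- k * (y $ i - ?Y $ i)\<^sup>2 / B\<^sup>2)" for i
  proof -
    have "(y $ i - ?Y $ i)\<^sup>2 / B\<^sup>2 \<le> (y $ i - ?Y $ i)\<^sup>2 / (?Y $ i)\<^sup>2"
      using Y[of i] B[of i] by (intro divide_left_mono power_mono mult_pos_pos zero_less_power) auto
    also have "\<dots> = (y $ i / ?Y $ i - 1)\<^sup>2"
      using Y[of i] by (simp add: power_divide[symmetric] diff_divide_distrib)
    finally have "?r i (y $ i) \<le> ?r i (?Y $ i) * exp (- ((y $ i - ?Y $ i)\<^sup>2 / B\<^sup>2))"
      using rate_le_gaussian[OF t chamber_B_nonneg[OF y, of i], of "x $ i" "w $ i"]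
      unfolding freezing_limit_nth
      by (meson exp_le_cancel_iff mult_left_mono neg_le_iff_le order_trans rate_nonneg)
    then have "?r i (y $ i) powr k \<le> (?r i (?Y $ i) * exp (- ((y $ i - ?Y $ i)\<^sup>2 / B\<^sup>2))) powr k"
      using k rate_nonneg by (intro powr_mono2) auto
    also have "\<dots> = ?r i (?Y $ i) powr k * exp (- k * (y $ i - ?Y $ i)\<^sup>2 / B\<^sup>2)"
      using rate_nonneg by (subst powr_mult) (auto simp: powr_def)
    finally show ?thesis .
  qed
  then have "rate_prod k x w t y \<le> (\<Prod>i\<in>UNIV. ?r i (?Y $ i) powr k * exp (- k * (y $ i - ?Y $ i)\<^sup>2 / B\<^sup>2))"
    unfolding rate_prod_def by (intro prod_mono) auto
  also have "\<dots> = rate_prod k x w t ?Y * exp (\<Sum>i\<in>UNIV. - k * (y $ i - ?Y $ i)\<^sup>2 / B\<^sup>2)"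
    by (simp add: rate_prod_def prod.distrib exp_sum)
  also have "(\<Sum>i\<in>UNIV. - k * (y $ i - ?Y $ i)\<^sup>2 / B\<^sup>2) = - k * (norm (y - ?Y))\<^sup>2 / B\<^sup>2"
    unfolding power2_norm_eq_inner
    by (simp add: inner_vec_def power2_eq_square sum_distrib_left sum_divide_distrib sum_negf)
  finally show ?thesis .
qed

lemma rate_prod_ge:
  fixes x w y :: "'n::{finite,linorder} rvec"
  assumes k: "0 < k" and t: "0 < t" and x: "x \<in> chamber_B" "w \<in> chamber_B"
    and y: "\<And>i. freezing_limit x w t $ i \<le> y $ i"
      "\<And>i. (y $ i)\<^sup>2 - (freezing_limit x w t $ i)\<^sup>2 \<le> D"
  shows "rate_prod k x w t (freezing_limit x w t) * exp (- k * (real CARD('n) * (D / (2 * t))))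
    \<le> rate_prod k x w t y"
proof -
  let ?Y = "freezing_limit x w t"
  let ?r = "\<lambda>i u. rate (x $ i) (w $ i) t u"
  have Y: "0 \<le> ?Y $ i" for i using frozen_pos[OF t] by (simp add: freezing_limit_nth less_imp_le)
  have "?r i (?Y $ i) powr k * exp (- k * (D / (2 * t))) \<le> ?r i (y $ i) powr k" for i
  proof -
    have "?r i (?Y $ i) * exp (- (D / (2 * t))) \<le> ?r i (?Y $ i) * exp (- ((y $ i)\<^sup>2 - (?Y $ i)\<^sup>2) / (2 * t))"
    proof (rule mult_left_mono[OF _ rate_nonneg])
      have "((y $ i)\<^sup>2 - (?Y $ i)\<^sup>2) / (2 * t) \<le> D / (2 * t)"
        using y(2)[of i] t by (intro divide_right_mono) auto
      then show "exp (- (D / (2 * t))) \<le> exp (- ((y $ i)\<^sup>2 - (?Y $ i)\<^sup>2) / (2 * t))"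
        by (simp only: minus_divide_left[symmetric] exp_le_cancel_iff neg_le_iff_le)
    qed
    also have "\<dots> \<le> ?r i (y $ i)"
      by (rule rate_lower) (use t x Y y chamber_B_nonneg in auto)
    finally have "(?r i (?Y $ i) * exp (- (D / (2 * t)))) powr k \<le> ?r i (y $ i) powr k"
      using k rate_nonneg by (intro powr_mono2) auto
    moreover have "(?r i (?Y $ i) * exp (- (D / (2 * t)))) powr k =
        ?r i (?Y $ i) powr k * exp (- k * (D / (2 * t)))"
      using rate_nonneg by (subst powr_mult) (auto simp: powr_def)
    ultimately show ?thesis by simp
  qed
  then have "(\<Prod>i\<in>UNIV. ?r i (?Y $ i) powr k * exp (- k * (D / (2 * t)))) \<le> rate_prod k x w t y"
    unfolding rate_prod_def by (intro prod_mono) auto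
  moreover have "exp (- k * (D / (2 * t))) ^ CARD('n) = exp (- k * (real CARD('n) * (D / (2 * t))))"
    by (simp add: exp_of_nat_mult[symmetric] mult_ac)
  ultimately show ?thesis by (simp add: rate_prod_def prod.distrib)
qed

text \<open>
  In both Bessel functions the scaling of time and drift makes the arguments of \<open>\<phi>\<close> independent
  of \<open>k1\<close>.
\<close>

lemma drift_density_bounds:
  fixes x w y :: "'n::{finite,linorder} rvec"
  assumes asym: "\<And>k1 (x :: 'n rvec) y f. 0 < k1 \<Longrightarrow> x \<in> chamber_B \<Longrightarrow> y \<in> chamber_B \<Longrightarrow>
      dunkl_eigen (k1, k2) y f \<Longrightarrow>
      0 < bessel_B (k1, k2) x y \<and>
      \<bar>ln (bessel_B (k1, k2) x y) - k1 * (\<Sum>i\<in>UNIV. phi (x $ i * y $ i / k1))\<bar> \<le> 2 * \<delta> * (norm x * norm y) + K"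
    and ex: "\<And>y :: 'n rvec. y \<in> chamber_B \<Longrightarrow> \<exists>f. dunkl_eigen (k1, k2) y f"
    and k1: "0 < k1" and t: "0 < t" and x: "x \<in> chamber_B" and w: "w \<in> chamber_B" and y: "y \<in> chamber_B"
  defines "r \<equiv> 2 * \<delta> * k1 * (norm y * (norm x / t + norm w)) + 2 * K"
  shows "rate_prod k1 x w t y * pair_weight k2 y * exp (- r) \<le> drift_density k1 k2 x w t y"
    and "drift_density k1 k2 x w t y \<le> rate_prod k1 x w t y * pair_weight k2 y * exp r"
proof -
  let ?\<tau> = "t / k1"
  let ?J1 = "bessel_B (k1, k2) (x /\<^sub>R sqrt ?\<tau>) (y /\<^sub>R sqrt ?\<tau>)" and ?J2 = "bessel_B (k1, k2) y (k1 *\<^sub>R w)"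
  let ?P1 = "k1 * (\<Sum>i\<in>UNIV. phi (x $ i * y $ i / t))" and ?P2 = "k1 * (\<Sum>i\<in>UNIV. phi (w $ i * y $ i))"
  define r1 where "r1 = 2 * \<delta> * (norm (x /\<^sub>R sqrt ?\<tau>) * norm (y /\<^sub>R sqrt ?\<tau>)) + K"
  define r2 where "r2 = 2 * \<delta> * (norm y * norm (k1 *\<^sub>R w)) + K"
  have \<tau>: "0 < ?\<tau>" using k1 t by simp
  have mem: "x /\<^sub>R sqrt ?\<tau> \<in> chamber_B" "y /\<^sub>R sqrt ?\<tau> \<in> chamber_B" "k1 *\<^sub>R w \<in> chamber_B"
    using x y w \<tau> k1 by (auto intro!: chamber_B_scaleR)
  have sq: "inverse (sqrt ?\<tau>) * inverse (sqrt ?\<tau>) = k1 / t"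
    using \<tau> k1 t by (simp flip: inverse_mult_distrib)
  have arg: "(x /\<^sub>R sqrt ?\<tau>) $ i * (y /\<^sub>R sqrt ?\<tau>) $ i / k1 = x $ i * y $ i / t" for i
  proof -
    have "(x /\<^sub>R sqrt ?\<tau>) $ i * (y /\<^sub>R sqrt ?\<tau>) $ i = (inverse (sqrt ?\<tau>) * inverse (sqrt ?\<tau>)) * (x $ i * y $ i)"
      by (simp only: vector_scaleR_component real_scaleR_def mult_ac)
    then show ?thesis unfolding sq using k1 by simp
  qed
  obtain f1 where f1: "dunkl_eigen (k1, k2) (y /\<^sub>R sqrt ?\<tau>) f1" using ex mem by blast
  obtain f2 where f2: "dunkl_eigen (k1, k2) (k1 *\<^sub>R w) f2" using ex mem by blast
  have bounds: "exp (P - r) \<le> J \<and> J \<le> exp (P + r)" if "0 < J \<and> \<bar>ln J - P\<bar> \<le> r" for J P r :: real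
    using that exp_ln[of J] exp_le_cancel_iff[of "P - r" "ln J"] exp_le_cancel_iff[of "ln J" "P + r"]
    by (simp add: abs_le_iff)
  have J1: "exp (?P1 - r1) \<le> ?J1" "?J1 \<le> exp (?P1 + r1)"
    using bounds[OF asym[OF k1 mem(1,2) f1]] unfolding arg r1_def by auto
  have J2: "exp (?P2 - r2) \<le> ?J2" "?J2 \<le> exp (?P2 + r2)"
    using bounds[OF asym[OF k1 y mem(3) f2]] k1 unfolding r2_def by (auto simp: mult.commute)
  have rr: "r = r1 + r2"
  proof -
    have "norm (x /\<^sub>R sqrt ?\<tau>) * norm (y /\<^sub>R sqrt ?\<tau>) =
        (inverse (sqrt ?\<tau>) * inverse (sqrt ?\<tau>)) * (norm x * norm y)"
      using \<tau> by (simp only: norm_scaleR abs_inverse abs_of_pos real_sqrt_gt_zero mult_ac)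
    also have "\<dots> = k1 / t * (norm x * norm y)" unfolding sq ..
    finally show ?thesis unfolding r_def r1_def r2_def using k1 by (simp add: algebra_simps)
  qed
  let ?g = "exp (- (norm y)\<^sup>2 / (2 * ?\<tau>))" and ?p = "pair_weight k2 y * (\<Prod>i\<in>UNIV. \<bar>y $ i\<bar> powr (2 * k1))"
  have p: "0 \<le> ?p" by (intro mult_nonneg_nonneg pair_weight_nonneg prod_nonneg) auto
  have J0: "0 \<le> ?J1" "0 \<le> ?J2" using J1(1) J2(1) exp_ge_zero order_trans by blast+
  have lower: "?g * (exp (?P1 - r1) * exp (?P2 - r2)) * ?p \<le> ?g * (?J1 * ?J2) * ?p"
    using J1 J2 J0 p by (intro mult_right_mono mult_left_mono mult_mono) auto
  have upper: "?g * (?J1 * ?J2) * ?p \<le> ?g * (exp (?P1 + r1) * exp (?P2 + r2)) * ?p"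
    using J1 J2 J0 p by (intro mult_right_mono mult_left_mono mult_mono) auto
  show "rate_prod k1 x w t y * pair_weight k2 y * exp (- r) \<le> drift_density k1 k2 x w t y"
    using lower unfolding drift_density_def weight_B_eq rate_prod_eq[OF k1 t] rr
    by (simp add: exp_add exp_diff exp_minus field_simps)
  show "drift_density k1 k2 x w t y \<le> rate_prod k1 x w t y * pair_weight k2 y * exp r"
    using upper unfolding drift_density_def weight_B_eq rate_prod_eq[OF k1 t] rr
    by (simp add: exp_add mult_ac)
qed

lemma bessel_transition_drift_density:
  fixes x w :: "'n::{finite,linorder} rvec"
  obtains Z where "\<And>A. bessel_transition_B (k1, k2) (k1 *\<^sub>R w) (t / k1) x A =
    Z * (LINT y:A|lborel. drift_density k1 k2 x w t y)"
proof
  fix A :: "'n rvec set"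
  let ?\<tau> = "t / k1"
  define c where "c = 2 ^ CARD('n) * fact CARD('n) * norm_const_B TYPE('n) (k1, k2) *
    exp (- (norm (k1 *\<^sub>R w))\<^sup>2 * ?\<tau> / 2) / ?\<tau> powr (gamma_B TYPE('n) (k1, k2) + real CARD('n) / 2)"
  define d where "d = exp (- (norm x)\<^sup>2 / (2 * ?\<tau>)) / bessel_B (k1, k2) x (k1 *\<^sub>R w)"
  have "exp (- ((norm x)\<^sup>2 + (norm y)\<^sup>2) / (2 * ?\<tau>)) *
      (bessel_B (k1, k2) (x /\<^sub>R sqrt ?\<tau>) (y /\<^sub>R sqrt ?\<tau>) * bessel_B (k1, k2) y (k1 *\<^sub>R w) /
        bessel_B (k1, k2) x (k1 *\<^sub>R w)) * weight_B (k1, k2) y = d * drift_density k1 k2 x w t y" for y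
  proof -
    have "exp (- ((norm x)\<^sup>2 + (norm y)\<^sup>2) / (2 * ?\<tau>)) =
        exp (- (norm x)\<^sup>2 / (2 * ?\<tau>)) * exp (- (norm y)\<^sup>2 / (2 * ?\<tau>))"
      by (simp only: exp_add[symmetric] add_divide_distrib[symmetric] minus_add_distrib)
    then show ?thesis unfolding d_def drift_density_def by (simp only: times_divide_eq_left times_divide_eq_right mult_ac)
  qed
  then show "bessel_transition_B (k1, k2) (k1 *\<^sub>R w) (t / k1) x A =
      (c * d) * (LINT y:A|lborel. drift_density k1 k2 x w t y)"
    unfolding bessel_transition_B_def c_def[symmetric] by simp
qed

section \<open>Concentration at the freezing limit\<close>

lemma gaussian_integral:
  fixes v :: "'v::euclidean_space"
  assumes c: "0 < c"
  shows "integrable lborel (\<lambda>y. exp (- c * (norm (y - v))\<^sup>2))"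
    and "(LINT y|lborel. exp (- c * (norm (y - v))\<^sup>2)) = sqrt (pi / c) ^ DIM('v)"
proof -
  have 1: "(\<integral>\<^sup>+u. ennreal (exp (- c * (u - m)\<^sup>2)) \<partial>lborel) = ennreal (sqrt (pi / c))" for m :: real
  proof -
    define \<sigma> where "\<sigma> = 1 / sqrt (2 * c)"
    have \<sigma>: "\<sigma> > 0" "\<sigma>\<^sup>2 = 1 / (2 * c)" using c by (auto simp: \<sigma>_def power_divide)
    have eq: "exp (- c * (u - m)\<^sup>2) = sqrt (pi / c) * normal_density m \<sigma> u" for u
      using c by (simp add: normal_density_def \<sigma>(2) real_sqrt_divide)
    have "(\<integral>\<^sup>+u. ennreal (exp (- c * (u - m)\<^sup>2)) \<partial>lborel)
        = ennreal (\<integral>u. sqrt (pi / c) * normal_density m \<sigma> u \<partial>lborel)"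
      unfolding eq using c \<sigma> by (intro nn_integral_eq_integral) auto
    then show ?thesis using \<sigma> by simp
  qed
  have prod: "exp (- c * (norm (y - v))\<^sup>2) = (\<Prod>b\<in>Basis. exp (- c * (y \<bullet> b - v \<bullet> b)\<^sup>2))" for y :: 'v
  proof -
    have "(norm (y - v))\<^sup>2 = (\<Sum>b\<in>Basis. (y \<bullet> b - v \<bullet> b)\<^sup>2)"
      unfolding power2_norm_eq_inner
      by (subst euclidean_inner) (simp add: power2_eq_square inner_diff_left)
    then show ?thesis by (simp add: exp_sum[symmetric] sum_distrib_left sum_negf)
  qed
  have "(\<integral>\<^sup>+y. ennreal (exp (- c * (norm (y - v))\<^sup>2)) \<partial>lborel)
      = (\<integral>\<^sup>+y. (\<Prod>b\<in>Basis. (\<lambda>u. ennreal (exp (- c * (u - v \<bullet> b)\<^sup>2))) (y \<bullet> b)) \<partial>lborel)"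
    by (subst prod_ennreal) (simp_all only: prod exp_ge_zero)
  also have "\<dots> = (\<Prod>b\<in>(Basis :: 'v set). \<integral>\<^sup>+u. ennreal (exp (- c * (u - v \<bullet> b)\<^sup>2)) \<partial>lborel)"
    by (rule nn_integral_lborel_prod) auto
  also have "\<dots> = ennreal (sqrt (pi / c) ^ DIM('v))"
    unfolding 1 using c by (simp add: ennreal_power)
  finally have nn: "(\<integral>\<^sup>+y. ennreal (exp (- c * (norm (y - v))\<^sup>2)) \<partial>lborel)
      = ennreal (sqrt (pi / c) ^ DIM('v))" .
  show int: "integrable lborel (\<lambda>y. exp (- c * (norm (y - v))\<^sup>2))"
    by (rule integrableI_nonneg) (simp_all only: nn, auto)
  show "(LINT y|lborel. exp (- c * (norm (y - v))\<^sup>2)) = sqrt (pi / c) ^ DIM('v)"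
    using nn c by (subst integral_eq_nn_integral) auto
qed

text \<open>
  Twice the number of later coordinates, so that values at consecutive coordinates differ by at
  least \<open>2\<close>.
\<close>

definition rank_below :: "'n::{finite,linorder} \<Rightarrow> real" where
  "rank_below i = 2 * real (card {j. i < j})"

text \<open>
  A cube of side \<open>\<rho>\<close> near \<open>v\<close> whose points have pairwise distances of at least \<open>\<rho>\<close> between their coordinates, even
  if coordinates of \<open>v\<close> coincide: there the weight of the long roots stays away from \<open>0\<close>. Coordinates are only
  increased, as \<open>rate_lower\<close> requires.
\<close>

definition freezing_box :: "'n::{finite,linorder} rvec \<Rightarrow> real \<Rightarrow> ('n rvec) set" where
  "freezing_box v \<rho> = cbox (\<chi> i. v $ i + \<rho> * rank_below i) (\<chi> i. v $ i + \<rho> * rank_below i + \<rho>)"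

lemma rank_below_less:
  assumes "i < (j :: 'n::{finite,linorder})" shows "rank_below j + 2 \<le> rank_below i"
proof -
  have "{k. j < k} \<subset> {k. i < k}" using assms by auto
  then have "card {k. j < k} < card {k. i < k}" by (intro psubset_card_mono) auto
  then show ?thesis by (simp add: rank_below_def)
qed

lemma rank_below_bounds:
  fixes i :: "'n::{finite,linorder}"
  shows "0 \<le> rank_below i" "rank_below i \<le> 2 * real CARD('n)"
  using card_mono[of UNIV "{j. i < j}"] by (auto simp: rank_below_def)

lemma freezing_box_props:
  fixes v :: "'n::{finite,linorder} rvec"
  assumes v: "v \<in> chamber_B" and \<rho>: "0 < \<rho>" and y: "y \<in> freezing_box v \<rho>"
  shows "v $ i \<le> y $ i" and "y $ i \<le> v $ i + \<rho> * (2 * real CARD('n) + 1)"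
    and "i < j \<Longrightarrow> y $ j + \<rho> \<le> y $ i" and "y \<in> chamber_B"
proof -
  have y1: "v $ i + \<rho> * rank_below i \<le> y $ i" "y $ i \<le> v $ i + \<rho> * rank_below i + \<rho>" for i
    using y by (auto simp: freezing_box_def mem_box_cart)
  have r: "0 \<le> \<rho> * rank_below i" "\<rho> * rank_below i \<le> \<rho> * (2 * real CARD('n))" for i :: 'n
    using \<rho> rank_below_bounds[of i] by auto
  show lower: "v $ i \<le> y $ i" for i using y1(1)[of i] r(1)[of i] by linarith
  show "y $ i \<le> v $ i + \<rho> * (2 * real CARD('n) + 1)"
    using y1(2)[of i] r(2)[of i] by (simp add: algebra_simps)
  show gap: "y $ j + \<rho> \<le> y $ i" if "i < j" for i j
  proof -
    have "\<rho> * (rank_below j + 2) \<le> \<rho> * rank_below i"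
      using rank_below_less[OF that] \<rho> by (intro mult_left_mono) auto
    moreover have "v $ j \<le> v $ i" using chamber_B_antimono[OF v] that by simp
    ultimately show ?thesis using y1(2)[of j] y1(1)[of i] by (simp add: algebra_simps)
  qed
  have "y $ j \<le> y $ i" if "i \<le> j" for i j
  proof (cases "i = j")
    case False
    then have "i < j" using that by simp
    from gap[OF this] show ?thesis using \<rho> by linarith
  qed simp
  moreover have "0 \<le> y $ i" for i using lower[of i] chamber_B_nonneg[OF v, of i] by linarith
  ultimately show "y \<in> chamber_B" by (simp add: chamber_B_def)
qed

lemma measure_freezing_box:
  assumes "0 \<le> \<rho>"
  shows "measure lborel (freezing_box (v :: 'n::{finite,linorder} rvec) \<rho>) = \<rho> ^ CARD('n)"
proof -
  let ?l = "(\<chi> i. v $ i + \<rho> * rank_below i) :: 'n rvec"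
    and ?u = "(\<chi> i. v $ i + \<rho> * rank_below i + \<rho>) :: 'n rvec"
  have "cbox ?l ?u \<noteq> {}" using assms by (simp add: interval_ne_empty_cart(1))
  then show ?thesis unfolding freezing_box_def
    using content_cbox_cart[of ?l ?u] by simp
qed

text \<open>
  At distance \<open>d \<ge> \<epsilon>\<close> from the limit point, the quadratic decay \<open>k d\<^sup>2 / B\<^sup>2\<close> is divided into four equal parts: one
  absorbs the weight of the long roots, one the error of the Bessel asymptotics, one is kept as a factor
  exponentially small in \<open>k\<close>, and one keeps the bound integrable.
\<close>

lemma laplace_exponent:
  fixes k \<epsilon> B c D \<delta> Y d n K :: real
  assumes eps: "0 < \<epsilon>" "\<epsilon> \<le> d" and B: "0 < B" and c: "0 \<le> c" and D: "0 \<le> D" and Y: "0 \<le> Y"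
    and \<delta>: "0 \<le> \<delta>" "2 * \<delta> * D * (1 / \<epsilon> + Y / \<epsilon>\<^sup>2) \<le> 1 / (4 * B\<^sup>2)"
    and k: "1 \<le> k" "8 * c * B\<^sup>2 \<le> k" and n: "0 \<le> n" "n \<le> d + Y"
  shows "- k * d\<^sup>2 / B\<^sup>2 + c * n\<^sup>2 + (2 * \<delta> * k * (n * D) + 2 * K)
    \<le> (2 * c * Y\<^sup>2 + 2 * K - k * (\<epsilon>\<^sup>2 / (4 * B\<^sup>2))) + - (1 / (4 * B\<^sup>2)) * d\<^sup>2"
proof -
  define q where "q = d\<^sup>2 / (4 * B\<^sup>2)"
  have dpos: "0 < d" using eps by simp
  have q0: "0 \<le> q" by (simp add: q_def)
  have "n\<^sup>2 \<le> (d + Y)\<^sup>2" using n by (intro power_mono) auto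
  also have "\<dots> \<le> 2 * d\<^sup>2 + 2 * Y\<^sup>2" using sum_squares_bound[of d Y] by (simp add: power2_eq_square algebra_simps)
  finally have "c * n\<^sup>2 \<le> c * (2 * d\<^sup>2 + 2 * Y\<^sup>2)" using c by (rule mult_left_mono)
  moreover have "2 * c * d\<^sup>2 \<le> k * q"
  proof -
    have "8 * c * B\<^sup>2 * d\<^sup>2 \<le> k * d\<^sup>2" using k(2) by (rule mult_right_mono) simp
    then show ?thesis using B by (simp add: q_def field_simps)
  qed
  ultimately have 1: "c * n\<^sup>2 \<le> k * q + 2 * c * Y\<^sup>2" by (simp add: algebra_simps)
  have "d + Y \<le> d\<^sup>2 * (1 / \<epsilon> + Y / \<epsilon>\<^sup>2)"
  proof -
    have "d * \<epsilon> \<le> d * d" using eps dpos by (intro mult_left_mono) auto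
    then have "d \<le> d\<^sup>2 / \<epsilon>" using eps by (simp add: field_simps power2_eq_square)
    moreover have "\<epsilon>\<^sup>2 \<le> d\<^sup>2" using eps by (intro power_mono) auto
    then have "Y * \<epsilon>\<^sup>2 \<le> Y * d\<^sup>2" using Y by (intro mult_left_mono) auto
    then have "Y \<le> d\<^sup>2 * Y / \<epsilon>\<^sup>2" using eps by (simp add: field_simps)
    ultimately show ?thesis by (simp add: algebra_simps)
  qed
  then have n2: "n \<le> d\<^sup>2 * (1 / \<epsilon> + Y / \<epsilon>\<^sup>2)" using n by simp
  have "2 * \<delta> * k * (n * D) = (2 * \<delta> * D * k) * n" by simp
  also have "\<dots> \<le> (2 * \<delta> * D * k) * (d\<^sup>2 * (1 / \<epsilon> + Y / \<epsilon>\<^sup>2))"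
    using \<delta> D k by (intro mult_left_mono n2) auto
  also have "\<dots> = (2 * \<delta> * D * (1 / \<epsilon> + Y / \<epsilon>\<^sup>2)) * (k * d\<^sup>2)" by (simp add: algebra_simps)
  also have "\<dots> \<le> 1 / (4 * B\<^sup>2) * (k * d\<^sup>2)" using k by (intro mult_right_mono \<delta>) auto
  also have "\<dots> = k * q" by (simp add: q_def)
  finally have 2: "2 * \<delta> * k * (n * D) \<le> k * q" .
  have 3: "- k * d\<^sup>2 / B\<^sup>2 = - 4 * (k * q)" using B by (simp add: q_def)
  have 4: "k * (\<epsilon>\<^sup>2 / (4 * B\<^sup>2)) \<le> k * q"
    unfolding q_def using eps k by (intro mult_left_mono divide_right_mono power_mono) auto
  have 5: "q \<le> k * q" using k(1) q0 by (simp add: mult_le_cancel_right1)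
  have 6: "- (1 / (4 * B\<^sup>2)) * d\<^sup>2 = - q" by (simp add: q_def)
  show ?thesis using 1 2 4 5 unfolding 3 6 by linarith
qed

text \<open>
  The mass of the far region is compared with that of \<open>freezing_box\<close>, whose own mass is at most one, so the
  normalisation \<open>Z\<close> is eliminated. First \<open>\<eta>\<close> is fixed by the decay over distance \<open>\<epsilon>\<close>; then \<open>\<rho>\<close> and the precision
  \<open>\<delta>\<close> of the Bessel asymptotics are chosen so small that on the box at most half of that decay is lost.
\<close>

lemma bessel_transition_concentrates:
  fixes k2 \<epsilon> t0 b :: real
  assumes k2: "0 \<le> k2" and \<epsilon>: "0 < \<epsilon>" and t0: "0 < t0" "t0 \<le> b"
  obtains C \<eta> k0 where "0 < \<eta>" and
    "\<And>k1 t (x :: 'n::{finite,linorder} rvec) w. k0 \<le> k1 \<Longrightarrow> x \<in> chamber_B \<Longrightarrow> w \<in> chamber_B \<Longrightarrow>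
      norm x \<le> b \<Longrightarrow> norm w \<le> b \<Longrightarrow> t0 \<le> t \<Longrightarrow> t \<le> b \<Longrightarrow>
      (\<And>y :: 'n rvec. y \<in> chamber_B \<Longrightarrow> \<exists>f. dunkl_eigen (k1, k2) y f) \<Longrightarrow>
      bessel_transition_B (k1, k2) (k1 *\<^sub>R w) (t / k1) x chamber_B = 1 \<Longrightarrow>
      (\<And>A. A \<in> sets borel \<Longrightarrow> A \<subseteq> chamber_B \<Longrightarrow>
        bessel_transition_B (k1, k2) (k1 *\<^sub>R w) (t / k1) x A \<le> 1) \<Longrightarrow>
      bessel_transition_B (k1, k2) (k1 *\<^sub>R w) (t / k1) x
        {y \<in> chamber_B. \<epsilon> \<le> norm (y - freezing_limit x w t)} \<le> C * exp (- \<eta> * k1)"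
proof -
  let ?N = "real CARD('n)"
  have b: "0 < b" using t0 by simp
  define B where "B = sqrt (b\<^sup>2 + b\<^sup>2 * b\<^sup>2 + 2 * b * (b\<^sup>2 + 1))"
  have B: "0 < B" using b by (simp add: B_def add_pos_nonneg)
  define Y where "Y = ?N * B"
  define c where "c = 2 * k2 * real (CARD('n)\<^sup>2)"
  define D where "D = b / t0 + b"
  define m where "m = 2 * ?N + 1"
  define Y' where "Y' = Y + ?N * m"
  have pos: "0 < Y" "0 \<le> c" "0 < D" "0 < m" "0 < Y'"
    using B b t0 k2 by (auto simp: Y_def c_def D_def m_def Y'_def add_pos_pos add_pos_nonneg)
  define \<eta> where "\<eta> = \<epsilon>\<^sup>2 / (8 * B\<^sup>2)"
  have \<eta>: "0 < \<eta>" using \<epsilon> B by (simp add: \<eta>_def)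
  define \<delta> where "\<delta> = min (1 / 2) (min (\<eta> / 2 / (2 * D * Y')) (1 / (4 * B\<^sup>2) / (2 * D * (1 / \<epsilon> + Y / \<epsilon>\<^sup>2))))"
  have den: "0 < 2 * D * Y'" "0 < 2 * D * (1 / \<epsilon> + Y / \<epsilon>\<^sup>2)"
    using pos \<epsilon> by (auto intro!: mult_pos_pos add_pos_pos)
  have \<delta>: "0 < \<delta>" "\<delta> < 1"
    using den \<eta> B by (auto simp: \<delta>_def)
  have \<delta>1: "\<delta> * (2 * D * Y') \<le> \<eta> / 2"
    unfolding pos_le_divide_eq[OF den(1), symmetric] by (simp only: \<delta>_def min.coboundedI1 min.coboundedI2 min.cobounded1 min.cobounded2 order_refl)
  have \<delta>2: "\<delta> * (2 * D * (1 / \<epsilon> + Y / \<epsilon>\<^sup>2)) \<le> 1 / (4 * B\<^sup>2)"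
    unfolding pos_le_divide_eq[OF den(2), symmetric] by (simp only: \<delta>_def min.coboundedI1 min.coboundedI2 min.cobounded1 min.cobounded2 order_refl)
  define \<rho> where "\<rho> = min 1 (\<eta> / 2 / (?N * (m * (2 * B + m) / (2 * t0))))"
  have den3: "0 < ?N * (m * (2 * B + m) / (2 * t0))" using pos B t0 by (auto intro!: mult_pos_pos divide_pos_pos)
  have "0 < \<eta> / 2 / (?N * (m * (2 * B + m) / (2 * t0)))"
    using \<eta> by (intro divide_pos_pos den3) auto
  then have \<rho>: "0 < \<rho>" "\<rho> \<le> 1" by (simp_all only: \<rho>_def min_less_iff_conj min.cobounded1 zero_less_one simp_thms)
  have \<rho>1: "\<rho> * (?N * (m * (2 * B + m) / (2 * t0))) \<le> \<eta> / 2"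
    unfolding pos_le_divide_eq[OF den3, symmetric] by (simp only: \<rho>_def min.cobounded2)
  obtain K where K: "\<And>k1 (x :: 'n rvec) y f. 0 < k1 \<Longrightarrow> x \<in> chamber_B \<Longrightarrow> y \<in> chamber_B \<Longrightarrow>
      dunkl_eigen (k1, k2) y f \<Longrightarrow>
      0 < bessel_B (k1, k2) x y \<and>
      \<bar>ln (bessel_B (k1, k2) x y) - k1 * (\<Sum>i\<in>UNIV. phi (x $ i * y $ i / k1))\<bar> \<le> 2 * \<delta> * (norm x * norm y) + K"
    using bessel_B_asymptotics[where 'n = 'n, OF k2 \<delta>] by blast
  define P where "P = ((\<rho>\<^sup>2) powr (2 * k2)) ^ card {(i :: 'n, j). i < j}"
  have P: "0 < P" using \<rho> by (simp add: P_def)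
  define G where "G = sqrt (pi / (1 / (4 * B\<^sup>2))) ^ CARD('n)"
  have G: "0 \<le> G" using B by (simp add: G_def)
  define C where "C = exp (2 * c * Y\<^sup>2 + 2 * K) * G / (P * exp (- 2 * K) * \<rho> ^ CARD('n))"
  show thesis
  proof (rule that[of \<eta> "max 1 (8 * c * B\<^sup>2)" C, OF \<eta>])
    fix k1 t :: real and x w :: "'n rvec"
    assume "max 1 (8 * c * B\<^sup>2) \<le> k1" and x: "x \<in> chamber_B" "norm x \<le> b" and w: "w \<in> chamber_B" "norm w \<le> b"
      and t: "t0 \<le> t" "t \<le> b"
      and ex: "\<And>y :: 'n rvec. y \<in> chamber_B \<Longrightarrow> \<exists>f. dunkl_eigen (k1, k2) y f"
      and mass: "bessel_transition_B (k1, k2) (k1 *\<^sub>R w) (t / k1) x chamber_B = 1"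
      and le1: "\<And>A. A \<in> sets borel \<Longrightarrow> A \<subseteq> chamber_B \<Longrightarrow>
        bessel_transition_B (k1, k2) (k1 *\<^sub>R w) (t / k1) x A \<le> 1"
    have k1: "1 \<le> k1" "8 * c * B\<^sup>2 \<le> k1" "0 < k1" using \<open>max 1 (8 * c * B\<^sup>2) \<le> k1\<close> by auto
    have tpos: "0 < t" using t t0 by simp
    let ?v = "freezing_limit x w t" and ?H = "drift_density k1 k2 x w t"
    let ?far = "{y \<in> chamber_B. \<epsilon> \<le> norm (y - ?v)}" and ?near = "freezing_box ?v \<rho>"
    define Q where "Q = rate_prod k1 x w t ?v"
    have Q: "0 < Q" unfolding Q_def by (rule rate_prod_pos[OF tpos])
    have vC: "?v \<in> chamber_B" by (rule freezing_limit_in_chamber_B[OF x(1) w(1) tpos])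
    have vB: "?v $ i \<le> B" for i
      unfolding freezing_limit_nth B_def
      by (rule frozen_le)
        (use component_le_norm_cart[of x i] component_le_norm_cart[of w i] x w t tpos in auto)
    have vY: "norm ?v \<le> Y"
    proof -
      have "norm ?v \<le> (\<Sum>i\<in>UNIV. \<bar>?v $ i\<bar>)" by (rule norm_le_l1_cart)
      also have "\<dots> \<le> (\<Sum>i\<in>(UNIV :: 'n set). B)"
        using vB chamber_B_nonneg[OF vC] by (intro sum_mono) simp
      finally show ?thesis by (simp add: Y_def)
    qed
    have xwD: "norm x / t + norm w \<le> D"
      unfolding D_def using x w t t0 b by (intro add_mono frac_le) auto
    define r where "r y = 2 * \<delta> * k1 * (norm y * (norm x / t + norm w)) + 2 * K" for y :: "'n rvec"
    have bounds: "rate_prod k1 x w t y * pair_weight k2 y * exp (- r y) \<le> ?H y"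
      "?H y \<le> rate_prod k1 x w t y * pair_weight k2 y * exp (r y)" if "y \<in> chamber_B" for y
      unfolding r_def using drift_density_bounds[OF K ex k1(3) tpos x(1) w(1) that] by auto
    have rD: "r y \<le> 2 * \<delta> * k1 * (norm y * D) + 2 * K" for y
      unfolding r_def using xwD \<delta> k1 by (intro add_mono mult_left_mono) auto
    have H0: "0 \<le> ?H y" if "y \<in> chamber_B" for y
    proof -
      have "0 \<le> rate_prod k1 x w t y * pair_weight k2 y * exp (- r y)"
        by (intro mult_nonneg_nonneg rate_prod_nonneg pair_weight_nonneg) simp
      also note bounds(1)[OF that]
      finally show ?thesis .
    qed
    obtain Z where Z: "\<And>A. bessel_transition_B (k1, k2) (k1 *\<^sub>R w) (t / k1) x A = Z * (LINT y:A|lborel. ?H y)"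
      using bessel_transition_drift_density by blast
    (* A function that is not integrable has integral 0, whereas the total mass is 1. *)
    have intC: "set_integrable lborel chamber_B ?H"
    proof (rule ccontr)
      assume "\<not> set_integrable lborel chamber_B ?H"
      then have "(LINT y:chamber_B|lborel. ?H y) = 0"
        unfolding set_integrable_def set_lebesgue_integral_def by (rule not_integrable_integral_eq)
      then show False using mass Z by simp
    qed
    have far: "?far \<in> sets borel" "?far \<subseteq> chamber_B"
    proof -
      have "closed ?far"
        unfolding Collect_conj_eq Collect_mem_eq
        by (intro closed_Int closed_chamber_B closed_Collect_le continuous_intros)
      then show "?far \<in> sets borel" by simp
    qed auto
    have near: "?near \<in> sets borel" "?near \<subseteq> chamber_B"
      using freezing_box_props(4)[OF vC \<rho>(1)] by (auto simp: freezing_box_def)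
    have int_far: "set_integrable lborel ?far ?H" and int_near: "set_integrable lborel ?near ?H"
      using far near by (auto intro: set_integrable_subset[OF intC])
    define F where "F = Q * exp (2 * c * Y\<^sup>2 + 2 * K - k1 * (\<epsilon>\<^sup>2 / (4 * B\<^sup>2)))"
    have F: "0 \<le> F" using Q by (simp add: F_def)
    let ?g = "\<lambda>y. F * exp (- (1 / (4 * B\<^sup>2)) * (norm (y - ?v))\<^sup>2)"
    have up: "?H y \<le> ?g y" if y: "y \<in> ?far" for y
    proof -
      have yC: "y \<in> chamber_B" and d: "\<epsilon> \<le> norm (y - ?v)" using y by auto
      have ny: "norm y \<le> norm (y - ?v) + Y"
        using norm_triangle_ineq[of "y - ?v" ?v] vY by simp
      have "?H y \<le> rate_prod k1 x w t y * pair_weight k2 y * exp (r y)" by (rule bounds(2)[OF yC])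
      also have "\<dots> \<le> (Q * exp (- k1 * (norm (y - ?v))\<^sup>2 / B\<^sup>2)) * exp (c * (norm y)\<^sup>2) *
          exp (2 * \<delta> * k1 * (norm y * D) + 2 * K)"
        unfolding Q_def c_def
        using rate_prod_le[OF k1(3) tpos yC vB] pair_weight_le[OF k2, of y] rD[of y] Q
        by (intro mult_mono mult_nonneg_nonneg rate_prod_nonneg pair_weight_nonneg) (auto simp: Q_def)
      also have "\<dots> = Q * exp (- k1 * (norm (y - ?v))\<^sup>2 / B\<^sup>2 + c * (norm y)\<^sup>2 + (2 * \<delta> * k1 * (norm y * D) + 2 * K))"
        by (simp only: exp_add mult.assoc)
      also have "\<dots> \<le> Q * exp ((2 * c * Y\<^sup>2 + 2 * K - k1 * (\<epsilon>\<^sup>2 / (4 * B\<^sup>2))) + - (1 / (4 * B\<^sup>2)) * (norm (y - ?v))\<^sup>2)"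
      proof -
        have "2 * \<delta> * D * (1 / \<epsilon> + Y / \<epsilon>\<^sup>2) \<le> 1 / (4 * B\<^sup>2)" using \<delta>2 by (simp only: mult_ac)
        then have "- k1 * (norm (y - ?v))\<^sup>2 / B\<^sup>2 + c * (norm y)\<^sup>2 + (2 * \<delta> * k1 * (norm y * D) + 2 * K)
          \<le> (2 * c * Y\<^sup>2 + 2 * K - k1 * (\<epsilon>\<^sup>2 / (4 * B\<^sup>2))) + - (1 / (4 * B\<^sup>2)) * (norm (y - ?v))\<^sup>2"
          using \<epsilon> d B pos \<delta> k1 ny by (intro laplace_exponent) auto
        then show ?thesis using Q by (intro mult_left_mono) auto
      qed
      also have "\<dots> = ?g y" by (simp only: F_def exp_add mult.assoc)
      finally show ?thesis .
    qed
    have a0: "0 < 1 / (4 * B\<^sup>2)" using B by simp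
    have intg: "integrable lborel ?g" using gaussian_integral(1)[OF a0, of ?v] by simp
    have "(LINT y:?far|lborel. ?H y) \<le> (LINT y|lborel. ?g y)"
      unfolding set_lebesgue_integral_def
    proof (rule integral_mono)
      show "integrable lborel (\<lambda>y. indicator ?far y *\<^sub>R ?H y)" using int_far by (simp add: set_integrable_def)
      show "indicator ?far y *\<^sub>R ?H y \<le> ?g y" for y
        using up[of y] F by (cases "y \<in> ?far") (auto simp: indicator_def)
    qed (rule intg)
    also have "\<dots> = F * G"
      using gaussian_integral(2)[OF a0, of ?v] by (simp add: G_def)
    finally have If: "(LINT y:?far|lborel. ?H y) \<le> F * G" .
    define L where "L = Q * P * exp (- k1 * \<eta> - 2 * K)"
    have L: "0 < L" using Q P by (simp add: L_def)
    have low: "L \<le> ?H y" if y: "y \<in> ?near" for y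
    proof -
      note pr = freezing_box_props[OF vC \<rho>(1) y]
      have dy: "0 \<le> y $ i - ?v $ i" "y $ i - ?v $ i \<le> \<rho> * m" for i
        using pr(1,2)[of i] by (auto simp: m_def)
      have dm: "\<rho> * m \<le> m" using \<rho> pos by (simp add: mult_left_le_one_le)
      have sq: "(y $ i)\<^sup>2 - (?v $ i)\<^sup>2 \<le> \<rho> * (m * (2 * B + m))" for i
      proof -
        have "(y $ i)\<^sup>2 - (?v $ i)\<^sup>2 = (y $ i - ?v $ i) * (y $ i + ?v $ i)"
          by (simp add: power2_eq_square algebra_simps)
        also have "\<dots> \<le> (\<rho> * m) * (2 * B + m)"
          using dy[of i] dm vB[of i] chamber_B_nonneg[OF vC, of i] by (intro mult_mono) auto
        finally show ?thesis by simp
      qed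
      have "norm (y - ?v) \<le> (\<Sum>i\<in>UNIV. \<bar>(y - ?v) $ i\<bar>)" by (rule norm_le_l1_cart)
      also have "\<dots> \<le> (\<Sum>i\<in>(UNIV :: 'n set). m)"
      proof (rule sum_mono)
        fix i show "\<bar>(y - ?v) $ i\<bar> \<le> m" using dy[of i] dm by simp
      qed
      finally have "norm y \<le> Y'"
        using norm_triangle_ineq[of "y - ?v" ?v] vY by (simp add: Y'_def)
      then have ry: "r y \<le> k1 * (\<eta> / 2) + 2 * K"
      proof -
        have "2 * \<delta> * k1 * (norm y * D) \<le> 2 * \<delta> * k1 * (Y' * D)"
          using \<open>norm y \<le> Y'\<close> \<delta> k1 pos by (intro mult_left_mono mult_right_mono) auto
        also have "\<dots> = k1 * (\<delta> * (2 * D * Y'))" by simp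
        also have "\<dots> \<le> k1 * (\<eta> / 2)" using \<delta>1 k1 by (intro mult_left_mono) auto
        finally show ?thesis using rD[of y] by linarith
      qed
      have "?N * (\<rho> * (m * (2 * B + m)) / (2 * t)) \<le> \<eta> / 2"
      proof -
        have "?N * (\<rho> * (m * (2 * B + m)) / (2 * t)) \<le> ?N * (\<rho> * (m * (2 * B + m)) / (2 * t0))"
          using t t0 pos \<rho> B by (intro mult_left_mono divide_left_mono) auto
        also have "\<dots> \<le> \<eta> / 2" using \<rho>1 by (simp add: mult_ac)
        finally show ?thesis .
      qed
      then have "k1 * (?N * (\<rho> * (m * (2 * B + m)) / (2 * t))) \<le> k1 * (\<eta> / 2)"
        using k1 by (intro mult_left_mono) auto
      then have ex1: "exp (- k1 * (\<eta> / 2)) \<le> exp (- k1 * (?N * (\<rho> * (m * (2 * B + m)) / (2 * t))))" by simp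
      have "L = (Q * exp (- k1 * (\<eta> / 2))) * P * exp (- (k1 * (\<eta> / 2) + 2 * K))"
      proof -
        have "exp (- k1 * \<eta> - 2 * K) = exp (- k1 * (\<eta> / 2)) * exp (- (k1 * (\<eta> / 2) + 2 * K))"
          by (simp add: exp_add[symmetric])
        then show ?thesis by (simp add: L_def mult_ac)
      qed
      also have "\<dots> \<le> rate_prod k1 x w t y * pair_weight k2 y * exp (- r y)"
      proof (intro mult_mono)
        have "Q * exp (- k1 * (\<eta> / 2)) \<le> Q * exp (- k1 * (?N * (\<rho> * (m * (2 * B + m)) / (2 * t))))"
          using Q by (intro mult_left_mono[OF ex1]) simp
        also have "\<dots> \<le> rate_prod k1 x w t y"
          unfolding Q_def by (rule rate_prod_ge[OF k1(3) tpos x(1) w(1) pr(1) sq])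
        finally show "Q * exp (- k1 * (\<eta> / 2)) \<le> rate_prod k1 x w t y" .
        show "P \<le> pair_weight k2 y"
          unfolding P_def by (rule pair_weight_ge[OF k2 \<rho>(1) chamber_B_nonneg[OF pr(4)] pr(3)])
        show "exp (- (k1 * (\<eta> / 2) + 2 * K)) \<le> exp (- r y)" using ry by simp
      qed (use Q P in \<open>auto intro: rate_prod_nonneg pair_weight_nonneg mult_nonneg_nonneg\<close>)
      also have "\<dots> \<le> ?H y" by (rule bounds(1)[OF pr(4)])
      finally show ?thesis .
    qed
    have fin: "emeasure lborel ?near \<noteq> \<infinity>" unfolding freezing_box_def
      by (rule less_imp_neq[OF emeasure_lborel_cbox_finite])
    have "L * \<rho> ^ CARD('n) = (LINT y:?near|lborel. L)"
      using near(1) fin \<rho> by (simp add: set_integral_const measure_freezing_box)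
    also have "\<dots> \<le> (LINT y:?near|lborel. ?H y)"
    proof (rule set_integral_mono[OF _ int_near low])
      show "set_integrable lborel ?near (\<lambda>y. L)"
        unfolding set_integrable_def using near(1) fin by (simp add: top.not_eq_extremum)
    qed
    finally have In: "L * \<rho> ^ CARD('n) \<le> (LINT y:?near|lborel. ?H y)" .
    define I where "I = L * \<rho> ^ CARD('n)"
    have I: "0 < I" using L \<rho> by (simp add: I_def)
    have "Z * I \<le> 1"
    proof (cases "0 \<le> Z")
      case True
      then have "Z * I \<le> Z * (LINT y:?near|lborel. ?H y)" using In by (simp add: I_def mult_left_mono)
      also have "\<dots> \<le> 1" using le1[OF near] Z by simp
      finally show ?thesis .
    next
      case False
      then have "Z * I \<le> 0" using I by (simp add: mult_nonpos_nonneg)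
      then show ?thesis by simp
    qed
    then have Z1: "Z \<le> 1 / I" using I by (simp add: pos_le_divide_eq)
    have If0: "0 \<le> (LINT y:?far|lborel. ?H y)"
      unfolding set_lebesgue_integral_def by (rule Bochner_Integration.integral_nonneg) (auto simp: indicator_def H0)
    have "bessel_transition_B (k1, k2) (k1 *\<^sub>R w) (t / k1) x ?far = Z * (LINT y:?far|lborel. ?H y)" by (rule Z)
    also have "\<dots> \<le> 1 / I * (LINT y:?far|lborel. ?H y)" by (rule mult_right_mono[OF Z1 If0])
    also have "\<dots> \<le> 1 / I * (F * G)" using I by (intro mult_left_mono[OF If]) simp
    also have "\<dots> = C * exp (- \<eta> * k1)"
    proof -
      have "exp (2 * c * Y\<^sup>2 + 2 * K - k1 * (\<epsilon>\<^sup>2 / (4 * B\<^sup>2))) =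
          exp (2 * c * Y\<^sup>2 + 2 * K) * exp (- \<eta> * k1) * exp (- k1 * \<eta>)"
        unfolding exp_add[symmetric] \<eta>_def using B by (simp add: field_simps)
      then have 1: "F = Q * (exp (2 * c * Y\<^sup>2 + 2 * K) * exp (- \<eta> * k1) * exp (- k1 * \<eta>))"
        by (simp add: F_def)
      have "exp (- k1 * \<eta> - 2 * K) = exp (- k1 * \<eta>) * exp (- 2 * K)"
        unfolding exp_add[symmetric] by simp
      then have 2: "I = Q * P * (exp (- k1 * \<eta>) * exp (- 2 * K)) * \<rho> ^ CARD('n)"
        by (simp only: I_def L_def)
      have "a / (q * p * (e * h) * s) * (q * (u * v * e) * g) = a * (u * g / (p * h * s)) * v"
        if "q \<noteq> 0" "e \<noteq> 0" for a q p e h s u v g :: real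
        using that by (simp add: field_simps)
      from this[of Q "exp (- k1 * \<eta>)" 1] show ?thesis unfolding 1 2 C_def using Q by simp
    qed
    finally show "bessel_transition_B (k1, k2) (k1 *\<^sub>R w) (t / k1) x ?far \<le> C * exp (- \<eta> * k1)" .
  qed
qed

lemma bessel_process_freezing_bound:
  fixes k2 \<epsilon> t0 b :: real
    and M :: "real \<Rightarrow> 'n::{finite,linorder} rvec \<Rightarrow> 'n rvec \<Rightarrow> 'a measure"
    and X :: "real \<Rightarrow> 'n rvec \<Rightarrow> 'n rvec \<Rightarrow> real \<Rightarrow> 'a \<Rightarrow> 'n rvec"
  assumes k2: "0 \<le> k2"
    and proc: "\<And>k1 w x. k1 > 0 \<Longrightarrow> w \<in> chamber_B \<Longrightarrow> x \<in> chamber_B \<Longrightarrow>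
      bessel_process_B (M k1 w x) (k1, k2) w x (X k1 w x)"
    and \<epsilon>: "0 < \<epsilon>" and t0: "0 < t0" "t0 \<le> b"
  obtains C \<eta> k0 where "0 < \<eta>" "0 < k0" and
    "\<And>k1 t x w. k0 \<le> k1 \<Longrightarrow> x \<in> chamber_B \<Longrightarrow> w \<in> chamber_B \<Longrightarrow>
      norm x \<le> b \<Longrightarrow> norm w \<le> b \<Longrightarrow> t0 \<le> t \<Longrightarrow> t \<le> b \<Longrightarrow>
      emeasure (M k1 (k1 *\<^sub>R w) x) {\<omega> \<in> space (M k1 (k1 *\<^sub>R w) x).
        \<epsilon> \<le> norm (X k1 (k1 *\<^sub>R w) x (t / k1) \<omega> - freezing_limit x w t)} \<le> ennreal (C * exp (- \<eta> * k1))"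
proof -
  show thesis
  proof (rule bessel_transition_concentrates[where 'n = 'n, OF k2 \<epsilon> t0])
    fix C \<eta> k0 :: real
    assume \<eta>: "0 < \<eta>" and conc:
    "\<And>k1 t (x :: 'n rvec) w. k0 \<le> k1 \<Longrightarrow> x \<in> chamber_B \<Longrightarrow> w \<in> chamber_B \<Longrightarrow>
      norm x \<le> b \<Longrightarrow> norm w \<le> b \<Longrightarrow> t0 \<le> t \<Longrightarrow> t \<le> b \<Longrightarrow>
      (\<And>y :: 'n rvec. y \<in> chamber_B \<Longrightarrow> \<exists>f. dunkl_eigen (k1, k2) y f) \<Longrightarrow>
      bessel_transition_B (k1, k2) (k1 *\<^sub>R w) (t / k1) x chamber_B = 1 \<Longrightarrow>
      (\<And>A. A \<in> sets borel \<Longrightarrow> A \<subseteq> chamber_B \<Longrightarrow>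
        bessel_transition_B (k1, k2) (k1 *\<^sub>R w) (t / k1) x A \<le> 1) \<Longrightarrow>
      bessel_transition_B (k1, k2) (k1 *\<^sub>R w) (t / k1) x
        {y \<in> chamber_B. \<epsilon> \<le> norm (y - freezing_limit x w t)} \<le> C * exp (- \<eta> * k1)"
  show thesis
  proof (rule that[of \<eta> "max k0 1" C])
    fix k1 t :: real and x w :: "'n rvec"
    assume k: "max k0 1 \<le> k1" and x: "x \<in> chamber_B" and w: "w \<in> chamber_B"
      and b: "norm x \<le> b" "norm w \<le> b" "t0 \<le> t" "t \<le> b"
    have k1: "k0 \<le> k1" "0 < k1" using k by auto
    have s: "0 < t / k1" using b t0 k1 by simp
    have kw: "k1 *\<^sub>R w \<in> chamber_B" using k1 w by (simp add: chamber_B_scaleR)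
    let ?M = "M k1 (k1 *\<^sub>R w) x" and ?X = "X k1 (k1 *\<^sub>R w) x"
    let ?far = "{y \<in> chamber_B. \<epsilon> \<le> norm (y - freezing_limit x w t)}"
    note pr = proc[OF k1(2) kw x]
    interpret prob_space ?M using pr by (simp add: bessel_process_B_def)
    have "closed ?far"
      unfolding Collect_conj_eq Collect_mem_eq
      by (intro closed_Int closed_chamber_B closed_Collect_le continuous_intros)
    then have far: "?far \<in> sets borel" "?far \<subseteq> chamber_B" by auto
    have "{\<omega> \<in> space ?M. \<epsilon> \<le> norm (?X (t / k1) \<omega> - freezing_limit x w t)}
        = {\<omega> \<in> space ?M. ?X (t / k1) \<omega> \<in> ?far}"
      using bessel_process_in_chamber[OF pr] s by auto
    then have "measure ?M {\<omega> \<in> space ?M. \<epsilon> \<le> norm (?X (t / k1) \<omega> - freezing_limit x w t)}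
        = bessel_transition_B (k1, k2) (k1 *\<^sub>R w) (t / k1) x ?far"
      using bessel_process_law[OF pr s far] by simp
    also have "\<dots> \<le> C * exp (- \<eta> * k1)"
    proof (rule conc[OF k1(1) x w b])
      show "\<exists>f. dunkl_eigen (k1, k2) y f" if "y \<in> chamber_B" for y :: "'n rvec"
        by (rule dunkl_eigen_exists[OF bessel_transition_chamber[OF proc[OF k1(2) _ zero_in_chamber_B]] that])
          auto
      show "bessel_transition_B (k1, k2) (k1 *\<^sub>R w) (t / k1) x chamber_B = 1"
        by (rule bessel_transition_chamber[OF pr s])
      show "bessel_transition_B (k1, k2) (k1 *\<^sub>R w) (t / k1) x A \<le> 1"
        if "A \<in> sets borel" "A \<subseteq> chamber_B" for A
        using bessel_process_law[OF pr s that] prob_le_1 by metis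
    qed
    finally have "measure ?M {\<omega> \<in> space ?M. \<epsilon> \<le> norm (?X (t / k1) \<omega> - freezing_limit x w t)}
        \<le> C * exp (- \<eta> * k1)" .
    then show "emeasure ?M {\<omega> \<in> space ?M. \<epsilon> \<le> norm (?X (t / k1) \<omega> - freezing_limit x w t)}
        \<le> ennreal (C * exp (- \<eta> * k1))"
      by (simp add: emeasure_eq_measure ennreal_leI)
  qed (use \<eta> in auto)
  qed
qed

lemma exp_bound_tendsto_0:
  fixes C \<eta> :: real assumes "0 < \<eta>" shows "((\<lambda>k. C * exp (- \<eta> * k)) \<longlongrightarrow> 0) at_top"
proof -
  have "filterlim (\<lambda>k. \<eta> * k) at_top at_top"
    using assms by (intro filterlim_tendsto_pos_mult_at_top[OF tendsto_const]) (auto intro: filterlim_ident)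
  then have "filterlim (\<lambda>k. - (\<eta> * k)) at_bot at_top" by (simp add: filterlim_uminus_at_bot)
  then have "((\<lambda>k. exp (- (\<eta> * k))) \<longlongrightarrow> 0) at_top" by (rule filterlim_compose[OF exp_at_bot])
  from tendsto_mult_right_zero[OF this, of C] show ?thesis by simp
qed

theorem theorem5p6:
  fixes k2 :: real
    and M :: "real \<Rightarrow> 'n::{finite,linorder} rvec \<Rightarrow> 'n rvec \<Rightarrow> 'a measure"
    and X :: "real \<Rightarrow> 'n rvec \<Rightarrow> 'n rvec \<Rightarrow> real \<Rightarrow> 'a \<Rightarrow> 'n rvec"
  assumes "k2 \<ge> 0"
    and "\<And>k1 w x. k1 > 0 \<Longrightarrow> w \<in> chamber_B \<Longrightarrow> x \<in> chamber_B \<Longrightarrow>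
      bessel_process_B (M k1 w x) (k1, k2) w x (X k1 w x)"
  shows "(\<forall>x\<in>chamber_B. \<forall>w\<in>chamber_B. \<forall>t>0. \<forall>\<epsilon>>0.
      ((\<lambda>k1. measure (M k1 (k1 *\<^sub>R w) x)
          {\<omega> \<in> space (M k1 (k1 *\<^sub>R w) x).
            norm (X k1 (k1 *\<^sub>R w) x (t / k1) \<omega> - freezing_limit x w t) \<ge> \<epsilon>})
        \<longlongrightarrow> 0) at_top) \<and>
    (\<forall>\<epsilon>>0. \<forall>U :: ('n rvec \<times> 'n rvec \<times> real) set.
      compact U \<and> U \<subseteq> chamber_B \<times> chamber_B \<times> {0<..} \<longrightarrow>
      ((\<lambda>k1. SUP (x, w, t)\<in>U. emeasure (M k1 (k1 *\<^sub>R w) x)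
          {\<omega> \<in> space (M k1 (k1 *\<^sub>R w) x).
            norm (X k1 (k1 *\<^sub>R w) x (t / k1) \<omega> - freezing_limit x w t) \<ge> \<epsilon>})
        \<longlongrightarrow> 0) at_top)"
proof -
  let ?S = "\<lambda>\<epsilon> U k1. SUP (x, w, t)\<in>U. emeasure (M k1 (k1 *\<^sub>R w) x) {\<omega> \<in> space (M k1 (k1 *\<^sub>R w) x).
      \<epsilon> \<le> norm (X k1 (k1 *\<^sub>R w) x (t / k1) \<omega> - freezing_limit x w t)}"
  have uniform: "(?S \<epsilon> U \<longlongrightarrow> 0) at_top"
    if \<epsilon>: "0 < \<epsilon>" and U: "compact U \<and> U \<subseteq> chamber_B \<times> chamber_B \<times> {0<..}"
    for \<epsilon> and U :: "('n rvec \<times> 'n rvec \<times> real) set"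
  proof -
    obtain t0 where t0: "0 < t0" "\<And>p. p \<in> U \<Longrightarrow> t0 \<le> snd (snd p)"
    proof (cases "U = {}")
      case False
      have "continuous_on U (\<lambda>p. snd (snd p))" by (intro continuous_intros)
      from continuous_attains_inf[OF conjunct1[OF U] False this]
      obtain q where q: "q \<in> U" "\<forall>p\<in>U. snd (snd q) \<le> snd (snd p)" by blast
      have "q \<in> chamber_B \<times> chamber_B \<times> {0<..}" using q(1) U by blast
      then have "0 < snd (snd q)" by auto
      then show thesis using q(2) by (intro that[of "snd (snd q)"]) auto
    qed (auto intro: that[of 1])
    obtain b' where b': "\<And>p. p \<in> U \<Longrightarrow> norm p \<le> b'"
      using U compact_imp_bounded bounded_iff by metis
    define b where "b = max b' t0"
    have b: "norm x \<le> b" "norm w \<le> b" "t \<le> b" if "(x, w, t) \<in> U" for x w t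
    proof -
      have "norm (x, w, t) \<le> b" using b'[OF that] by (simp add: b_def)
      moreover have "norm x \<le> norm (x, w, t)" "norm (w, t) \<le> norm (x, w, t)"
        using norm_fst_le[of x "(w, t)"] norm_snd_le[of "(w, t)" x] by auto
      moreover have "norm w \<le> norm (w, t)" "\<bar>t\<bar> \<le> norm (w, t)"
        using norm_fst_le[of w t] norm_snd_le[of t w] by auto
      ultimately show "norm x \<le> b" "norm w \<le> b" "t \<le> b" by linarith+
    qed
    have t0b: "t0 \<le> b" by (simp add: b_def)
    show "(?S \<epsilon> U \<longlongrightarrow> 0) at_top"
    proof (rule bessel_process_freezing_bound[OF assms \<epsilon> t0(1) t0b])
      fix C \<eta> k0 :: real
      assume \<eta>: "0 < \<eta>" and bound: "\<And>k1 t x w. k0 \<le> k1 \<Longrightarrow> x \<in> chamber_B \<Longrightarrow> w \<in> chamber_B \<Longrightarrow>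
        norm x \<le> b \<Longrightarrow> norm w \<le> b \<Longrightarrow> t0 \<le> t \<Longrightarrow> t \<le> b \<Longrightarrow>
        emeasure (M k1 (k1 *\<^sub>R w) x) {\<omega> \<in> space (M k1 (k1 *\<^sub>R w) x).
          \<epsilon> \<le> norm (X k1 (k1 *\<^sub>R w) x (t / k1) \<omega> - freezing_limit x w t)} \<le> ennreal (C * exp (- \<eta> * k1))"
      show ?thesis
      proof (rule tendsto_sandwich[OF _ _ tendsto_const])
        show "((\<lambda>k1. ennreal (C * exp (- \<eta> * k1))) \<longlongrightarrow> 0) at_top"
          using tendsto_ennrealI[OF exp_bound_tendsto_0[OF \<eta>, of C]] by simp
        show "\<forall>\<^sub>F k1 in at_top. ?S \<epsilon> U k1 \<le> ennreal (C * exp (- \<eta> * k1))"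
          using eventually_ge_at_top[of k0]
        proof eventually_elim
          case (elim k1)
          show ?case
          proof (rule SUP_least, clarify)
            fix x w t assume p: "(x, w, t) \<in> U"
            then have C: "x \<in> chamber_B" "w \<in> chamber_B" using U by auto
            have "t0 \<le> t" using t0(2)[OF p] by simp
            from bound[OF elim C b(1,2)[OF p] this b(3)[OF p]]
            show "emeasure (M k1 (k1 *\<^sub>R w) x) {\<omega> \<in> space (M k1 (k1 *\<^sub>R w) x).
              \<epsilon> \<le> norm (X k1 (k1 *\<^sub>R w) x (t / k1) \<omega> - freezing_limit x w t)} \<le> ennreal (C * exp (- \<eta> * k1))" .
          qed
        qed
      qed simp
    qed
  qed
  show ?thesis
  proof (intro conjI ballI allI impI)
    fix x w :: "'n rvec" and t \<epsilon> :: real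
    assume *: "x \<in> chamber_B" "w \<in> chamber_B" "0 < t" "0 < \<epsilon>"
    have "(?S \<epsilon> {(x, w, t)} \<longlongrightarrow> ennreal 0) at_top"
      using uniform[of \<epsilon> "{(x, w, t)}"] * by simp
    then have "((\<lambda>k1. enn2real (?S \<epsilon> {(x, w, t)} k1)) \<longlongrightarrow> 0) at_top"
      by (rule tendsto_enn2real) simp
    then show "((\<lambda>k1. measure (M k1 (k1 *\<^sub>R w) x) {\<omega> \<in> space (M k1 (k1 *\<^sub>R w) x).
        \<epsilon> \<le> norm (X k1 (k1 *\<^sub>R w) x (t / k1) \<omega> - freezing_limit x w t)}) \<longlongrightarrow> 0) at_top"
      by (simp add: measure_def)
  qed (rule uniform)
qed

end
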